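(* Let $\mathcal{H}$ be a separable Hilbert space with inner product $\langle\cdot,\cdot\rangle$, norm $\|\cdot\|_{\mathcal{H}}$ and orthonormal basis $\{e_j:j\in\mathbb{N}\}$. Let $N\ge1$ be an integer and let $\{Z_s:s\in\mathbb{Z}^N\}$ be a random field whose marginals take values in $\mathcal{H}$ and satisfy $\mathbb{E}[Z_s]=0$. Assume that, uniformly in $s\in\mathbb{Z}^N$, $$\mathbb{E}\left[\langle Z_s,e_j\rangle^2\right]\le d_0\exp(-d_1j)\ \text{ for all } j\in\mathbb{N}\quad\text{and}\quad \mathbb{P}(\|Z_s\|_{\mathcal{H}}\ge z)\le\kappa_0\exp(-\kappa_1z^\gamma)\ \text{ for all } z\ge 0,$$ for positive constants $d_0,d_1,\kappa_0,\kappa_1$ and $\gamma$. Assume that the $\alpha$-mixing coefficients of the random field satisfy $\alpha(k)\le c_0\exp(-c_1k)$, $k\in\mathbb{N}$, for some $c_0,c_1\in(0,\infty)$, and that $n\in\mathbb{N}^N$, with $|I_n|\ge2$, satisfies $\min_i n_i\ge C'\max_i n_i$ for a constant $C'>0$. Let $\epsilon>0$. Then there are constants $A_1$ and $A_2$ such that $$\mathbb{P}\left(|I_n|^{-1}\left\|\sum_{s\in I_n}Z_s\right\|_{\mathcal{H}}\ge\epsilon\right)\le A_1\exp\left\{-A_2\left(\frac{\epsilon|I_n|^{1/N}}{(\log|I_n|)^2}\right)^{2\gamma/(2+3\gamma)}\right\}.$$ Here $A_1$ and $A_2$ depend on the decay rate of the mixing coefficients, on the tail parameters $\gamma,\kappa_i,d_i$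 and on $C'$, but not on $n$, except that additionally $A_1$ depends polynomially on $|I_n|$ and $\epsilon$. If additionally $\gamma\ge1$, then there are constants $A_1,A_2$ which depend on the decay rate of the mixing coefficients, on the tail parameters $\gamma,\kappa_i,d_i$ and on $C'$, but not on $n$, and where $A_1$ does not depend on $\epsilon$ and $|I_n|$, such that $$\begin{aligned}\mathbb{P}\left(|I_n|^{-1}\left\|\sum_{s\in I_n}Z_s\right\|_{\mathcal{H}}\ge\epsilon\right)\le\ & A_1\exp\left\{-A_2\left(\frac{\epsilon|I_n|^{1/N}}{(\log|I_n|)^2}\right)^{2/5}\right\}\\ &\cdot\left\{\epsilon^{-2}+\left(\frac{\epsilon|I_n|^{1/N}}{(\log|I_n|)^2}\right)^{2/5}+\left(\frac{|I_n|^{1/N}}{(\log|I_n|)^2}\right)^{1/5}\epsilon^{-4/5}\right\}.\end{aligned}$$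
   Context: All random variables live on a probability space $(\Omega,\mathcal{A},\mathbb{P})$. For $n\in\mathbb{N}^N$, $I_n=\{s\in\mathbb{Z}^N: 1\le s_i\le n_i,\ i=1,\dots,N\}$, with cardinality $|I_n|$. Mixing coefficients: for sub-$\sigma$-algebras $\mathcal{F},\mathcal{G}\subseteq\mathcal{A}$, $\alpha(\mathcal{F},\mathcal{G})=\sup\{|\mathbb{P}(A\cap B)-\mathbb{P}(A)\mathbb{P}(B)|: A\in\mathcal{F},B\in\mathcal{G}\}$. For $I\subseteq\mathbb{Z}^N$ let $\mathcal{F}(I)=\sigma(Z_s:s\in I)$, and for $I,J\subseteq\mathbb{Z}^N$ let $d_\infty(I,J)=\inf\{\|s-t\|_{\max}:s\in I,t\in J\}$, where $\|\cdot\|_{\max}$ is the maximum norm. The $\alpha$-mixing coefficients of the random field are $\alpha(k)=\sup\{\alpha(\mathcal{F}(I),\mathcal{F}(J)): I,J\subseteq\mathbb{Z}^N,\ d_\infty(I,J)\ge k\}$, $k\in\mathbb{N}$.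
   Formalization: For N = 1 the constant A_2 may depend on ε in both inequalities: independence of ε fails there, e.g. for independent signs times e_1 with ε = |I_n|^{-1/2}/2. For N ≥ 2, A_2 does not depend on ε, as stated. *)

theory Defs
  imports "HOL-Probability.Probability"
begin

text \<open>The set of natural numbers is \<open>{1, 2, \<dots>}\<close> throughout: indices \<open>j\<close> of the basis and lags
  \<open>k\<close> of the mixing coefficients start at \<open>1\<close>. The lattice dimension \<open>N\<close> is the cardinality of the
  index type \<open>'N\<close>.\<close>

definition orthonormal_basis :: "(nat \<Rightarrow> 'h::real_inner) \<Rightarrow> bool" where
  "orthonormal_basis e \<longleftrightarrow>
     (\<forall>i\<ge>1. \<forall>j\<ge>1. e i \<bullet> e j = (if i = j then 1 else 0)) \<and>
     closure (span (e ` {1..})) = UNIV"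

definition lattice_box :: "nat ^ 'N \<Rightarrow> (int ^ 'N) set" where
  "lattice_box n = {s. \<forall>i. 1 \<le> s $ i \<and> s $ i \<le> int (n $ i)}"

definition max_norm :: "int ^ 'N::finite \<Rightarrow> int" where
  "max_norm s = Max (range (\<lambda>i. \<bar>s $ i\<bar>))"

text \<open>Extended real values, so that the distance to the empty set is \<open>\<infinity>\<close>.\<close>

definition d_infty :: "(int ^ 'N::finite) set \<Rightarrow> (int ^ 'N) set \<Rightarrow> ereal" where
  "d_infty I J = (INF (s, t) \<in> I \<times> J. ereal (real_of_int (max_norm (s - t))))"

definition alpha :: "'a measure \<Rightarrow> 'a set set \<Rightarrow> 'a set set \<Rightarrow> real" where
  "alpha M F G = (SUP (A, B) \<in> F \<times> G. \<bar>measure M (A \<inter> B) - measure M A * measure M B\<bar>)"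

definition sigma_field ::
  "'a measure \<Rightarrow> ('i \<Rightarrow> 'a \<Rightarrow> 'b::topological_space) \<Rightarrow> 'i set \<Rightarrow> 'a set set" where
  "sigma_field M Z I =
     sigma_sets (space M) {Z s -` B \<inter> space M | s B. s \<in> I \<and> B \<in> sets borel}"

definition alpha_mixing ::
  "'a measure \<Rightarrow> (int ^ 'N::finite \<Rightarrow> 'a \<Rightarrow> 'b::topological_space) \<Rightarrow> nat \<Rightarrow> real" where
  "alpha_mixing M Z k =
     (SUP (I, J) \<in> {(I, J). ereal (real k) \<le> d_infty I J}.
        alpha M (sigma_field M Z I) (sigma_field M Z J))"

text \<open>The two integrability requirements only express that the expectations exist; they follow
  from measurability and the tail bound.\<close>

definition mixing_hilbert_field ::
  "real \<Rightarrow> real \<Rightarrow> real \<Rightarrow> real \<Rightarrow> real \<Rightarrow> real \<Rightarrow> real \<Rightarrow> 'a measure \<Rightarrow>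
   (nat \<Rightarrow> 'h::{real_inner, banach, second_countable_topology}) \<Rightarrow>
   (int ^ 'N::finite \<Rightarrow> 'a \<Rightarrow> 'h) \<Rightarrow> bool" where
  "mixing_hilbert_field c\<^sub>0 c\<^sub>1 d\<^sub>0 d\<^sub>1 \<kappa>\<^sub>0 \<kappa>\<^sub>1 \<gamma> M e Z \<longleftrightarrow>
     prob_space M \<and> orthonormal_basis e \<and>
     (\<forall>s. Z s \<in> borel_measurable M) \<and>
     (\<forall>s. integrable M (Z s) \<and> (\<integral>\<omega>. Z s \<omega> \<partial>M) = 0) \<and>
     (\<forall>s. \<forall>j\<ge>1. integrable M (\<lambda>\<omega>. (Z s \<omega> \<bullet> e j)\<^sup>2) \<and>
        (\<integral>\<omega>. (Z s \<omega> \<bullet> e j)\<^sup>2 \<partial>M) \<le> d\<^sub>0 * exp (- d\<^sub>1 * real j)) \<and>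
     (\<forall>s. \<forall>z\<ge>0. \<P>(\<omega> in M. norm (Z s \<omega>) \<ge> z) \<le> \<kappa>\<^sub>0 * exp (- \<kappa>\<^sub>1 * z powr \<gamma>)) \<and>
     (\<forall>k\<ge>1. alpha_mixing M Z k \<le> c\<^sub>0 * exp (- c\<^sub>1 * real k))"

definition admissible_size :: "real \<Rightarrow> nat ^ 'N::finite \<Rightarrow> bool" where
  "admissible_size C' n \<longleftrightarrow>
     card (lattice_box n) \<ge> 2 \<and>
     real (Min (range (\<lambda>i. n $ i))) \<ge> C' * real (Max (range (\<lambda>i. n $ i)))"

definition mean_exceedance ::
  "'a measure \<Rightarrow> (int ^ 'N::finite \<Rightarrow> 'a \<Rightarrow> 'h::real_normed_vector) \<Rightarrow> nat ^ 'N \<Rightarrow> real \<Rightarrow> real"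
where
  "mean_exceedance M Z n \<epsilon> =
     \<P>(\<omega> in M. norm (\<Sum>s\<in>lattice_box n. Z s \<omega>) / real (card (lattice_box n)) \<ge> \<epsilon>)"

text \<open>The quantity \<open>|I\<^sub>n|\<^bsup>1/N\<^esup> / (log |I\<^sub>n|)\<^sup>2\<close>.\<close>

definition rate :: "nat ^ 'N::finite \<Rightarrow> real" where
  "rate n = real (card (lattice_box n)) powr (1 / real CARD('N)) / (ln (real (card (lattice_box n))))\<^sup>2"

end

theory Submission
  imports Defs
begin

text \<open>Slicing the box along its longest axis turns the field into a one-dimensional sequence of slab
  sums, so only the scalar case in dimension one is needed. For such a sequence the sum over an
  interval is an average, over all shifts, of sums over a Cantor-like subset; by convexity of the
  exponential it suffices to bound the Laplace transform over the Cantor set. Its gaps at each scale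
  are a fraction of order \<open>1 / log |I\<^sub>n|\<close> of the blocks they separate, which is just enough for
  the mixing error \<open>exp (- c\<^sub>1 gap)\<close> to beat the size of the exponential, and its base
  blocks have length of order \<open>(log |I\<^sub>n|)\<^sup>2\<close>; this is where the squared logarithm comes from.

  With \<open>x = \<epsilon> |I\<^sub>n|\<^bsup>1/N\<^esup> / (log |I\<^sub>n|)\<^sup>2\<close> and \<open>\<beta> = 2 \<gamma> / (2 + 3 \<gamma>)\<close>, the field is truncated in
  norm at \<open>x\<^bsup>\<beta>/\<gamma>\<^esup>\<close> and projected onto the first \<open>x\<^bsup>\<beta>\<^esup>\<close> basis vectors. The discarded parts
  and the scalar bound for each remaining coordinate all have size \<open>exp (- c x\<^bsup>\<beta>\<^esup>)\<close>, up to
  a polynomial factor. For \<open>\<gamma> \<ge> 1\<close> the polynomial factor is absorbed by the exponential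
  unless \<open>x\<close> is polylogarithmic in \<open>|I\<^sub>n|\<close>, and in that range \<open>\<epsilon>\<^bsup>-2\<^esup>\<close> is polynomially large.\<close>

section \<open>Covariances of bounded functions under mixing\<close>

text \<open>The mixing coefficient ignores the sizes of the index sets, so two groups of slabs at
  distance g decouple at a cost of order exp (-c1 g), however many sites a slab holds. In exchange
  the effective sample size is only one side length, at least |I_n|^(1/N). The exponent comes from a
  balance. With a tilt of order 1/(log |I_n|)^2, truncation at B and m coordinates at level
  \<epsilon>/sqrt m, the linear Chernoff term has order x/(B sqrt m); truncation contributes the
  exponent B^\<gamma>, projection the exponent m. Taking m = B^\<gamma> = x^\<beta> equates all
  three when 1 - \<beta>/2 - \<beta>/\<gamma> = \<beta>. The obstacle is the quadratic Chernoff
  term, of order v n_i/(log |I_n|)^2 for normalised slab variance v. For N \<ge> 2 summable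
  covariances give v of order 1/|slab|, and |slab| \<ge> C' n_i keeps the term bounded. For N = 1
  there is no such gain, and the term is held below half of the linear one by a tilt that shrinks
  with small \<epsilon>; hence \<open>A\<^sub>2\<close> depends on \<epsilon> there.\<close>

lemma discretise_unit:
  fixes y :: real and k :: nat
  assumes "0 \<le> y" "y \<le> 1" "k \<ge> 1"
  shows "\<bar>(\<Sum>i=1..k. (if real i / real k \<le> y then 1 else 0)) / real k - y\<bar> \<le> 1 / real k"
proof -
  have ky: "0 \<le> real k * y" "real k * y \<le> real k" using assms by (auto simp: mult_left_le)
  have "{i\<in>{1..k}. real i / real k \<le> y} = {1..nat \<lfloor>real k * y\<rfloor>}"
  proof -
    have "(real i / real k \<le> y) = (i \<le> nat \<lfloor>real k * y\<rfloor>)" for i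
    proof -
      have "(real i / real k \<le> y) = (real i \<le> real k * y)" using assms by (simp add: field_simps)
      also have "\<dots> = (int i \<le> \<lfloor>real k * y\<rfloor>)" by (simp add: le_floor_iff)
      also have "\<dots> = (i \<le> nat \<lfloor>real k * y\<rfloor>)" using ky by linarith
      finally show ?thesis .
    qed
    then have "{i\<in>{1..k}. real i / real k \<le> y} = {i\<in>{1..k}. i \<le> nat \<lfloor>real k * y\<rfloor>}" by (simp only:)
    moreover have "nat \<lfloor>real k * y\<rfloor> \<le> k" using ky by linarith
    ultimately show ?thesis by fastforce
  qed
  then have "(\<Sum>i=1..k. (if real i / real k \<le> y then 1 else 0)) = real (nat \<lfloor>real k * y\<rfloor>)"
    by (simp add: sum.If_cases Int_def)
  moreover have "\<bar>real (nat \<lfloor>real k * y\<rfloor>) - real k * y\<bar> \<le> 1" using ky by linarith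
  then have "\<bar>(real (nat \<lfloor>real k * y\<rfloor>) - real k * y) / real k\<bar> \<le> 1 / real k"
    using assms by (simp add: divide_right_mono)
  moreover have "(real (nat \<lfloor>real k * y\<rfloor>) - real k * y) / real k = real (nat \<lfloor>real k * y\<rfloor>) / real k - y"
    using assms by (simp add: field_simps)
  ultimately show ?thesis by simp
qed

lemma abs_mult_diff_le_unit:
  fixes a b c d :: real
  assumes "\<bar>a\<bar> \<le> 1" "\<bar>d\<bar> \<le> 1" "\<bar>a - c\<bar> \<le> e" "\<bar>b - d\<bar> \<le> e"
  shows "\<bar>a * b - c * d\<bar> \<le> 2 * e"
proof -
  have "a * b - c * d = a * (b - d) + (a - c) * d" by (simp add: algebra_simps)
  also have "\<bar>\<dots>\<bar> \<le> \<bar>a\<bar> * \<bar>b - d\<bar> + \<bar>a - c\<bar> * \<bar>d\<bar>" by (metis abs_mult abs_triangle_ineq)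
  also have "\<dots> \<le> 1 * e + e * 1" using assms by (intro add_mono mult_mono) auto
  finally show ?thesis by simp
qed

text \<open>A discrete layer-cake argument: f is within 1/k of the average of the indicators of the
  sets where f is at least i/k. The covariance of two such averages is an average of k^2 covariances
  of level sets, each at most \<open>a\<close>. Only finite sums occur, and k tends to infinity at
  the end.\<close>

lemma (in prob_space) covariance_le_unit:
  fixes f g :: "'a \<Rightarrow> real"
  assumes [measurable]: "f \<in> borel_measurable M" "g \<in> borel_measurable M"
    and f: "\<And>\<omega>. \<omega> \<in> space M \<Longrightarrow> 0 \<le> f \<omega> \<and> f \<omega> \<le> 1"
    and g: "\<And>\<omega>. \<omega> \<in> space M \<Longrightarrow> 0 \<le> g \<omega> \<and> g \<omega> \<le> 1"
    and a: "\<And>s t. \<bar>prob ({\<omega>\<in>space M. s \<le> f \<omega>} \<inter> {\<omega>\<in>space M. t \<le> g \<omega>}) -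
              prob {\<omega>\<in>space M. s \<le> f \<omega>} * prob {\<omega>\<in>space M. t \<le> g \<omega>}\<bar> \<le> a"
  shows "\<bar>expectation (\<lambda>\<omega>. f \<omega> * g \<omega>) - expectation f * expectation g\<bar> \<le> a"
proof -
  \<comment> \<open>The error 4/k consists of 2/k for the mean of the product and 2/k for the
    product of the means.\<close>
  have step: "\<bar>expectation (\<lambda>\<omega>. f \<omega> * g \<omega>) - expectation f * expectation g\<bar> \<le> a + 4 * (1 / real k)"
    if k: "k \<ge> 1" for k :: nat
  proof -
    define A where "A h i = {\<omega>\<in>space M. real i / real k \<le> h \<omega>}" for h :: "'a \<Rightarrow> real" and i
    define D where "D h \<omega> = (\<Sum>i=1..k. indicator (A h i) \<omega>) / real k" for h :: "'a \<Rightarrow> real" and \<omega>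
    have [measurable]: "A h i \<in> sets M" if [measurable]: "h \<in> borel_measurable M" for h i
      unfolding A_def by measurable
    have Dm[measurable]: "D h \<in> borel_measurable M" if [measurable]: "h \<in> borel_measurable M" for h
      unfolding D_def by measurable
    have D01: "0 \<le> D h \<omega> \<and> D h \<omega> \<le> 1" for h \<omega>
    proof -
      have "(\<Sum>i=1..k. indicator (A h i) \<omega>) \<le> (\<Sum>i=1..k. 1::real)"
        by (intro sum_mono) (auto simp: indicator_def)
      then show ?thesis unfolding D_def using k by (auto intro!: divide_nonneg_nonneg sum_nonneg)
    qed
    have Dclose: "\<bar>D h \<omega> - h \<omega>\<bar> \<le> 1 / real k" if "\<omega> \<in> space M" "0 \<le> h \<omega> \<and> h \<omega> \<le> 1" for h \<omega>
    proof -
      have "(\<Sum>i=1..k. indicator (A h i) \<omega>) = (\<Sum>i=1..k. (if real i / real k \<le> h \<omega> then 1 else 0 :: real))"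
        using that by (intro sum.cong) (auto simp: A_def)
      then show ?thesis using discretise_unit[of "h \<omega>" k] that k unfolding D_def by simp
    qed
    have int01: "integrable M h" if "h \<in> borel_measurable M"
       "\<And>\<omega>. \<omega> \<in> space M \<Longrightarrow> 0 \<le> h \<omega> \<and> h \<omega> \<le> 1" for h :: "'a \<Rightarrow> real"
      using that by (intro integrable_const_bound[where B=1]) auto
    have bnd: "\<bar>expectation h - expectation h'\<bar> \<le> c"
      if "integrable M h" "integrable M h'" "\<And>\<omega>. \<omega> \<in> space M \<Longrightarrow> \<bar>h \<omega> - h' \<omega>\<bar> \<le> c"
      for h h' :: "'a \<Rightarrow> real" and c
    proof -
      have "\<bar>expectation h - expectation h'\<bar> = \<bar>expectation (\<lambda>\<omega>. h \<omega> - h' \<omega>)\<bar>" using that by simp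
      also have "\<dots> \<le> expectation (\<lambda>\<omega>. \<bar>h \<omega> - h' \<omega>\<bar>)" by (rule integral_abs_bound)
      also have "\<dots> \<le> expectation (\<lambda>\<omega>. c)" using that by (intro integral_mono) auto
      finally show ?thesis by (simp add: prob_space)
    qed
    have If: "integrable M f" and Ig: "integrable M g" and IDf: "integrable M (D f)" and IDg: "integrable M (D g)"
      using f g D01 by (auto intro!: int01)
    have Ifg: "integrable M (\<lambda>\<omega>. f \<omega> * g \<omega>)" using f g by (intro int01) (auto simp: mult_le_one)
    have IDfg: "integrable M (\<lambda>\<omega>. D f \<omega> * D g \<omega>)" using D01 by (intro int01) (auto simp: mult_le_one)
    have esum: "expectation (\<lambda>\<omega>. \<Sum>i\<in>I. indicator (S i) \<omega>) = (\<Sum>i\<in>I. prob (S i))"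
      if "\<And>i. i \<in> I \<Longrightarrow> S i \<in> events" for I :: "(nat \<times> nat) set" and S
      by (subst Bochner_Integration.integral_sum) (use that in \<open>auto intro!: sum.cong integrable_real_indicator simp: less_top[symmetric]\<close>)
    have eD: "expectation (D h) = (\<Sum>i=1..k. prob (A h i)) / real k" if "h \<in> borel_measurable M" for h
    proof -
      have "expectation (\<lambda>\<omega>. \<Sum>i=1..k. indicator (A h i) \<omega>) = (\<Sum>i=1..k. prob (A h i))"
        by (subst Bochner_Integration.integral_sum) (use that in \<open>auto intro!: sum.cong integrable_real_indicator simp: less_top[symmetric]\<close>)
      then show ?thesis unfolding D_def integral_divide_zero by simp
    qed
    have DD: "D f \<omega> * D g \<omega> = (\<Sum>(i, j)\<in>{1..k} \<times> {1..k}. indicator (A f i \<inter> A g j) \<omega>) / (real k * real k)" for \<omega>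
      unfolding D_def
      by (simp only: times_divide_times_eq sum_product indicator_inter_arith sum.cartesian_product)
    have eDD: "expectation (\<lambda>\<omega>. D f \<omega> * D g \<omega>) = (\<Sum>i=1..k. \<Sum>j=1..k. prob (A f i \<inter> A g j)) / (real k * real k)"
    proof -
      have "expectation (\<lambda>\<omega>. \<Sum>x\<in>{1..k} \<times> {1..k}. indicator (A f (fst x) \<inter> A g (snd x)) \<omega>) =
          (\<Sum>x\<in>{1..k} \<times> {1..k}. prob (A f (fst x) \<inter> A g (snd x)))"
        by (rule esum) auto
      then show ?thesis
        unfolding DD integral_divide_zero by (simp add: case_prod_unfold sum.cartesian_product)
    qed
    have "expectation (\<lambda>\<omega>. D f \<omega> * D g \<omega>) - expectation (D f) * expectation (D g) =
       (\<Sum>i=1..k. \<Sum>j=1..k. prob (A f i \<inter> A g j) - prob (A f i) * prob (A g j)) / (real k * real k)"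
      unfolding eDD eD[OF assms(1)] eD[OF assms(2)]
      by (simp only: times_divide_times_eq sum_product sum_subtractf diff_divide_distrib)
    also have "\<bar>\<dots>\<bar> \<le> (\<Sum>i=1..k. \<Sum>j=1..k. a) / (real k * real k)"
    proof -
      have "\<bar>\<Sum>i=1..k. \<Sum>j=1..k. prob (A f i \<inter> A g j) - prob (A f i) * prob (A g j)\<bar> \<le> (\<Sum>i=1..k. \<Sum>j=1..k. a)"
        unfolding A_def by (intro order_trans[OF sum_abs] sum_mono a)
      then show ?thesis unfolding abs_divide abs_mult abs_of_nat by (intro divide_right_mono) auto
    qed
    also have "\<dots> = a" using k by simp
    finally have 1: "\<bar>expectation (\<lambda>\<omega>. D f \<omega> * D g \<omega>) - expectation (D f) * expectation (D g)\<bar> \<le> a" .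
    have 2: "\<bar>expectation (\<lambda>\<omega>. D f \<omega> * D g \<omega>) - expectation (\<lambda>\<omega>. f \<omega> * g \<omega>)\<bar> \<le> 2 * (1 / real k)"
    proof (rule bnd[OF IDfg Ifg])
      fix \<omega> assume w: "\<omega> \<in> space M"
      show "\<bar>D f \<omega> * D g \<omega> - f \<omega> * g \<omega>\<bar> \<le> 2 * (1 / real k)"
        by (rule abs_mult_diff_le_unit) (use D01[of f \<omega>] g[OF w] Dclose[of \<omega> f] Dclose[of \<omega> g] f[OF w] w in auto)
    qed
    have e1: "\<bar>expectation (D f) - expectation f\<bar> \<le> 1 / real k" "\<bar>expectation (D g) - expectation g\<bar> \<le> 1 / real k"
      using bnd[OF IDf If, of "1 / real k"] bnd[OF IDg Ig, of "1 / real k"] Dclose[of _ f] Dclose[of _ g] f g by simp_all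
    have "\<bar>expectation (D f)\<bar> \<le> 1" using bnd[OF IDf integrable_zero, of 1] D01[of f] by simp
    moreover have "\<bar>expectation g\<bar> \<le> 1" using bnd[OF Ig integrable_zero, of 1] g by simp
    ultimately have "\<bar>expectation (D f) * expectation (D g) - expectation f * expectation g\<bar> \<le> 2 * (1 / real k)"
      using e1 by (intro abs_mult_diff_le_unit) auto
    with 1 2 show ?thesis by linarith
  qed
  have "(\<lambda>k. a + 4 * (1 / real k)) \<longlonglongrightarrow> a + 4 * 0"
    by (intro tendsto_intros lim_1_over_n)
  then show ?thesis
    by (intro LIMSEQ_le_const[where X="\<lambda>k. a + 4 * (1 / real k)"]) (use step in auto)
qed

lemma (in prob_space) covariance_le:
  fixes f g :: "'a \<Rightarrow> real"
  assumes m: "f \<in> borel_measurable M" "g \<in> borel_measurable M"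
    and c: "c > 0" "d > 0"
    and f: "\<And>\<omega>. \<omega> \<in> space M \<Longrightarrow> 0 \<le> f \<omega> \<and> f \<omega> \<le> c"
    and g: "\<And>\<omega>. \<omega> \<in> space M \<Longrightarrow> 0 \<le> g \<omega> \<and> g \<omega> \<le> d"
    and a: "\<And>s t. \<bar>prob ({\<omega>\<in>space M. s \<le> f \<omega>} \<inter> {\<omega>\<in>space M. t \<le> g \<omega>}) -
              prob {\<omega>\<in>space M. s \<le> f \<omega>} * prob {\<omega>\<in>space M. t \<le> g \<omega>}\<bar> \<le> a"
  shows "\<bar>expectation (\<lambda>\<omega>. f \<omega> * g \<omega>) - expectation f * expectation g\<bar> \<le> a * c * d"
proof -
  have "\<bar>expectation (\<lambda>\<omega>. (f \<omega> / c) * (g \<omega> / d)) - expectation (\<lambda>\<omega>. f \<omega> / c) * expectation (\<lambda>\<omega>. g \<omega> / d)\<bar> \<le> a"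
  proof (rule covariance_le_unit)
    show "\<bar>prob ({\<omega>\<in>space M. s \<le> f \<omega> / c} \<inter> {\<omega>\<in>space M. t \<le> g \<omega> / d}) -
        prob {\<omega>\<in>space M. s \<le> f \<omega> / c} * prob {\<omega>\<in>space M. t \<le> g \<omega> / d}\<bar> \<le> a" for s t
      using a[of "s * c" "t * d"] c by (simp add: pos_le_divide_eq)
  qed (use m f g c in \<open>auto simp: divide_le_eq\<close>)
  also have "expectation (\<lambda>\<omega>. (f \<omega> / c) * (g \<omega> / d)) - expectation (\<lambda>\<omega>. f \<omega> / c) * expectation (\<lambda>\<omega>. g \<omega> / d)
     = (expectation (\<lambda>\<omega>. f \<omega> * g \<omega>) - expectation f * expectation g) / (c * d)"
    by (simp add: diff_divide_distrib)
  finally show ?thesis using c by (simp add: abs_mult divide_le_eq mult.assoc)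
qed

section \<open>Laplace transform of a one-dimensional mixing sum\<close>

text \<open>Span of the stage-k set: 2^k base blocks of length \<open>p\<close>, plus gaps. The gap
  \<open>2 * q * 2 ^ i\<close> opened when passing from stage i to i + 1 occurs 2^(k-1-i) times, so
  each of the k levels of gaps has the same total length q 2^k.\<close>

definition cantor_len :: "nat \<Rightarrow> nat \<Rightarrow> nat \<Rightarrow> nat" where
  "cantor_len p q k = 2 ^ k * (p + k * q)"

text \<open>The gap doubles from stage to stage because the number of sites on its two sides
  doubles, and with it the exponent of the bound on the exponentials that have to be decoupled
  across it.\<close>

primrec cantor_set :: "nat \<Rightarrow> nat \<Rightarrow> nat \<Rightarrow> int set" where
  "cantor_set p q 0 = {0..<int p}"
| "cantor_set p q (Suc k) = cantor_set p q k \<union>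
     (\<lambda>t. t + int (cantor_len p q k + 2 * q * 2 ^ k)) ` cantor_set p q k"

lemma cantor_len_Suc: "cantor_len p q (Suc k) = 2 * cantor_len p q k + 2 * q * 2 ^ k"
  by (simp add: cantor_len_def algebra_simps)

lemma cantor_setD:
  assumes "t \<in> cantor_set p q k"
  shows "0 \<le> t" "t < int (cantor_len p q k)"
proof -
  have "0 \<le> t \<and> t < int (cantor_len p q k)" using assms
  proof (induction k arbitrary: t)
    case 0
    then show ?case by (simp add: cantor_len_def)
  next
    case (Suc k)
    let ?g = "int (cantor_len p q k + 2 * q * 2 ^ k)"
    from Suc.prems consider "t \<in> cantor_set p q k" | s where "s \<in> cantor_set p q k" "t = s + ?g" by auto
    moreover have "int (cantor_len p q (Suc k)) = int (cantor_len p q k) + ?g" "?g \<ge> 0" by (simp_all add: cantor_len_Suc)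
    ultimately show ?case
    proof cases
      case 1
      then show ?thesis using Suc.IH[of t] \<open>?g \<ge> 0\<close>
          \<open>int (cantor_len p q (Suc k)) = int (cantor_len p q k) + ?g\<close> by linarith
    next
      case 2
      then show ?thesis using Suc.IH[of s] \<open>?g \<ge> 0\<close>
          \<open>int (cantor_len p q (Suc k)) = int (cantor_len p q k) + ?g\<close> by linarith
    qed
  qed
  then show "0 \<le> t" "t < int (cantor_len p q k)" by auto
qed

lemma finite_cantor_set: "finite (cantor_set p q k)"
  by (rule finite_subset[of _ "{0..<int (cantor_len p q k)}"]) (auto dest: cantor_setD)

lemma card_cantor_set: "card (cantor_set p q k) = 2 ^ k * p"
proof (induction k)
  case 0
  then show ?case by simp
next
  case (Suc k)
  let ?s = "\<lambda>t. t + int (cantor_len p q k + 2 * q * 2 ^ k)"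
  have "cantor_set p q k \<inter> ?s ` cantor_set p q k = {}"
  proof -
    have "?s a \<notin> cantor_set p q k" if "a \<in> cantor_set p q k" for a
    proof
      assume "?s a \<in> cantor_set p q k"
      from cantor_setD(2)[OF this] cantor_setD(1)[OF that] show False by linarith
    qed
    then show ?thesis by blast
  qed
  moreover have "card (?s ` cantor_set p q k) = card (cantor_set p q k)"
    by (rule card_image) (simp add: inj_on_def)
  ultimately show ?case
    using Suc by (simp add: card_Un_disjoint finite_cantor_set)
qed

text \<open>For negative x put y = -x: then (1 - y + y^2)(1 + y) = 1 + y^3 is at least 1, and 1 + y
  is at most exp y.\<close>

lemma exp_le_quadratic:
  fixes x :: real
  assumes "\<bar>x\<bar> \<le> 1"
  shows "exp x \<le> 1 + x + x\<^sup>2"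
proof (cases "x \<ge> 0")
  case True
  then show ?thesis using assms exp_bound[of x] by simp
next
  case False
  define y where "y = - x"
  have y: "y > 0" using False by (simp add: y_def)
  have "1 \<le> (1 - y + y\<^sup>2) * (1 + y)" using y by (simp add: algebra_simps power2_eq_square)
  also have "\<dots> \<le> (1 - y + y\<^sup>2) * exp y"
  proof (rule mult_left_mono)
    have "1 - y + y\<^sup>2 = (y - 1/2)\<^sup>2 + 3/4" by (simp add: power2_eq_square algebra_simps)
    then show "0 \<le> 1 - y + y\<^sup>2" by simp
  qed simp
  finally have "exp (- y) \<le> 1 - y + y\<^sup>2" by (simp add: exp_minus field_simps)
  then show ?thesis by (simp add: y_def)
qed

context prob_space
begin

lemma abs_sum_le_card:
  fixes V :: "int \<Rightarrow> 'a \<Rightarrow> real"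
  assumes "\<And>t. \<bar>V t \<omega>\<bar> \<le> 1"
  shows "\<bar>\<Sum>t\<in>D. V t \<omega>\<bar> \<le> real (card D)"
  using order_trans[OF sum_abs sum_mono[of D "\<lambda>t. \<bar>V t \<omega>\<bar>" "\<lambda>_. 1"]] assms by simp

lemma integrable_exp_sum:
  fixes V :: "int \<Rightarrow> 'a \<Rightarrow> real"
  assumes [measurable]: "\<And>t. V t \<in> borel_measurable M"
    and bd: "\<And>t \<omega>. \<omega> \<in> space M \<Longrightarrow> \<bar>V t \<omega>\<bar> \<le> 1"
  shows "integrable M (\<lambda>\<omega>. exp (l * (\<Sum>t\<in>D. V t \<omega>)))"
proof (rule integrable_const_bound[where B="exp (\<bar>l\<bar> * card D)"])
  have "\<bar>l * (\<Sum>t\<in>D. V t \<omega>)\<bar> \<le> \<bar>l\<bar> * card D" if "\<omega> \<in> space M" for \<omega>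
    unfolding abs_mult using abs_sum_le_card[of V \<omega> D] bd that by (intro mult_left_mono) auto
  then show "AE \<omega> in M. norm (exp (l * (\<Sum>t\<in>D. V t \<omega>))) \<le> exp (\<bar>l\<bar> * card D)"
    by (auto simp: abs_le_iff)
qed measurable

text \<open>Cauchy-Schwarz, with no assumption on the dependence. It serves wherever no gap or decay
  of covariances is exploited: inside a base block, inside a slab, and for the remainder of the
  basis expansion.\<close>

lemma second_moment_sum_le:
  fixes V :: "'i \<Rightarrow> 'a \<Rightarrow> real"
  assumes m[measurable]: "\<And>t. t \<in> D \<Longrightarrow> V t \<in> borel_measurable M"
    and int: "\<And>t. t \<in> D \<Longrightarrow> integrable M (\<lambda>\<omega>. (V t \<omega>)\<^sup>2)"
    and v: "\<And>t. t \<in> D \<Longrightarrow> expectation (\<lambda>\<omega>. (V t \<omega>)\<^sup>2) \<le> v"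
  shows "integrable M (\<lambda>\<omega>. (\<Sum>t\<in>D. V t \<omega>)\<^sup>2)"
    and "expectation (\<lambda>\<omega>. (\<Sum>t\<in>D. V t \<omega>)\<^sup>2) \<le> (real (card D))\<^sup>2 * v"
proof -
  have le: "(\<Sum>t\<in>D. V t \<omega>)\<^sup>2 \<le> (\<Sum>t\<in>D. (V t \<omega>)\<^sup>2) * real (card D)" for \<omega>
    by (rule sum_squared_le_sum_of_squares)
  have i: "integrable M (\<lambda>\<omega>. (\<Sum>t\<in>D. (V t \<omega>)\<^sup>2) * real (card D))" using int by auto
  show I: "integrable M (\<lambda>\<omega>. (\<Sum>t\<in>D. V t \<omega>)\<^sup>2)"
    by (rule Bochner_Integration.integrable_bound[OF i]) (use le in \<open>auto simp: sum_nonneg\<close>)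
  have "expectation (\<lambda>\<omega>. (\<Sum>t\<in>D. V t \<omega>)\<^sup>2) \<le> expectation (\<lambda>\<omega>. (\<Sum>t\<in>D. (V t \<omega>)\<^sup>2) * real (card D))"
    using I i le by (intro integral_mono)
  also have "\<dots> = (\<Sum>t\<in>D. expectation (\<lambda>\<omega>. (V t \<omega>)\<^sup>2)) * real (card D)"
    using int by simp
  also have "\<dots> \<le> (\<Sum>t\<in>D. v) * real (card D)" using v by (intro mult_right_mono sum_mono) auto
  finally show "expectation (\<lambda>\<omega>. (\<Sum>t\<in>D. V t \<omega>)\<^sup>2) \<le> (real (card D))\<^sup>2 * v"
    by (simp add: power2_eq_square mult_ac)
qed

text \<open>Each gap is crossed once at the price of a factor \<open>1 + \<eta>\<close>, and a
  stage-k set has 2^k - 1 gaps. The bound covers arbitrary subsets \<open>D\<close> of a translate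
  because translates that stick out of the summation interval are cut off at its ends.\<close>

lemma cantor_laplace:
  fixes V :: "int \<Rightarrow> 'a \<Rightarrow> real" and l :: real
  assumes m[measurable]: "\<And>t. V t \<in> borel_measurable M"
    and bd: "\<And>t \<omega>. \<omega> \<in> space M \<Longrightarrow> \<bar>V t \<omega>\<bar> \<le> 1"
    and mean: "\<And>t. expectation (V t) = 0"
    and var: "\<And>t. expectation (\<lambda>\<omega>. (V t \<omega>)\<^sup>2) \<le> v"
    and dec: "\<And>A B g. finite A \<Longrightarrow> finite B \<Longrightarrow> g \<ge> 1 \<Longrightarrow> (\<And>a b. a \<in> A \<Longrightarrow> b \<in> B \<Longrightarrow> a + int g \<le> b) \<Longrightarrow>
      \<bar>expectation (\<lambda>\<omega>. exp (l * (\<Sum>t\<in>A. V t \<omega>)) * exp (l * (\<Sum>t\<in>B. V t \<omega>))) -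
        expectation (\<lambda>\<omega>. exp (l * (\<Sum>t\<in>A. V t \<omega>))) * expectation (\<lambda>\<omega>. exp (l * (\<Sum>t\<in>B. V t \<omega>)))\<bar>
      \<le> c\<^sub>0 * exp (- c\<^sub>1 * real g) * exp (\<bar>l\<bar> * real (card A + card B))"
    and q: "q \<ge> 1" and lp: "\<bar>l\<bar> * real p \<le> 1" and \<eta>: "\<eta> \<ge> 0" and c0: "c\<^sub>0 \<ge> 0"
    and err: "\<And>k. c\<^sub>0 * exp (- c\<^sub>1 * real (2 * q * 2 ^ k)) * exp (\<bar>l\<bar> * real (p * 2 ^ Suc k)) \<le> \<eta>"
    and D: "D \<subseteq> (\<lambda>t. t + h) ` cantor_set p q k"
  shows "expectation (\<lambda>\<omega>. exp (l * (\<Sum>t\<in>D. V t \<omega>))) \<le> (1 + \<eta>) ^ (2 ^ k - 1) * exp (l\<^sup>2 * v * real p * real (card D))"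
  using D
proof (induction k arbitrary: h D)
  case 0
  have v0: "0 \<le> v" using var[of 0] by (rule order_trans[rotated]) simp
  have "finite D" using 0 finite_cantor_set finite_surj by blast
  have cD: "card D \<le> p" using 0 by (metis card_cantor_set finite_cantor_set surj_card_le mult_1 power_0)
  have intV: "integrable M (V t)" for t
    using bd by (intro integrable_const_bound[where B=1]) auto
  have intV2: "integrable M (\<lambda>\<omega>. (V t \<omega>)\<^sup>2)" for t
    using bd by (intro integrable_const_bound[where B=1]) (auto simp: abs_square_le_1)
  note S2 = second_moment_sum_le[of D V v, OF m intV2 var]
  have "expectation (\<lambda>\<omega>. exp (l * (\<Sum>t\<in>D. V t \<omega>))) \<le>
      expectation (\<lambda>\<omega>. 1 + l * (\<Sum>t\<in>D. V t \<omega>) + l\<^sup>2 * (\<Sum>t\<in>D. V t \<omega>)\<^sup>2)"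
  proof (rule integral_mono)
    fix \<omega> assume w: "\<omega> \<in> space M"
    have "\<bar>l * (\<Sum>t\<in>D. V t \<omega>)\<bar> \<le> \<bar>l\<bar> * real p"
      unfolding abs_mult using abs_sum_le_card[of V \<omega> D] bd[OF w] cD by (intro mult_left_mono) fastforce+
    then show "exp (l * (\<Sum>t\<in>D. V t \<omega>)) \<le> 1 + l * (\<Sum>t\<in>D. V t \<omega>) + l\<^sup>2 * (\<Sum>t\<in>D. V t \<omega>)\<^sup>2"
      using exp_le_quadratic[of "l * (\<Sum>t\<in>D. V t \<omega>)"] lp by (simp add: power_mult_distrib)
  qed (use intV S2 integrable_exp_sum[OF m bd] in auto)
  also have "\<dots> = 1 + l\<^sup>2 * expectation (\<lambda>\<omega>. (\<Sum>t\<in>D. V t \<omega>)\<^sup>2)"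
    using intV S2 mean by (simp add: prob_space)
  also have "\<dots> \<le> 1 + l\<^sup>2 * ((real (card D))\<^sup>2 * v)"
    using S2 by (simp add: mult_left_mono)
  \<comment> \<open>One factor \<open>card D\<close> is traded for the block length, which makes the
    exponent additive over disjoint unions and so compatible with the induction.\<close>
  also have "(real (card D))\<^sup>2 * v \<le> real p * real (card D) * v"
    using v0 cD by (simp add: power2_eq_square mult_right_mono)
  then have "1 + l\<^sup>2 * ((real (card D))\<^sup>2 * v) \<le> 1 + l\<^sup>2 * (real p * real (card D) * v)"
    by (simp add: mult_left_mono)
  also have "\<dots> \<le> exp (l\<^sup>2 * v * real p * real (card D))"
    using exp_ge_add_one_self[of "l\<^sup>2 * v * real p * real (card D)"] by (simp add: mult_ac)
  finally show ?case by simp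
next
  case (Suc k)
  have v0: "0 \<le> v" using var[of 0] by (rule order_trans[rotated]) simp
  have fD: "finite D" using Suc.prems finite_cantor_set finite_surj by blast
  let ?g = "2 * q * 2 ^ k" and ?P = "cantor_len p q k"
  define h' where "h' = int (?P + ?g) + h"
  define A where "A = D \<inter> (\<lambda>t. t + h) ` cantor_set p q k"
  define B where "B = D \<inter> (\<lambda>t. t + h') ` cantor_set p q k"
  have D_eq: "D = A \<union> B"
    using Suc.prems unfolding A_def B_def h'_def by (auto simp: image_iff algebra_simps)
  have AB: "a + int ?g \<le> b" if "a \<in> A" "b \<in> B" for a b
  proof -
    from that obtain a' b' where "a' \<in> cantor_set p q k" "b' \<in> cantor_set p q k" "a = a' + h" "b = b' + h'"
      unfolding A_def B_def by blast
    then show ?thesis using cantor_setD(2)[of a' p q k] cantor_setD(1)[of b' p q k] unfolding h'_def by linarith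
  qed
  have "A \<inter> B = {}"
  proof -
    have "int ?g > 0" using q by simp
    then have "a \<notin> B" if "a \<in> A" for a using AB[OF that, of a] by linarith
    then show ?thesis by blast
  qed
  then have cD: "card D = card A + card B" using fD by (auto simp: D_eq card_Un_disjoint)
  have fin: "finite A" "finite B" using fD D_eq by auto
  have cA: "card A \<le> 2 ^ k * p" "card B \<le> 2 ^ k * p"
    unfolding A_def B_def
    by (metis card_cantor_set finite_cantor_set surj_card_le Int_lower2)+
  let ?E = "\<lambda>X. expectation (\<lambda>\<omega>. exp (l * (\<Sum>t\<in>X. V t \<omega>)))"
  let ?Y = "\<lambda>X. (1 + \<eta>) ^ (2 ^ k - 1) * exp (l\<^sup>2 * v * real p * real (card X))"
  have "?E D = expectation (\<lambda>\<omega>. exp (l * (\<Sum>t\<in>A. V t \<omega>)) * exp (l * (\<Sum>t\<in>B. V t \<omega>)))"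
    unfolding D_eq using fin \<open>A \<inter> B = {}\<close> by (simp add: sum.union_disjoint distrib_left exp_add)
  also have "\<dots> \<le> ?E A * ?E B + c\<^sub>0 * exp (- c\<^sub>1 * real ?g) * exp (\<bar>l\<bar> * real (card A + card B))"
    using dec[OF fin _ AB] q by fastforce
  finally have 1: "?E D \<le> ?E A * ?E B + c\<^sub>0 * exp (- c\<^sub>1 * real ?g) * exp (\<bar>l\<bar> * real (card A + card B))" .
  have 2: "c\<^sub>0 * exp (- c\<^sub>1 * real ?g) * exp (\<bar>l\<bar> * real (card A + card B)) \<le> \<eta>"
  proof (rule order_trans[OF _ err[of k]], rule mult_left_mono)
    have "card A + card B \<le> p * 2 ^ Suc k" using add_mono[OF cA] by (simp add: mult_ac)
    then have "real (card A + card B) \<le> real (p * 2 ^ Suc k)" by (simp only: of_nat_le_iff)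
    then show "exp (\<bar>l\<bar> * real (card A + card B)) \<le> exp (\<bar>l\<bar> * real (p * 2 ^ Suc k))"
      by (simp add: mult_left_mono del: of_nat_add)
  qed (use c0 in auto)
  have 3: "?E A * ?E B \<le> ?Y A * ?Y B"
    using \<eta> by (intro mult_mono Suc.IH[of _ h] Suc.IH[of _ h']) (auto simp: A_def B_def intro!: integral_nonneg_AE)
  \<comment> \<open>The additive decoupling error becomes multiplicative because both inductive
    bounds are at least 1.\<close>
  have 4: "\<eta> \<le> \<eta> * (?Y A * ?Y B)"
  proof -
    have "1 \<le> ?Y X" for X
      using \<eta> v0 by (auto intro!: mult_ge1_I one_le_power)
    from mult_ge1_I[OF this[of A] this[of B]] have "1 \<le> ?Y A * ?Y B" .
    then show ?thesis using \<eta> mult_left_mono[of 1 "?Y A * ?Y B" \<eta>] by simp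
  qed
  have "?E D \<le> ?Y A * ?Y B + \<eta> * (?Y A * ?Y B)" using 1 2 3 4 by linarith
  also have "\<dots> = (1 + \<eta>) * (?Y A * ?Y B)" by (rule distrib_left[of "?Y A * ?Y B" 1 \<eta>, unfolded mult.commute[of "?Y A * ?Y B"] mult_1, symmetric])
  also have "\<dots> = (1 + \<eta>) ^ (1 + (2 ^ k - 1) + (2 ^ k - 1)) * exp (l\<^sup>2 * v * real p * real (card D))"
    unfolding cD of_nat_add distrib_left exp_add power_add power_one_right by (simp only: mult_ac)
  also have "1 + (2 ^ k - 1) + (2 ^ k - 1) = 2 ^ Suc k - (1::nat)"
    by (simp add: mult_2) 
  finally show ?case .
qed

text \<open>Jensen's inequality over the shifts replaces the tilt \<open>l\<close> by one at most
  three times as large; this explains why \<open>dec\<close> is assumed for every tilt and gives the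
  factor 9. The prefactor 3 bounds e, which in turn bounds (1 + 2^(-K))^(2^K).\<close>

lemma laplace_mixing_sum:
  fixes V :: "int \<Rightarrow> 'a \<Rightarrow> real" and l :: real
  assumes m[measurable]: "\<And>t. V t \<in> borel_measurable M"
    and bd: "\<And>t \<omega>. \<omega> \<in> space M \<Longrightarrow> \<bar>V t \<omega>\<bar> \<le> 1"
    and mean: "\<And>t. expectation (V t) = 0"
    and var: "\<And>t. expectation (\<lambda>\<omega>. (V t \<omega>)\<^sup>2) \<le> v"
    and dec: "\<And>l A B g. finite A \<Longrightarrow> finite B \<Longrightarrow> g \<ge> 1 \<Longrightarrow> (\<And>a b. a \<in> A \<Longrightarrow> b \<in> B \<Longrightarrow> a + int g \<le> b) \<Longrightarrow>
      \<bar>expectation (\<lambda>\<omega>. exp (l * (\<Sum>t\<in>A. V t \<omega>)) * exp (l * (\<Sum>t\<in>B. V t \<omega>))) -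
        expectation (\<lambda>\<omega>. exp (l * (\<Sum>t\<in>A. V t \<omega>))) * expectation (\<lambda>\<omega>. exp (l * (\<Sum>t\<in>B. V t \<omega>)))\<bar>
      \<le> c\<^sub>0 * exp (- c\<^sub>1 * real g) * exp (\<bar>l\<bar> * real (card A + card B))"
    and c: "c\<^sub>0 > 0" "c\<^sub>1 > 0" and Q: "1 + \<bar>ln c\<^sub>0\<bar> \<le> c\<^sub>1 * real Q"
    and K: "K \<ge> 1" "n \<le> 2 ^ K"
    and l: "3 * real Q * \<bar>l\<bar> * (real K)\<^sup>2 \<le> 1" "6 * \<bar>l\<bar> * (real K)\<^sup>2 \<le> c\<^sub>1"
  shows "expectation (\<lambda>\<omega>. exp (l * (\<Sum>t\<in>{1..int n}. V t \<omega>))) \<le> 3 * exp (9 * l\<^sup>2 * v * (real Q * (real K)\<^sup>2) * real n)"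
proof -
  have Q1: "Q \<ge> 1" using Q c by (cases Q) auto
  have v0: "0 \<le> v" using var[of 0] by (rule order_trans[rotated]) simp
  \<comment> \<open>These choices satisfy \<open>p = K * q\<close>, so that after K stages the gaps
    fill exactly half of the span of the set. The value of \<open>\<eta>\<close> makes the
    accumulated loss over 2^K - 1 gaps a constant.\<close>
  define p q \<eta> where "p = Q * K\<^sup>2" and "q = Q * K" and "\<eta> = (1/2::real) ^ K"
  define C where "C = cantor_set p q K"
  define P where "P = cantor_len p q K"
  \<comment> \<open>Exactly the shifts h for which the interval from h to h + P - 1, which contains
    the translate, meets the interval from 1 to n.\<close>
  define H where "H = {2 - int P..int n}"
  define J where "J = {1..int n}"
  define S where "S h = (\<lambda>t. t + h) ` C \<inter> J" for h
  have p1: "p \<ge> 1" using Q1 K by (simp add: p_def)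
  have cC: "card C = 2 ^ K * p" by (simp add: C_def card_cantor_set)
  have PC: "P = 2 * card C" by (simp add: cC P_def cantor_len_def p_def q_def power2_eq_square)
  have cC1: "card C \<ge> 2 ^ K" using p1 by (simp add: cC)
  have cC0: "card C > 0" using cC1 by (rule less_le_trans[rotated]) simp
  have cH: "real (card H) \<le> 3 * real (card C)" "card H > 0"
    using K(2) cC1 cC0 by (auto simp: H_def PC)
  define l' where "l' = l * real (card H) / real (card C)"
  have "real (card H) / real (card C) \<le> 3" using cH cC0 by (simp add: divide_le_eq)
  then have l': "\<bar>l'\<bar> \<le> 3 * \<bar>l\<bar>"
    unfolding l'_def using mult_left_mono[of "real (card H) / real (card C)" 3 "\<bar>l\<bar>"] by (simp add: abs_mult)
  have "\<bar>l'\<bar> * real p \<le> 3 * \<bar>l\<bar> * real p" using l' by (intro mult_right_mono) auto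
  also have "\<dots> \<le> 1" using l by (simp add: p_def mult_ac)
  finally have lp: "\<bar>l'\<bar> * real p \<le> 1" .
  \<comment> \<open>The exponentials use up at most half of the mixing exponent
    \<open>2 * c\<^sub>1 * q * 2 ^ k\<close>. By the choice of \<open>Q\<close> the other half is at
    least K + |ln c0|, which pays for the constant \<open>c\<^sub>0\<close> and leaves exp (-K),
    below 2^(-K).\<close>
  have err: "c\<^sub>0 * exp (- c\<^sub>1 * real (2 * q * 2 ^ k)) * exp (\<bar>l'\<bar> * real (p * 2 ^ Suc k)) \<le> \<eta>" for k
  proof -
    have "\<bar>l'\<bar> * real K * (2 * real K) \<le> 3 * \<bar>l\<bar> * real K * (2 * real K)" using l' by (intro mult_right_mono) auto
    also have "\<dots> \<le> c\<^sub>1" using l by (simp add: power2_eq_square mult_ac)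
    finally have "2 * \<bar>l'\<bar> * real K * real K \<le> c\<^sub>1" by (simp add: mult_ac)
    moreover have "2 * \<bar>l'\<bar> * real K * 1 \<le> 2 * \<bar>l'\<bar> * real K * real K" using K by (intro mult_left_mono) auto
    ultimately have "2 * \<bar>l'\<bar> * real K \<le> c\<^sub>1" by linarith
    then have "2 * \<bar>l'\<bar> * real K * (real q * 2 ^ k) \<le> c\<^sub>1 * (real q * 2 ^ k)" by (rule mult_right_mono) simp
    then have "\<bar>l'\<bar> * real (p * 2 ^ Suc k) \<le> c\<^sub>1 * real q * 2 ^ k"
      by (simp add: p_def q_def power2_eq_square mult_ac)
    moreover have "c\<^sub>1 * real q * 1 \<le> c\<^sub>1 * real q * 2 ^ k" using c by (intro mult_left_mono) auto
    moreover have "(1 + \<bar>ln c\<^sub>0\<bar>) * real K \<le> c\<^sub>1 * real q"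
      using mult_right_mono[OF Q, of "real K"] by (simp add: q_def mult_ac)
    moreover have "real K + \<bar>ln c\<^sub>0\<bar> \<le> (1 + \<bar>ln c\<^sub>0\<bar>) * real K"
      using K mult_left_mono[of 1 "real K" "\<bar>ln c\<^sub>0\<bar>"] by (simp add: algebra_simps)
    moreover have "- c\<^sub>1 * real (2 * q * 2 ^ k) = - 2 * (c\<^sub>1 * real q * 2 ^ k)" by simp
    ultimately have "ln c\<^sub>0 + - c\<^sub>1 * real (2 * q * 2 ^ k) + \<bar>l'\<bar> * real (p * 2 ^ Suc k) \<le> - real K" by linarith
    then have "exp (ln c\<^sub>0 + - c\<^sub>1 * real (2 * q * 2 ^ k) + \<bar>l'\<bar> * real (p * 2 ^ Suc k)) \<le> exp (- real K)"
      by (simp only: exp_le_cancel_iff)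
    also have "exp (- real K) = (1 / exp 1) ^ K" by (simp add: exp_minus exp_of_nat_mult[symmetric] power_one_over field_simps)
    also have "\<dots> \<le> \<eta>" unfolding \<eta>_def using exp_ge_add_one_self[of 1] by (intro power_mono) (auto simp: field_simps)
    finally show ?thesis using c by (simp only: exp_add exp_ln)
  qed
  have \<eta>0: "\<eta> \<ge> 0" by (simp add: \<eta>_def)
  have fJ: "finite J" and cJ: "card J = n" by (auto simp: J_def)
  have e3: "(1 + \<eta>) ^ (2 ^ K - 1) \<le> 3"
  proof -
    have "(1 + \<eta>) ^ (2 ^ K - 1) \<le> (1 + \<eta>) ^ (2 ^ K)" using \<eta>0 by (intro power_increasing) auto
    also have "\<dots> \<le> exp \<eta> ^ (2 ^ K)" using \<eta>0 by (intro power_mono) auto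
    also have "\<dots> = exp 1" by (simp add: \<eta>_def exp_of_nat_mult[symmetric] power_one_over)
    finally show ?thesis using exp_le by simp
  qed
  have ES: "expectation (\<lambda>\<omega>. exp (l' * (\<Sum>t\<in>S h. V t \<omega>))) \<le> 3 * exp (9 * l\<^sup>2 * v * real p * real n)" for h
  proof -
    have "expectation (\<lambda>\<omega>. exp (l' * (\<Sum>t\<in>S h. V t \<omega>))) \<le> (1 + \<eta>) ^ (2 ^ K - 1) * exp (l'\<^sup>2 * v * real p * real (card (S h)))"
      by (rule cantor_laplace[OF m bd mean var dec _ lp \<eta>0 _ err]) (use c Q1 K in \<open>auto simp: q_def S_def C_def\<close>)
    also have "\<dots> \<le> 3 * exp (9 * l\<^sup>2 * v * real p * real n)"
    proof -
      have "card (S h) \<le> n" unfolding S_def using card_mono[OF fJ Int_lower2] cJ by simp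
      moreover have "l'\<^sup>2 \<le> 9 * l\<^sup>2" using power_mono[OF l', of 2] by (simp add: power_mult_distrib)
      ultimately have "l'\<^sup>2 * v * real p * real (card (S h)) \<le> 9 * l\<^sup>2 * v * real p * real n"
        using v0 by (intro mult_mono mult_nonneg_nonneg) auto
      then show ?thesis using e3 by (intro mult_mono) auto
    qed
    finally show ?thesis .
  qed
  have avg: "l * (\<Sum>t\<in>J. V t \<omega>) = (\<Sum>h\<in>H. (1 / real (card H)) *\<^sub>R (l' * (\<Sum>t\<in>S h. V t \<omega>)))" for \<omega>
  proof -
    have "(\<Sum>t\<in>S h. V t \<omega>) = (\<Sum>t\<in>J. if t - h \<in> C then V t \<omega> else 0)" for h
    proof -
      have "S h = {t\<in>J. t - h \<in> C}" unfolding S_def by (auto simp: image_iff) (metis diff_add_cancel)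
      then show ?thesis using fJ by (simp add: sum.inter_filter)
    qed
    then have "(\<Sum>h\<in>H. \<Sum>t\<in>S h. V t \<omega>) = (\<Sum>t\<in>J. \<Sum>h\<in>H. if t - h \<in> C then V t \<omega> else 0)"
      by (simp add: sum.swap[of _ H])
    also have "\<dots> = (\<Sum>t\<in>J. real (card C) * V t \<omega>)"
    proof (rule sum.cong[OF refl])
      fix t assume t: "t \<in> J"
      \<comment> \<open>\<open>H\<close> reaches far enough to the left that no translate covering t
        is missed, so the multiplicity is the same for all sites, also near the ends of the
        interval.\<close>
      have "{h\<in>H. t - h \<in> C} = (\<lambda>c. t - c) ` C"
        using t cantor_setD[of _ p q K] unfolding H_def J_def C_def P_def
        by (auto simp: image_iff) (metis diff_diff_eq2 add_diff_cancel_left' , smt (verit), smt (verit))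
      then have "card {h\<in>H. t - h \<in> C} = card C" by (simp add: card_image inj_on_def)
      then show "(\<Sum>h\<in>H. if t - h \<in> C then V t \<omega> else 0) = real (card C) * V t \<omega>"
        by (simp add: sum.inter_filter[symmetric] H_def)
    qed
    finally have "(\<Sum>h\<in>H. \<Sum>t\<in>S h. V t \<omega>) = real (card C) * (\<Sum>t\<in>J. V t \<omega>)"
      by (simp add: sum_distrib_left)
    moreover have "(\<Sum>h\<in>H. (1 / real (card H)) *\<^sub>R (l' * (\<Sum>t\<in>S h. V t \<omega>))) =
        (1 / real (card H)) * l' * (\<Sum>h\<in>H. \<Sum>t\<in>S h. V t \<omega>)"
      by (simp add: sum_distrib_left mult_ac)
    ultimately show ?thesis using cH cC0 by (simp add: l'_def)
  qed
  have fH: "finite H" "H \<noteq> {}" using cH by (auto simp: card_gt_0_iff)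
  have jensen: "exp (l * (\<Sum>t\<in>J. V t \<omega>)) \<le> (\<Sum>h\<in>H. (1 / real (card H)) * exp (l' * (\<Sum>t\<in>S h. V t \<omega>)))" for \<omega>
    unfolding avg by (rule convex_on_sum[OF fH exp_convex]) (use cH in auto)
  have "expectation (\<lambda>\<omega>. exp (l * (\<Sum>t\<in>J. V t \<omega>))) \<le>
      expectation (\<lambda>\<omega>. \<Sum>h\<in>H. (1 / real (card H)) * exp (l' * (\<Sum>t\<in>S h. V t \<omega>)))"
    using jensen integrable_exp_sum[OF m bd] by (intro integral_mono) auto
  also have "\<dots> = (\<Sum>h\<in>H. (1 / real (card H)) * expectation (\<lambda>\<omega>. exp (l' * (\<Sum>t\<in>S h. V t \<omega>))))"
    using integrable_exp_sum[OF m bd] by (subst Bochner_Integration.integral_sum) auto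
  also have "\<dots> \<le> (\<Sum>h\<in>H. (1 / real (card H)) * (3 * exp (9 * l\<^sup>2 * v * real p * real n)))"
    using ES by (intro sum_mono mult_left_mono) auto
  also have "\<dots> = 3 * exp (9 * l\<^sup>2 * v * real p * real n)" using cH by simp
  finally show ?thesis by (simp add: J_def p_def)
qed

end

section \<open>Boxes and slabs\<close>

text \<open>The pinned coordinate may be any integer, not only one inside the box, because the
  one-dimensional bound is stated for sequences indexed by all of \<int>. The cardinality does not
  depend on it.\<close>

definition slab :: "nat ^ 'N \<Rightarrow> 'N \<Rightarrow> int \<Rightarrow> (int ^ 'N) set" where
  "slab n i t = {s. s $ i = t \<and> (\<forall>j. j \<noteq> i \<longrightarrow> 1 \<le> s $ j \<and> s $ j \<le> int (n $ j))}"

lemma bij_betw_vec_PiE: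
  "bij_betw vec_nth {s :: 'a ^ 'N::finite. \<forall>i. s $ i \<in> A i} (PiE UNIV A)"
  by (rule bij_betwI[where g = vec_lambda]) auto

lemma card_vec_box: "card {s :: 'a ^ 'N::finite. \<forall>i. s $ i \<in> A i} = (\<Prod>i\<in>UNIV. card (A i))"
  using bij_betw_same_card[OF bij_betw_vec_PiE[of A]] by (simp add: card_PiE)

lemma finite_vec_box:
  assumes "\<And>i. finite (A i)"
  shows "finite {s :: 'a ^ 'N::finite. \<forall>i. s $ i \<in> A i}"
  using bij_betw_finite[OF bij_betw_vec_PiE[of A]] assms by (simp add: finite_PiE)

text \<open>Applied to exponentials of coordinate distances, this reduces a lattice sum of
  covariance bounds to one-dimensional geometric series.\<close>

lemma sum_prod_vec_box:
  fixes f :: "'N::finite \<Rightarrow> 'a \<Rightarrow> real"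
  assumes "\<And>i. finite (A i)"
  shows "(\<Sum>s\<in>{s :: 'a ^ 'N. \<forall>i. s $ i \<in> A i}. \<Prod>i\<in>UNIV. f i (s $ i)) = (\<Prod>i\<in>UNIV. \<Sum>x\<in>A i. f i x)"
proof -
  have "(\<Sum>s\<in>{s :: 'a ^ 'N. \<forall>i. s $ i \<in> A i}. \<Prod>i\<in>UNIV. f i (s $ i)) = (\<Sum>g\<in>PiE UNIV A. \<Prod>i\<in>UNIV. f i (g i))"
    by (rule sum.reindex_bij_betw[OF bij_betw_vec_PiE, where g = "\<lambda>g. \<Prod>i\<in>UNIV. f i (g i)"])
  also have "\<dots> = (\<Prod>i\<in>UNIV. \<Sum>x\<in>A i. f i x)"
    by (rule prod_sum_PiE[symmetric]) (use assms in auto)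
  finally show ?thesis .
qed

lemma lattice_box_eq: "lattice_box n = {s. \<forall>i. s $ i \<in> {1..int (n $ i)}}"
  by (auto simp: lattice_box_def)

lemma slab_eq: "slab n i t = {s. \<forall>j. s $ j \<in> (if j = i then {t} else {1..int (n $ j)})}"
  by (auto simp: slab_def)

lemma finite_lattice_box: "finite (lattice_box (n :: nat ^ 'N::finite))"
  unfolding lattice_box_eq by (rule finite_vec_box) simp

lemma finite_slab: "finite (slab (n :: nat ^ 'N::finite) i t)"
  unfolding slab_eq by (rule finite_vec_box) simp

lemma card_lattice_box: "card (lattice_box (n :: nat ^ 'N::finite)) = (\<Prod>i\<in>UNIV. n $ i)"
  unfolding lattice_box_eq by (subst card_vec_box) simp

lemma card_slab: "card (slab (n :: nat ^ 'N::finite) i t) = (\<Prod>j\<in>UNIV - {i}. n $ j)"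
  unfolding slab_eq
  by (subst card_vec_box, subst prod.remove[of UNIV i]) (auto intro!: prod.cong)

lemma card_lattice_box_slab:
  "card (lattice_box (n :: nat ^ 'N::finite)) = n $ i * card (slab n i t)"
  unfolding card_lattice_box card_slab by (rule prod.remove) auto

lemma sum_lattice_box_slab:
  fixes f :: "int ^ 'N::finite \<Rightarrow> real"
  shows "(\<Sum>s\<in>lattice_box n. f s) = (\<Sum>t\<in>{1..int (n $ i)}. \<Sum>s\<in>slab n i t. f s)"
proof -
  have "lattice_box n = (\<Union>t\<in>{1..int (n $ i)}. slab n i t)"
    by (auto simp: lattice_box_def slab_def)
  moreover have "slab n i t \<inter> slab n i t' = {}" if "t \<noteq> t'" for t t'
    using that by (auto simp: slab_def)
  ultimately show ?thesis
    by (simp add: sum.UNION_disjoint finite_slab)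
qed

lemma abs_component_le_max_norm: "\<bar>s $ i\<bar> \<le> max_norm (s :: int ^ 'N::finite)"
  unfolding max_norm_def by (intro Max_ge) auto

lemma le_d_infty:
  fixes I J :: "(int ^ 'N::finite) set"
  assumes "\<And>s t. s \<in> I \<Longrightarrow> t \<in> J \<Longrightarrow> int k \<le> max_norm (s - t)"
  shows "ereal (real k) \<le> d_infty I J"
proof -
  have "real k \<le> real_of_int (max_norm (s - t))" if "s \<in> I" "t \<in> J" for s t
    using assms[OF that] by linarith
  then show ?thesis unfolding d_infty_def by (intro INF_greatest) auto
qed

text \<open>The distance to x is injective on each side of x, so each side is part of a geometric
  series. The bound depends neither on x nor on the size of \<open>A\<close>.\<close>

lemma sum_exp_int_le:
  fixes a :: real and A :: "int set"
  assumes "a > 0" "finite A"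
  shows "(\<Sum>j\<in>A. exp (- a * \<bar>of_int (x - j)\<bar>)) \<le> 2 / (1 - exp (- a))"
proof -
  define r where "r = exp (- a)"
  have r: "0 < r" "r < 1" using assms by (auto simp: r_def)
  have half: "(\<Sum>j\<in>B. r ^ nat \<bar>x - j\<bar>) \<le> 1 / (1 - r)"
    if "finite B" "inj_on (\<lambda>j. nat \<bar>x - j\<bar>) B" for B
  proof -
    have "(\<Sum>j\<in>B. r ^ nat \<bar>x - j\<bar>) = (\<Sum>k\<in>(\<lambda>j. nat \<bar>x - j\<bar>) ` B. r ^ k)"
      using that by (simp add: sum.reindex)
    also have "\<dots> \<le> (\<Sum>k. r ^ k)"
      using r that by (intro sum_le_suminf summable_geometric) auto
    also have "\<dots> = 1 / (1 - r)" using r by (intro suminf_geometric) auto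
    finally show ?thesis .
  qed
  have "exp (- a * \<bar>of_int (x - j)\<bar>) = r ^ nat \<bar>x - j\<bar>" for j
  proof -
    have "\<bar>of_int (x - j)\<bar> = real (nat \<bar>x - j\<bar>)" by simp
    then show ?thesis unfolding r_def by (simp add: exp_of_nat_mult[symmetric] mult.commute)
  qed
  then have "(\<Sum>j\<in>A. exp (- a * \<bar>of_int (x - j)\<bar>)) = (\<Sum>j\<in>A. r ^ nat \<bar>x - j\<bar>)" by simp
  also have "\<dots> = (\<Sum>j\<in>{j\<in>A. j \<le> x}. r ^ nat \<bar>x - j\<bar>) + (\<Sum>j\<in>{j\<in>A. \<not> j \<le> x}. r ^ nat \<bar>x - j\<bar>)"
  proof -
    have "A = {j\<in>A. j \<le> x} \<union> {j\<in>A. \<not> j \<le> x}" by auto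
    then show ?thesis using assms(2) by (subst sum.union_disjoint[symmetric]) auto
  qed
  also have "\<dots> \<le> 1 / (1 - r) + 1 / (1 - r)"
    using assms(2) by (intro add_mono half) (auto simp: inj_on_def)
  finally show ?thesis by (simp add: r_def)
qed

section \<open>From mixing coefficients to covariances of functions of the field\<close>

context prob_space
begin

text \<open>The \<sigma>-algebra \<open>sigma_field M Z I\<close> packaged as a measure, so that
  measurability with respect to it can be derived by the usual rules.\<close>

definition generated_by :: "('i \<Rightarrow> 'a \<Rightarrow> 'b::topological_space) \<Rightarrow> 'i set \<Rightarrow> 'a measure" where
  "generated_by Z I = sigma (space M) {Z s -` B \<inter> space M | s B. s \<in> I \<and> B \<in> sets borel}"

lemma space_generated_by: "space (generated_by Z I) = space M"
  unfolding generated_by_def by (rule space_measure_of) auto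

lemma sets_generated_by: "sets (generated_by Z I) = sigma_field M Z I"
  unfolding generated_by_def sigma_field_def by (rule sets_measure_of) auto

lemma measurable_generated_by:
  assumes "s \<in> I"
  shows "Z s \<in> borel_measurable (generated_by Z I)"
proof (rule measurableI)
  fix B :: "'c set" assume "B \<in> sets borel"
  then show "Z s -` B \<inter> space (generated_by Z I) \<in> sets (generated_by Z I)"
    unfolding sets_generated_by sigma_field_def space_generated_by
    using assms by (intro sigma_sets.Basic) auto
qed auto

lemma borel_measurable_generated_by:
  assumes "\<And>s. Z s \<in> borel_measurable M" and f: "f \<in> borel_measurable (generated_by Z I)"
  shows "f \<in> borel_measurable M"
proof (rule measurable_from_subalg[OF _ f])
  have "sigma_field M Z I \<subseteq> sets M"
    unfolding sigma_field_def using assms(1) by (intro sets.sigma_sets_subset) (auto intro: measurable_sets)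
  then show "subalgebra M (generated_by Z I)"
    by (simp add: subalgebra_def space_generated_by sets_generated_by)
qed

text \<open>A real supremum bounds its members only if the family is bounded above. All set
  covariances are at most 1, and since every \<sigma>-field contains the empty set, the inner
  suprema run over nonempty families and inherit this bound.\<close>

lemma alpha_mixing_bound:
  fixes Z :: "int ^ 'N::finite \<Rightarrow> 'a \<Rightarrow> 'b::topological_space"
  assumes A: "A \<in> sigma_field M Z I" and B: "B \<in> sigma_field M Z J" and d: "ereal (real k) \<le> d_infty I J"
  shows "\<bar>prob (A \<inter> B) - prob A * prob B\<bar> \<le> alpha_mixing M Z k"
proof -
  have le1: "\<bar>prob (X \<inter> Y) - prob X * prob Y\<bar> \<le> 1" for X Y
  proof -
    have "0 \<le> prob X * prob Y" "prob X * prob Y \<le> 1" by (simp_all add: mult_le_one)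
    moreover have "0 \<le> prob (X \<inter> Y)" "prob (X \<inter> Y) \<le> 1" by simp_all
    ultimately show ?thesis by linarith
  qed
  have bdd: "bdd_above ((\<lambda>(A, B). \<bar>prob (A \<inter> B) - prob A * prob B\<bar>) ` X)" for X
    using le1 by (intro bdd_aboveI[where M=1]) auto
  have ne: "\<exists>X. X \<in> sigma_field M Z I'" for I'
    unfolding sigma_field_def by (blast intro: sigma_sets.Empty)
  have al: "alpha M (sigma_field M Z I') (sigma_field M Z J') \<le> 1" for I' J'
    unfolding alpha_def using le1 ne by (intro cSUP_least) auto
  have "\<bar>prob (A \<inter> B) - prob A * prob B\<bar> \<le> alpha M (sigma_field M Z I) (sigma_field M Z J)"
    unfolding alpha_def using cSUP_upper[OF _ bdd, of "(A, B)"] A B by fastforce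
  also have "\<dots> \<le> alpha_mixing M Z k"
  proof -
    have "bdd_above ((\<lambda>(I, J). alpha M (sigma_field M Z I) (sigma_field M Z J)) ` {(I, J). ereal (real k) \<le> d_infty I J})"
      using al by (intro bdd_aboveI[where M=1]) auto
    from cSUP_upper[OF _ this, of "(I, J)"] d show ?thesis unfolding alpha_mixing_def by simp
  qed
  finally show ?thesis .
qed

lemma mixing_covariance_le:
  fixes Z :: "int ^ 'N::finite \<Rightarrow> 'a \<Rightarrow> 'b::topological_space" and f g :: "'a \<Rightarrow> real"
  assumes Z: "\<And>s. Z s \<in> borel_measurable M"
    and d: "ereal (real k) \<le> d_infty I J"
    and m: "f \<in> borel_measurable (generated_by Z I)" "g \<in> borel_measurable (generated_by Z J)"
    and c: "c > 0" "d > 0"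
    and f: "\<And>\<omega>. \<omega> \<in> space M \<Longrightarrow> 0 \<le> f \<omega> \<and> f \<omega> \<le> c"
    and g: "\<And>\<omega>. \<omega> \<in> space M \<Longrightarrow> 0 \<le> g \<omega> \<and> g \<omega> \<le> d"
  shows "\<bar>expectation (\<lambda>\<omega>. f \<omega> * g \<omega>) - expectation f * expectation g\<bar> \<le> alpha_mixing M Z k * c * d"
proof (rule covariance_le[OF borel_measurable_generated_by[OF Z m(1)] borel_measurable_generated_by[OF Z m(2)] c f g])
  have lev: "{\<omega>\<in>space M. s \<le> h \<omega>} \<in> sigma_field M Z I'" if "h \<in> borel_measurable (generated_by Z I')"
    for h :: "'a \<Rightarrow> real" and s I'
  proof -
    have "{\<omega>\<in>space (generated_by Z I'). s \<le> h \<omega>} \<in> sets (generated_by Z I')" using that by measurable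
    then show ?thesis by (simp only: space_generated_by sets_generated_by)
  qed
  show "\<bar>prob ({\<omega>\<in>space M. s \<le> f \<omega>} \<inter> {\<omega>\<in>space M. t \<le> g \<omega>}) -
      prob {\<omega>\<in>space M. s \<le> f \<omega>} * prob {\<omega>\<in>space M. t \<le> g \<omega>}\<bar> \<le> alpha_mixing M Z k" for s t
    by (rule alpha_mixing_bound[OF lev[OF m(1)] lev[OF m(2)] d])
qed

end

section \<open>Exponential tails and second moments of slab sums\<close>

lemma (in prob_space) markov_exp:
  assumes l: "l > 0" and i: "integrable M (\<lambda>\<omega>. exp (l * f \<omega>))"
  shows "prob {\<omega>\<in>space M. a \<le> f \<omega>} \<le> exp (- l * a) * expectation (\<lambda>\<omega>. exp (l * f \<omega>))"
proof -
  have "set_integrable M (space M) (\<lambda>\<omega>. exp (l * f \<omega>))"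
    unfolding set_integrable_def by (rule integrable_mult_indicator) (use i in auto)
  from Chernoff_ineq_ge[OF l this] set_integral_space[OF i] show ?thesis by simp
qed

locale mixing_field = prob_space M for M :: "'a measure" +
  fixes Z :: "int ^ 'N::finite \<Rightarrow> 'a \<Rightarrow> 'b::topological_space" and c\<^sub>0 c\<^sub>1 :: real
  assumes measurable_field[measurable]: "\<And>s. Z s \<in> borel_measurable M"
    and mixing: "\<And>k. k \<ge> 1 \<Longrightarrow> alpha_mixing M Z k \<le> c\<^sub>0 * exp (- c\<^sub>1 * real k)"
    and c0_pos: "c\<^sub>0 > 0" and c1_pos: "c\<^sub>1 > 0"
begin

lemma field_covariance_le:
  assumes d: "ereal (real k) \<le> d_infty I J" and k: "k \<ge> 1"
    and m: "f \<in> borel_measurable (generated_by Z I)" "g \<in> borel_measurable (generated_by Z J)"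
    and c: "c > 0" "d > 0"
    and f: "\<And>\<omega>. \<omega> \<in> space M \<Longrightarrow> 0 \<le> f \<omega> \<and> f \<omega> \<le> c"
    and g: "\<And>\<omega>. \<omega> \<in> space M \<Longrightarrow> 0 \<le> g \<omega> \<and> g \<omega> \<le> d"
  shows "\<bar>expectation (\<lambda>\<omega>. f \<omega> * g \<omega>) - expectation f * expectation g\<bar> \<le> c\<^sub>0 * exp (- c\<^sub>1 * real k) * c * d"
proof (rule order_trans[OF mixing_covariance_le[OF measurable_field d m c f g]])
  show "alpha_mixing M Z k * c * d \<le> c\<^sub>0 * exp (- c\<^sub>1 * real k) * c * d"
    using mixing[OF k] c by (intro mult_right_mono) auto
qed

text \<open>Divided by \<open>b * w\<close>, slab sums lie in [-1, 1], and slabs whose indices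
  differ by g are at maximum distance at least g along axis i, so they form a mixing sequence. The
  functions \<open>\<psi> s\<close> depend on the site because the field need not be stationary and
  centring constants vary. Two tails with prefactor 3 each give 6.\<close>

lemma slab_tail:
  fixes \<psi> :: "int ^ 'N \<Rightarrow> 'b \<Rightarrow> real"
  assumes psi[measurable]: "\<And>s. \<psi> s \<in> borel_measurable borel"
    and bd: "\<And>s \<omega>. \<omega> \<in> space M \<Longrightarrow> \<bar>\<psi> s (Z s \<omega>)\<bar> \<le> b" and b: "b > 0"
    and mean: "\<And>s. expectation (\<lambda>\<omega>. \<psi> s (Z s \<omega>)) = 0"
    and w: "\<And>t. card (slab n i t) = w" "w > 0"
    and var: "\<And>t. expectation (\<lambda>\<omega>. (\<Sum>s\<in>slab n i t. \<psi> s (Z s \<omega>))\<^sup>2) \<le> v * (b * real w)\<^sup>2"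
    and Q: "1 + \<bar>ln c\<^sub>0\<bar> \<le> c\<^sub>1 * real Q"
    and K: "K \<ge> 1" "n $ i \<le> 2 ^ K"
    and l: "l > 0" "3 * real Q * l * (real K)\<^sup>2 \<le> 1" "6 * l * (real K)\<^sup>2 \<le> c\<^sub>1"
  shows "prob {\<omega>\<in>space M. \<delta> * real (card (lattice_box n)) \<le> \<bar>\<Sum>s\<in>lattice_box n. \<psi> s (Z s \<omega>)\<bar>}
    \<le> 6 * exp (- l * \<delta> * real (n $ i) / b + 9 * l\<^sup>2 * v * (real Q * (real K)\<^sup>2) * real (n $ i))"
proof -
  define V where "V t \<omega> = (\<Sum>s\<in>slab n i t. \<psi> s (Z s \<omega>)) / (b * real w)" for t \<omega>
  have bw: "b * real w > 0" using b w by simp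
  have m[measurable]: "V t \<in> borel_measurable M" for t
    unfolding V_def by measurable
  have V1: "\<bar>V t \<omega>\<bar> \<le> 1" if "\<omega> \<in> space M" for t \<omega>
  proof -
    have "\<bar>\<Sum>s\<in>slab n i t. \<psi> s (Z s \<omega>)\<bar> \<le> (\<Sum>s\<in>slab n i t. b)"
      using bd that by (intro order_trans[OF sum_abs sum_mono])
    also have "\<dots> = b * real w" by (simp add: w)
    finally show ?thesis using bw b by (simp add: V_def abs_mult divide_le_eq)
  qed
  have ipsi: "integrable M (\<lambda>\<omega>. \<psi> s (Z s \<omega>))" for s
    using bd by (intro integrable_const_bound[where B=b]) auto
  have V0: "expectation (V t) = 0" for t
    unfolding V_def using ipsi mean by simp
  have Vv: "expectation (\<lambda>\<omega>. (V t \<omega>)\<^sup>2) \<le> v" for t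
    unfolding V_def power_divide using var[of t] b w by (simp add: divide_le_eq)
  have Vgen: "(\<lambda>\<omega>. exp (l * (\<Sum>t\<in>A. V t \<omega>))) \<in> borel_measurable (generated_by Z (\<Union>t\<in>A. slab n i t))" for l A
  proof -
    have "(\<lambda>\<omega>. \<psi> s (Z s \<omega>)) \<in> borel_measurable (generated_by Z (\<Union>t\<in>A. slab n i t))"
      if "t \<in> A" "s \<in> slab n i t" for s t
      by (rule measurable_compose[OF measurable_generated_by psi]) (use that in auto)
    then have "V t \<in> borel_measurable (generated_by Z (\<Union>t\<in>A. slab n i t))" if "t \<in> A" for t
      unfolding V_def using that by (intro borel_measurable_divide borel_measurable_sum) auto
    then have "(\<lambda>\<omega>. \<Sum>t\<in>A. V t \<omega>) \<in> borel_measurable (generated_by Z (\<Union>t\<in>A. slab n i t))"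
      by (intro borel_measurable_sum)
    then show ?thesis by measurable
  qed
  have Vexp: "0 \<le> exp (l * (\<Sum>t\<in>A. V t \<omega>)) \<and> exp (l * (\<Sum>t\<in>A. V t \<omega>)) \<le> exp (\<bar>l\<bar> * real (card A))"
    if "\<omega> \<in> space M" for l A \<omega>
  proof -
    have "\<bar>l * (\<Sum>t\<in>A. V t \<omega>)\<bar> \<le> \<bar>l\<bar> * real (card A)"
      unfolding abs_mult using abs_sum_le_card[of V \<omega> A] V1[OF that] by (intro mult_left_mono) auto
    then show ?thesis by (simp add: abs_le_iff)
  qed
  have dec: "\<bar>expectation (\<lambda>\<omega>. exp (l * (\<Sum>t\<in>A. V t \<omega>)) * exp (l * (\<Sum>t\<in>B. V t \<omega>))) -
        expectation (\<lambda>\<omega>. exp (l * (\<Sum>t\<in>A. V t \<omega>))) * expectation (\<lambda>\<omega>. exp (l * (\<Sum>t\<in>B. V t \<omega>)))\<bar>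
      \<le> c\<^sub>0 * exp (- c\<^sub>1 * real g) * exp (\<bar>l\<bar> * real (card A + card B))"
    if AB: "finite A" "finite B" "g \<ge> 1" "\<And>a b. a \<in> A \<Longrightarrow> b \<in> B \<Longrightarrow> a + int g \<le> b" for l A B g
  proof -
    have "ereal (real g) \<le> d_infty (\<Union>t\<in>A. slab n i t) (\<Union>t\<in>B. slab n i t)"
    proof (rule le_d_infty)
      fix s t assume "s \<in> (\<Union>t\<in>A. slab n i t)" "t \<in> (\<Union>t\<in>B. slab n i t)"
      then have "s $ i \<in> A" "t $ i \<in> B" by (auto simp: slab_def)
      with AB(4) have "s $ i + int g \<le> t $ i" by blast
      then have "int g \<le> \<bar>(s - t) $ i\<bar>" by simp
      also have "\<dots> \<le> max_norm (s - t)" by (rule abs_component_le_max_norm)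
      finally show "int g \<le> max_norm (s - t)" .
    qed
    from field_covariance_le[OF this AB(3) Vgen Vgen _ _ Vexp Vexp]
    show ?thesis by (simp add: distrib_left exp_add mult_ac)
  qed
  have lap: "expectation (\<lambda>\<omega>. exp (l' * (\<Sum>t\<in>{1..int (n $ i)}. V t \<omega>))) \<le>
      3 * exp (9 * l\<^sup>2 * v * (real Q * (real K)\<^sup>2) * real (n $ i))" if "\<bar>l'\<bar> = l" for l'
  proof -
    have "l'\<^sup>2 = l\<^sup>2" using that by auto
    moreover have "expectation (\<lambda>\<omega>. exp (l' * (\<Sum>t\<in>{1..int (n $ i)}. V t \<omega>))) \<le>
      3 * exp (9 * l'\<^sup>2 * v * (real Q * (real K)\<^sup>2) * real (n $ i))"
    proof (rule laplace_mixing_sum[of V v c\<^sub>0 c\<^sub>1 Q K "n $ i" l'])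
      fix l A B g
      assume "finite A" "finite B" "g \<ge> 1" "\<And>a b. a \<in> A \<Longrightarrow> b \<in> B \<Longrightarrow> a + int g \<le> b"
      then show "\<bar>expectation (\<lambda>\<omega>. exp (l * (\<Sum>t\<in>A. V t \<omega>)) * exp (l * (\<Sum>t\<in>B. V t \<omega>))) -
        expectation (\<lambda>\<omega>. exp (l * (\<Sum>t\<in>A. V t \<omega>))) * expectation (\<lambda>\<omega>. exp (l * (\<Sum>t\<in>B. V t \<omega>)))\<bar>
      \<le> c\<^sub>0 * exp (- c\<^sub>1 * real g) * exp (\<bar>l\<bar> * real (card A + card B))" by (rule dec)
    qed (use m V1 V0 Vv c0_pos c1_pos Q K l that in auto)
    ultimately show ?thesis by simp
  qed
  define S where "S \<omega> = (\<Sum>t\<in>{1..int (n $ i)}. V t \<omega>)" for \<omega>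
  have box: "(\<Sum>s\<in>lattice_box n. \<psi> s (Z s \<omega>)) = b * real w * S \<omega>" for \<omega>
  proof -
    have "(\<Sum>s\<in>slab n i t. \<psi> s (Z s \<omega>)) = b * real w * V t \<omega>" for t
      using b w by (simp add: V_def)
    then show ?thesis unfolding sum_lattice_box_slab[of _ n i] S_def by (simp add: sum_distrib_left)
  qed
  have cb: "real (card (lattice_box n)) = real (n $ i) * real w"
    using card_lattice_box_slab[of n i 0] w by simp
  \<comment> \<open>Since |I_n| is n_i times w, the slab size cancels: in units of
    \<open>b * w\<close> the level is proportional to the side length alone.\<close>
  define u where "u = \<delta> * real (n $ i) / b"
  have iff: "\<delta> * real (card (lattice_box n)) \<le> \<bar>\<Sum>s\<in>lattice_box n. \<psi> s (Z s \<omega>)\<bar> \<longleftrightarrow> u \<le> \<bar>S \<omega>\<bar>" for \<omega>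
  proof -
    have "\<delta> * real (card (lattice_box n)) = b * real w * u" using b by (simp add: cb u_def)
    moreover have "\<bar>\<Sum>s\<in>lattice_box n. \<psi> s (Z s \<omega>)\<bar> = b * real w * \<bar>S \<omega>\<bar>" using b by (simp add: box abs_mult)
    ultimately show ?thesis by (simp only: mult_le_cancel_left_pos[OF bw])
  qed
  let ?B = "exp (- l * u) * (3 * exp (9 * l\<^sup>2 * v * (real Q * (real K)\<^sup>2) * real (n $ i)))"
  have [measurable]: "S \<in> borel_measurable M" unfolding S_def by measurable
  have "prob {\<omega>\<in>space M. u \<le> S \<omega>} \<le> ?B"
    using integrable_exp_sum[of V l "{1..int (n $ i)}", OF m V1] lap[of l] l
    unfolding S_def by (intro order_trans[OF markov_exp[of l]] mult_left_mono) auto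
  moreover have "prob {\<omega>\<in>space M. u \<le> - S \<omega>} \<le> ?B"
    using integrable_exp_sum[of V "-l" "{1..int (n $ i)}", OF m V1] lap[of "-l"] l
    unfolding S_def by (intro order_trans[OF markov_exp[of l]] mult_left_mono) auto
  moreover have "prob {\<omega>\<in>space M. u \<le> \<bar>S \<omega>\<bar>} \<le> prob ({\<omega>\<in>space M. u \<le> S \<omega>} \<union> {\<omega>\<in>space M. u \<le> - S \<omega>})"
    by (intro finite_measure_mono) auto
  moreover have "\<dots> \<le> prob {\<omega>\<in>space M. u \<le> S \<omega>} + prob {\<omega>\<in>space M. u \<le> - S \<omega>}"
    by (intro measure_Un_le) auto
  ultimately have "prob {\<omega>\<in>space M. u \<le> \<bar>S \<omega>\<bar>} \<le> 2 * ?B" by linarith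
  then show ?thesis unfolding iff exp_add by (simp add: u_def mult_ac)
qed

text \<open>The maximum of the |z_i| is at least their mean. This divides the rate by N but turns
  the bound into a product over coordinates, which can be summed axis by axis.\<close>

lemma exp_max_norm_le:
  fixes z :: "int ^ 'N"
  shows "exp (- c\<^sub>1 * real_of_int (max_norm z)) \<le> (\<Prod>i\<in>UNIV. exp (- (c\<^sub>1 / real CARD('N)) * \<bar>of_int (z $ i)\<bar>))"
proof -
  have "(\<Sum>i\<in>UNIV. \<bar>real_of_int (z $ i)\<bar>) \<le> (\<Sum>i\<in>(UNIV :: 'N set). real_of_int (max_norm z))"
    using abs_component_le_max_norm[of z] by (intro sum_mono) (simp add: of_int_abs[symmetric] del: of_int_abs)
  then have "(c\<^sub>1 / real CARD('N)) * (\<Sum>i\<in>UNIV. \<bar>real_of_int (z $ i)\<bar>) \<le> (c\<^sub>1 / real CARD('N)) * (real CARD('N) * real_of_int (max_norm z))"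
    using c1_pos by (intro mult_left_mono) auto
  then show ?thesis by (simp add: exp_sum[symmetric] sum_distrib_left sum_divide_distrib sum_negf)
qed

text \<open>Covariances decay exponentially in the distance, so each site contributes a bounded
  amount and the second moment is linear rather than quadratic in the size of the slab. This is the
  variance gain exploited when N \<ge> 2.\<close>

lemma slab_second_moment_le:
  fixes \<psi> :: "int ^ 'N \<Rightarrow> 'b \<Rightarrow> real"
  assumes psi[measurable]: "\<And>s. \<psi> s \<in> borel_measurable borel"
    and bd: "\<And>s \<omega>. \<omega> \<in> space M \<Longrightarrow> \<bar>\<psi> s (Z s \<omega>)\<bar> \<le> b" and b: "b > 0"
    and mean: "\<And>s. expectation (\<lambda>\<omega>. \<psi> s (Z s \<omega>)) = 0"
  shows "expectation (\<lambda>\<omega>. (\<Sum>s\<in>slab n i t. \<psi> s (Z s \<omega>))\<^sup>2) \<le>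
    real (card (slab n i t)) * (4 * b\<^sup>2 * (c\<^sub>0 + 1)) * (2 / (1 - exp (- (c\<^sub>1 / real CARD('N))))) ^ CARD('N)"
proof -
  let ?X = "\<lambda>s \<omega>. \<psi> s (Z s \<omega>)"
  let ?a = "c\<^sub>1 / real CARD('N)"
  let ?G = "2 / (1 - exp (- ?a))"
  let ?r = "\<lambda>z :: int ^ 'N. \<Prod>i\<in>UNIV. exp (- ?a * \<bar>of_int (z $ i)\<bar>)"
  have a: "?a > 0" using c1_pos by simp
  have iX: "integrable M (?X s)" for s
    using bd by (intro integrable_const_bound[where B=b]) auto
  have iXX: "integrable M (\<lambda>\<omega>. ?X s \<omega> * ?X s' \<omega>)" for s s'
    using bd b by (intro integrable_const_bound[where B="b * b"]) (auto simp: abs_mult intro!: mult_mono)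
  have cov: "expectation (\<lambda>\<omega>. ?X s \<omega> * ?X s' \<omega>) \<le> 4 * b\<^sup>2 * (c\<^sub>0 + 1) * ?r (s - s')" for s s'
  proof (cases "s = s'")
    \<comment> \<open>Mixing controls only lags of at least 1. The diagonal is bounded trivially by
      b^2, and the summand 1 in \<open>c\<^sub>0 + 1\<close> makes the common bound cover
      it.\<close>
    case True
    have "expectation (\<lambda>\<omega>. ?X s \<omega> * ?X s' \<omega>) \<le> expectation (\<lambda>\<omega>. b * b)"
    proof (rule integral_mono[OF iXX])
      fix \<omega> assume "\<omega> \<in> space M"
      then have "\<bar>?X s \<omega>\<bar> * \<bar>?X s' \<omega>\<bar> \<le> b * b" using bd b by (intro mult_mono) auto
      then show "?X s \<omega> * ?X s' \<omega> \<le> b * b" unfolding abs_mult[symmetric] by linarith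
    qed auto
    also have "\<dots> \<le> 4 * b\<^sup>2 * (c\<^sub>0 + 1)"
      using b c0_pos by (simp add: prob_space power2_eq_square)
    finally show ?thesis using True by simp
  next
    case False
    define k where "k = nat (max_norm (s - s'))"
    obtain j where j: "s $ j \<noteq> s' $ j" using False by (auto simp: vec_eq_iff)
    have k: "int k = max_norm (s - s')" "k \<ge> 1"
      using abs_component_le_max_norm[of "s - s'" j] j by (auto simp: k_def)
    have d: "ereal (real k) \<le> d_infty {s} {s'}"
      by (rule le_d_infty) (use k in auto)
    \<comment> \<open>Adding \<open>b\<close> leaves the covariance unchanged and moves the range
      into [0, 2 b], as the covariance inequality for nonnegative functions demands; hence the
      factor 4 b^2.\<close>
    have mX: "(\<lambda>\<omega>. ?X s \<omega> + b) \<in> borel_measurable (generated_by Z {s})" for s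
    proof -
      have [measurable]: "Z s \<in> borel_measurable (generated_by Z {s})" by (rule measurable_generated_by) simp
      show ?thesis by measurable
    qed
    have Xb: "0 \<le> ?X s \<omega> + b \<and> ?X s \<omega> + b \<le> 2 * b" if "\<omega> \<in> space M" for s \<omega>
      using bd[OF that, of s] by (auto simp: abs_le_iff)
    have "expectation (\<lambda>\<omega>. (?X s \<omega> + b) * (?X s' \<omega> + b)) = expectation (\<lambda>\<omega>. ?X s \<omega> * ?X s' \<omega>) + b * b"
    proof -
      have "(?X s \<omega> + b) * (?X s' \<omega> + b) = ?X s \<omega> * ?X s' \<omega> + b * ?X s \<omega> + b * ?X s' \<omega> + b * b" for \<omega>
        by algebra
      then show ?thesis using iX iXX mean by (simp add: prob_space)
    qed
    moreover have "expectation (\<lambda>\<omega>. ?X s \<omega> + b) = b" for s using iX mean by (simp add: prob_space)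
    ultimately have "expectation (\<lambda>\<omega>. ?X s \<omega> * ?X s' \<omega>) \<le> c\<^sub>0 * exp (- c\<^sub>1 * real k) * (2 * b) * (2 * b)"
      using field_covariance_le[OF d k(2) mX mX _ _ Xb Xb] b by simp
    also have "\<dots> = 4 * b\<^sup>2 * c\<^sub>0 * exp (- c\<^sub>1 * real_of_int (max_norm (s - s')))"
      by (simp add: k(1)[symmetric] power2_eq_square)
    also have "\<dots> \<le> 4 * b\<^sup>2 * (c\<^sub>0 + 1) * ?r (s - s')"
      using c0_pos exp_max_norm_le[of "s - s'"] by (intro mult_mono) (auto intro!: prod_nonneg)
    finally show ?thesis .
  qed
  have G: "(\<Sum>s'\<in>slab n i t. ?r (s - s')) \<le> ?G ^ CARD('N)" for s
  proof -
    have "(\<Sum>s'\<in>slab n i t. ?r (s - s')) = (\<Prod>j\<in>UNIV. \<Sum>x\<in>(if j = i then {t} else {1..int (n $ j)}). exp (- ?a * \<bar>of_int (s $ j - x)\<bar>))"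
      unfolding slab_eq by (subst sum_prod_vec_box[symmetric]) auto
    also have "\<dots> \<le> (\<Prod>j\<in>(UNIV :: 'N set). ?G)"
      by (intro prod_mono conjI sum_nonneg sum_exp_int_le[OF a]) auto
    finally show ?thesis by simp
  qed
  have "expectation (\<lambda>\<omega>. (\<Sum>s\<in>slab n i t. ?X s \<omega>)\<^sup>2) = (\<Sum>s\<in>slab n i t. \<Sum>s'\<in>slab n i t. expectation (\<lambda>\<omega>. ?X s \<omega> * ?X s' \<omega>))"
    unfolding power2_eq_square sum_product using iXX by simp
  also have "\<dots> \<le> (\<Sum>s\<in>slab n i t. \<Sum>s'\<in>slab n i t. 4 * b\<^sup>2 * (c\<^sub>0 + 1) * ?r (s - s'))"
    by (intro sum_mono cov)
  also have "\<dots> \<le> (\<Sum>s\<in>slab n i t. 4 * b\<^sup>2 * (c\<^sub>0 + 1) * ?G ^ CARD('N))"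
    unfolding sum_distrib_left[symmetric] using G c0_pos by (intro sum_mono mult_left_mono) auto
  finally show ?thesis by simp
qed

end

section \<open>Coordinates of the Hilbert space\<close>

definition basis_proj :: "(nat \<Rightarrow> 'h::real_inner) \<Rightarrow> nat \<Rightarrow> 'h \<Rightarrow> 'h" where
  "basis_proj e m z = (\<Sum>j=1..m. (z \<bullet> e j) *\<^sub>R e j)"

lemma orthonormal_basisD:
  assumes "orthonormal_basis e" "i \<ge> 1" "j \<ge> 1"
  shows "e i \<bullet> e j = (if i = j then 1 else 0)"
  using assms by (simp add: orthonormal_basis_def)

lemma norm_orthonormal_basis:
  assumes "orthonormal_basis e" "j \<ge> 1"
  shows "norm (e j) = 1"
  using orthonormal_basisD[OF assms assms(2)] by (simp add: norm_eq_sqrt_inner)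

lemma inner_basis_proj:
  assumes "orthonormal_basis e" "j \<ge> 1"
  shows "basis_proj e m z \<bullet> e j = (if j \<le> m then z \<bullet> e j else 0)"
proof -
  have "basis_proj e m z \<bullet> e j = (\<Sum>i=1..m. (z \<bullet> e i) * (e i \<bullet> e j))"
    by (simp add: basis_proj_def inner_sum_left)
  also have "\<dots> = (\<Sum>i=1..m. if i = j then z \<bullet> e j else 0)"
    using orthonormal_basisD[OF assms(1) _ assms(2)] by (intro sum.cong) auto
  also have "\<dots> = (if j \<le> m then z \<bullet> e j else 0)" using assms(2) by simp
  finally show ?thesis .
qed

lemma norm_basis_proj:
  assumes "orthonormal_basis e"
  shows "(norm (basis_proj e m z))\<^sup>2 = (\<Sum>j=1..m. (z \<bullet> e j)\<^sup>2)"
proof -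
  have "(norm (basis_proj e m z))\<^sup>2 = basis_proj e m z \<bullet> (\<Sum>j=1..m. (z \<bullet> e j) *\<^sub>R e j)"
    unfolding power2_norm_eq_inner basis_proj_def[symmetric] ..
  also have "\<dots> = (\<Sum>j=1..m. (z \<bullet> e j) * (basis_proj e m z \<bullet> e j))"
    by (simp add: inner_sum_right)
  also have "\<dots> = (\<Sum>j=1..m. (z \<bullet> e j)\<^sup>2)"
    using inner_basis_proj[OF assms] by (intro sum.cong) (auto simp: power2_eq_square)
  finally show ?thesis .
qed

lemma norm_minus_basis_proj:
  assumes "orthonormal_basis e"
  shows "(norm (z - basis_proj e m z))\<^sup>2 = (norm z)\<^sup>2 - (\<Sum>j=1..m. (z \<bullet> e j)\<^sup>2)"
proof -
  have "z \<bullet> basis_proj e m z = (\<Sum>j=1..m. (z \<bullet> e j)\<^sup>2)"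
    by (simp add: basis_proj_def inner_sum_right power2_eq_square)
  moreover have "(norm (z - basis_proj e m z))\<^sup>2 = (norm z)\<^sup>2 + (norm (basis_proj e m z))\<^sup>2 - 2 * (z \<bullet> basis_proj e m z)"
    by (simp add: power2_norm_eq_inner inner_diff_left inner_diff_right inner_commute)
  ultimately show ?thesis using norm_basis_proj[OF assms] by simp
qed

text \<open>The projections eventually fix every element of the span, and taking the residual does
  not increase the norm. The residual of z equals that of z - y once y is fixed, so density of the
  span suffices.\<close>

lemma parseval:
  fixes e :: "nat \<Rightarrow> 'h::real_inner"
  assumes e: "orthonormal_basis e"
  shows "(\<lambda>k. \<Sum>j=1..k. (z \<bullet> e j)\<^sup>2) \<longlonglongrightarrow> (norm z)\<^sup>2"
proof -
  have lin: "basis_proj e k (x + c *\<^sub>R y) = basis_proj e k x + c *\<^sub>R basis_proj e k y" for k x y c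
    by (simp add: basis_proj_def inner_add_left scaleR_add_left sum.distrib scaleR_sum_right)
  have fix_span: "\<exists>k0. \<forall>k\<ge>k0. basis_proj e k y = y" if "y \<in> span (e ` {1..})" for y
    using that
  proof (rule span_induct)
    show "subspace {y. \<exists>k0. \<forall>k\<ge>k0. basis_proj e k y = y}"
    proof (rule subspaceI)
      show "0 \<in> {y. \<exists>k0. \<forall>k\<ge>k0. basis_proj e k y = y}" by (simp add: basis_proj_def)
    next
      fix x y assume "x \<in> {y. \<exists>k0. \<forall>k\<ge>k0. basis_proj e k y = y}" "y \<in> {y. \<exists>k0. \<forall>k\<ge>k0. basis_proj e k y = y}"
      then obtain k1 k2 where "\<forall>k\<ge>k1. basis_proj e k x = x" "\<forall>k\<ge>k2. basis_proj e k y = y" by blast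
      then show "x + y \<in> {y. \<exists>k0. \<forall>k\<ge>k0. basis_proj e k y = y}"
        using lin[of _ x 1 y] by (auto intro!: exI[of _ "max k1 k2"])
    next
      fix c x assume "x \<in> {y. \<exists>k0. \<forall>k\<ge>k0. basis_proj e k y = y}"
      then show "c *\<^sub>R x \<in> {y. \<exists>k0. \<forall>k\<ge>k0. basis_proj e k y = y}"
        using lin[of _ 0 c x] by (auto simp: basis_proj_def)
    qed
  next
    fix x assume "x \<in> e ` {1..}"
    then obtain j where j: "j \<ge> 1" "x = e j" by auto
    have "basis_proj e k x = x" if "k \<ge> j" for k
    proof -
      have "basis_proj e k x = (\<Sum>i=1..k. if i = j then e j else 0)"
        unfolding basis_proj_def j(2)
        using orthonormal_basisD[OF e j(1)] by (intro sum.cong) auto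
      then show ?thesis using that j by simp
    qed
    then show "\<exists>k0. \<forall>k\<ge>k0. basis_proj e k x = x" by blast
  qed
  have "(\<lambda>k. (norm (z - basis_proj e k z))\<^sup>2) \<longlonglongrightarrow> 0"
  proof (rule LIMSEQ_I)
    fix r :: real assume r: "r > 0"
    have "z \<in> closure (span (e ` {1..}))" using e by (simp add: orthonormal_basis_def)
    then obtain y where y: "y \<in> span (e ` {1..})" "dist y z < sqrt r"
      using r by (meson closure_approachable real_sqrt_gt_zero)
    from fix_span[OF y(1)] obtain k0 where k0: "\<forall>k\<ge>k0. basis_proj e k y = y" by blast
    have "(norm (z - basis_proj e k z))\<^sup>2 < r" if "k \<ge> k0" for k
    proof -
      have "z - basis_proj e k z = (z - y) - basis_proj e k (z - y)"
        using lin[of k z "-1" y] k0 that by simp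
      then have "(norm (z - basis_proj e k z))\<^sup>2 = (norm (z - y))\<^sup>2 - (\<Sum>j=1..k. ((z - y) \<bullet> e j)\<^sup>2)"
        using norm_minus_basis_proj[OF e, of "z - y" k] by (simp only:)
      also have "\<dots> \<le> (norm (z - y))\<^sup>2" by (simp add: sum_nonneg)
      also have "\<dots> < (sqrt r)\<^sup>2"
        using y(2) by (intro power_strict_mono) (auto simp: dist_norm norm_minus_commute)
      finally show ?thesis using r by simp
    qed
    then show "\<exists>k0. \<forall>k\<ge>k0. norm ((norm (z - basis_proj e k z))\<^sup>2 - 0) < r" by auto
  qed
  then have "(\<lambda>k. (norm z)\<^sup>2 - (norm (z - basis_proj e k z))\<^sup>2) \<longlonglongrightarrow> (norm z)\<^sup>2 - 0"
    by (intro tendsto_intros)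
  then show ?thesis by (simp add: norm_minus_basis_proj[OF e])
qed

lemma parseval_remainder:
  assumes e: "orthonormal_basis e"
  shows "(\<lambda>k. (z \<bullet> e (m + 1 + k))\<^sup>2) sums (norm (z - basis_proj e m z))\<^sup>2"
proof -
  have "(\<Sum>k<K. (z \<bullet> e (m + 1 + k))\<^sup>2) = (\<Sum>j=1..K+m. (z \<bullet> e j)\<^sup>2) - (\<Sum>j=1..m. (z \<bullet> e j)\<^sup>2)" for K
    by (induction K) (auto simp: add.commute)
  moreover have "(\<lambda>K. (\<Sum>j=1..K+m. (z \<bullet> e j)\<^sup>2) - (\<Sum>j=1..m. (z \<bullet> e j)\<^sup>2)) \<longlonglongrightarrow> (norm z)\<^sup>2 - (\<Sum>j=1..m. (z \<bullet> e j)\<^sup>2)"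
    by (intro tendsto_intros LIMSEQ_ignore_initial_segment[OF parseval[OF e]])
  ultimately show ?thesis by (simp add: sums_def norm_minus_basis_proj[OF e])
qed

text \<open>Markov's inequality for the squared remainder, whose mean is a sum of coordinate
  variances and hence at most a geometric tail. Sum and expectation are exchanged for nonnegative
  extended reals, which also yields integrability.\<close>

lemma (in prob_space) basis_remainder_tail:
  fixes X :: "'a \<Rightarrow> 'h::{real_inner, banach, second_countable_topology}"
  assumes e: "orthonormal_basis e" and X[measurable]: "X \<in> borel_measurable M"
    and int: "\<And>j. j \<ge> 1 \<Longrightarrow> integrable M (\<lambda>\<omega>. (X \<omega> \<bullet> e j)\<^sup>2)"
    and bd: "\<And>j. j \<ge> 1 \<Longrightarrow> expectation (\<lambda>\<omega>. (X \<omega> \<bullet> e j)\<^sup>2) \<le> C * exp (- d * real j)"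
    and C: "C \<ge> 0" and d: "d > 0" and a: "a > 0"
  shows "prob {\<omega>\<in>space M. a \<le> norm (X \<omega> - basis_proj e m (X \<omega>))} \<le> C * exp (- d * real m) / ((1 - exp (- d)) * a\<^sup>2)"
proof -
  let ?R = "\<lambda>\<omega>. norm (X \<omega> - basis_proj e m (X \<omega>))"
  define c where "c = C * exp (- d * real m) / (1 - exp (- d))"
  have [measurable]: "(\<lambda>\<omega>. basis_proj e m (X \<omega>)) \<in> borel_measurable M"
    unfolding basis_proj_def by measurable
  have r: "0 < exp (- d)" "exp (- d) < 1" using d by auto
  have "(\<integral>\<^sup>+\<omega>. ennreal ((?R \<omega>)\<^sup>2) \<partial>M) = (\<integral>\<^sup>+\<omega>. (\<Sum>k. ennreal ((X \<omega> \<bullet> e (m + 1 + k))\<^sup>2)) \<partial>M)"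
    using parseval_remainder[OF e]
    by (intro nn_integral_cong) (simp add: sums_iff suminf_ennreal2 del: add_Suc)
  also have "\<dots> = (\<Sum>k. \<integral>\<^sup>+\<omega>. ennreal ((X \<omega> \<bullet> e (m + 1 + k))\<^sup>2) \<partial>M)"
    by (rule nn_integral_suminf) measurable
  also have "\<dots> = (\<Sum>k. ennreal (expectation (\<lambda>\<omega>. (X \<omega> \<bullet> e (m + 1 + k))\<^sup>2)))"
    by (subst nn_integral_eq_integral[OF int]) auto
  also have "\<dots> \<le> (\<Sum>k. ennreal (C * exp (- d * real m) * exp (- d) ^ k))"
  proof (rule suminf_le)
    fix k
    have "expectation (\<lambda>\<omega>. (X \<omega> \<bullet> e (m + 1 + k))\<^sup>2) \<le> C * exp (- d * real (m + 1 + k))" by (rule bd) simp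
    also have "\<dots> \<le> C * exp (- d * real (m + k))" using C d by (intro mult_left_mono) auto
    also have "\<dots> = C * exp (- d * real m) * exp (- d) ^ k"
      by (simp add: exp_of_nat_mult[symmetric] exp_add[symmetric] algebra_simps)
    finally show "ennreal (expectation (\<lambda>\<omega>. (X \<omega> \<bullet> e (m + 1 + k))\<^sup>2)) \<le> ennreal (C * exp (- d * real m) * exp (- d) ^ k)"
      by (rule ennreal_leI)
  qed auto
  also have "\<dots> = ennreal (\<Sum>k. C * exp (- d * real m) * exp (- d) ^ k)"
    using C r by (intro suminf_ennreal2 summable_mult summable_geometric) auto
  also have "(\<Sum>k. C * exp (- d * real m) * exp (- d) ^ k) = c"
    using r by (simp add: suminf_mult suminf_geometric summable_geometric c_def)
  finally have nn: "(\<integral>\<^sup>+\<omega>. ennreal ((?R \<omega>)\<^sup>2) \<partial>M) \<le> ennreal c" .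
  have c0: "c \<ge> 0" using C r by (simp add: c_def)
  have i: "integrable M (\<lambda>\<omega>. (?R \<omega>)\<^sup>2)"
    using nn by (intro integrableI_nonneg) (auto simp: less_top[symmetric] top_unique)
  have "expectation (\<lambda>\<omega>. (?R \<omega>)\<^sup>2) \<le> c"
    using nn c0 by (subst (asm) nn_integral_eq_integral[OF i]) auto
  have "prob {\<omega>\<in>space M. a\<^sup>2 \<le> (?R \<omega>)\<^sup>2} \<le> expectation (\<lambda>\<omega>. (?R \<omega>)\<^sup>2) / a\<^sup>2"
    using a by (intro integral_Markov_inequality_measure[OF i]) auto
  also have "\<dots> \<le> c / a\<^sup>2" using \<open>expectation (\<lambda>\<omega>. (?R \<omega>)\<^sup>2) \<le> c\<close> by (simp add: divide_right_mono)
  also have "{\<omega>\<in>space M. a\<^sup>2 \<le> (?R \<omega>)\<^sup>2} = {\<omega>\<in>space M. a \<le> ?R \<omega>}"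
    using a by (auto simp: abs_le_square_iff[symmetric])
  finally show ?thesis by (simp add: c_def)
qed

text \<open>On the event considered all norms are below \<open>B\<close>, so truncation changes
  nothing there and only the recentring by \<open>\<mu>\<close> costs, at most half of the level.
  Half the level and the range 2 B combine to the denominator 4 B. The first alternative for
  \<open>v\<close> is Cauchy-Schwarz within a slab, the second uses the decay of
  covariances.\<close>

lemma coordinate_tail:
  fixes Z :: "int ^ 'N::finite \<Rightarrow> 'a \<Rightarrow> 'h::{real_inner, banach, second_countable_topology}"
  assumes mf: "mixing_field M Z c\<^sub>0 c\<^sub>1" and u: "norm u = 1"
    and int: "\<And>s. integrable M (Z s)" and mean: "\<And>s. (\<integral>\<omega>. Z s \<omega> \<partial>M) = 0"
    and int2: "\<And>s. integrable M (\<lambda>\<omega>. (Z s \<omega> \<bullet> u)\<^sup>2)" and d: "\<And>s. (\<integral>\<omega>. (Z s \<omega> \<bullet> u)\<^sup>2 \<partial>M) \<le> d"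
    and tail: "\<And>s. \<P>(\<omega> in M. B \<le> norm (Z s \<omega>)) \<le> \<tau>" and B: "B > 0"
    and a: "a > 0" "a * d + \<tau> / a \<le> \<delta>"
    and w: "\<And>t. card (slab n i t) = w" "w > 0"
    and v: "v = d / (4 * B\<^sup>2) \<or> v = 4 * (c\<^sub>0 + 1) * (2 / (1 - exp (- (c\<^sub>1 / real CARD('N))))) ^ CARD('N) / real w"
    and Q: "1 + \<bar>ln c\<^sub>0\<bar> \<le> c\<^sub>1 * real Q"
    and K: "K \<ge> 1" "n $ i \<le> 2 ^ K"
    and l: "l > 0" "3 * real Q * l * (real K)\<^sup>2 \<le> 1" "6 * l * (real K)\<^sup>2 \<le> c\<^sub>1"
  shows "\<P>(\<omega> in M. (\<forall>s\<in>lattice_box n. norm (Z s \<omega>) < B) \<and>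
      \<delta> * real (card (lattice_box n)) \<le> \<bar>(\<Sum>s\<in>lattice_box n. Z s \<omega>) \<bullet> u\<bar>)
    \<le> 6 * exp (- l * \<delta> * real (n $ i) / (4 * B) + 9 * l\<^sup>2 * v * (real Q * (real K)\<^sup>2) * real (n $ i))"
proof -
  interpret mixing_field M Z c\<^sub>0 c\<^sub>1 by (rule mf)
  define \<phi> where "\<phi> z = (if norm z < B then z \<bullet> u else 0)" for z
  define \<mu> where "\<mu> s = expectation (\<lambda>\<omega>. \<phi> (Z s \<omega>))" for s
  define \<psi> where "\<psi> s z = \<phi> z - \<mu> s" for s z
  have [measurable]: "\<phi> \<in> borel_measurable borel" unfolding \<phi>_def by measurable
  have psi[measurable]: "\<psi> s \<in> borel_measurable borel" for s unfolding \<psi>_def by measurable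
  have phiB: "\<bar>\<phi> z\<bar> \<le> B" for z
    using Cauchy_Schwarz_ineq2[of z u] u B by (auto simp: \<phi>_def)
  have iphi: "integrable M (\<lambda>\<omega>. \<phi> (Z s \<omega>))" for s
    using phiB by (intro integrable_const_bound[where B=B]) auto
  have iphi2: "integrable M (\<lambda>\<omega>. (\<phi> (Z s \<omega>))\<^sup>2)" for s
    using power_mono[OF phiB, where n=2] by (intro integrable_const_bound[where B="B\<^sup>2"]) auto
  have muB: "\<bar>\<mu> s\<bar> \<le> B" for s
  proof -
    have "\<bar>\<mu> s\<bar> \<le> expectation (\<lambda>\<omega>. \<bar>\<phi> (Z s \<omega>)\<bar>)" unfolding \<mu>_def by (rule integral_abs_bound)
    also have "\<dots> \<le> expectation (\<lambda>\<omega>. B)" using iphi phiB by (intro integral_mono) auto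
    finally show ?thesis by (simp add: prob_space)
  qed
  have bd: "\<bar>\<psi> s (Z s \<omega>)\<bar> \<le> 2 * B" for s \<omega>
    using phiB[of "Z s \<omega>"] muB[of s] by (simp add: \<psi>_def)
  have mpsi: "expectation (\<lambda>\<omega>. \<psi> s (Z s \<omega>)) = 0" for s
    unfolding \<psi>_def using iphi by (simp add: prob_space \<mu>_def)
  have shift: "\<bar>\<mu> s\<bar> \<le> \<delta> / 2" for s
  proof -
    have iu: "integrable M (\<lambda>\<omega>. Z s \<omega> \<bullet> u)" using int by simp
    have "expectation (\<lambda>\<omega>. Z s \<omega> \<bullet> u) = 0" using int mean by (simp add: integral_inner_left)
    then have "\<bar>\<mu> s\<bar> = \<bar>expectation (\<lambda>\<omega>. \<phi> (Z s \<omega>) - Z s \<omega> \<bullet> u)\<bar>" using iphi iu by (simp add: \<mu>_def)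
    also have "\<dots> \<le> expectation (\<lambda>\<omega>. \<bar>\<phi> (Z s \<omega>) - Z s \<omega> \<bullet> u\<bar>)" by (rule integral_abs_bound)
    also have "\<dots> \<le> expectation (\<lambda>\<omega>. (a / 2) * (Z s \<omega> \<bullet> u)\<^sup>2 + (1 / (2 * a)) * indicator {\<omega>\<in>space M. B \<le> norm (Z s \<omega>)} \<omega>)"
    proof (rule integral_mono)
      show "integrable M (\<lambda>\<omega>. (a / 2) * (Z s \<omega> \<bullet> u)\<^sup>2 + (1 / (2 * a)) * indicator {\<omega>\<in>space M. B \<le> norm (Z s \<omega>)} \<omega>)"
        using int2 by (auto intro!: integrable_real_indicator simp: less_top[symmetric])
      fix \<omega> assume w: "\<omega> \<in> space M"
      \<comment> \<open>A weighted arithmetic-geometric mean inequality. It splits the part of the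
        mean cut off by truncation into a variance and a tail probability, with a weight
        \<open>a\<close> left free for balancing the two.\<close>
      have "\<bar>y\<bar> \<le> a / 2 * y\<^sup>2 + 1 / (2 * a)" for y :: real
      proof -
        have "(a * \<bar>y\<bar> - 1)\<^sup>2 = a * a * y\<^sup>2 + 1 - 2 * a * \<bar>y\<bar>"
          by (simp add: power2_diff power_mult_distrib) (simp add: power2_eq_square)
        then have "2 * a * \<bar>y\<bar> \<le> a * a * y\<^sup>2 + 1" using zero_le_power2[of "a * \<bar>y\<bar> - 1"] by linarith
        then show ?thesis using a by (simp add: field_simps power2_eq_square)
      qed
      then show "\<bar>\<phi> (Z s \<omega>) - Z s \<omega> \<bullet> u\<bar> \<le> (a / 2) * (Z s \<omega> \<bullet> u)\<^sup>2 + (1 / (2 * a)) * indicator {\<omega>\<in>space M. B \<le> norm (Z s \<omega>)} \<omega>"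
        using w a by (auto simp: \<phi>_def indicator_def)
    qed (use iphi iu in auto)
    also have "\<dots> = (a / 2) * expectation (\<lambda>\<omega>. (Z s \<omega> \<bullet> u)\<^sup>2) + (1 / (2 * a)) * prob {\<omega>\<in>space M. B \<le> norm (Z s \<omega>)}"
      using int2 by (subst Bochner_Integration.integral_add) (auto intro!: integrable_real_indicator simp: less_top[symmetric])
    also have "\<dots> \<le> (a / 2) * d + (1 / (2 * a)) * \<tau>"
      using d tail a by (intro add_mono mult_left_mono) auto
    also have "\<dots> = (a * d + \<tau> / a) / 2" using a by (simp add: field_simps)
    finally show ?thesis using a by simp
  qed
  have var: "expectation (\<lambda>\<omega>. (\<Sum>s\<in>slab n i t. \<psi> s (Z s \<omega>))\<^sup>2) \<le> v * (2 * B * real w)\<^sup>2" for t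
    using v
  proof
    assume v: "v = d / (4 * B\<^sup>2)"
    have ipsi2: "integrable M (\<lambda>\<omega>. (\<psi> s (Z s \<omega>))\<^sup>2)" for s
      unfolding \<psi>_def power2_diff using iphi iphi2 by simp
    have "expectation (\<lambda>\<omega>. (\<psi> s (Z s \<omega>))\<^sup>2) \<le> d" for s
    proof -
      have "expectation (\<lambda>\<omega>. (\<psi> s (Z s \<omega>))\<^sup>2) = expectation (\<lambda>\<omega>. (\<phi> (Z s \<omega>))\<^sup>2) - (\<mu> s)\<^sup>2"
        unfolding \<psi>_def power2_diff using iphi iphi2 by (simp add: prob_space \<mu>_def power2_eq_square)
      also have "\<dots> \<le> expectation (\<lambda>\<omega>. (\<phi> (Z s \<omega>))\<^sup>2)" by simp
      also have "\<dots> \<le> expectation (\<lambda>\<omega>. (Z s \<omega> \<bullet> u)\<^sup>2)"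
        using iphi2 int2 by (intro integral_mono) (auto simp: \<phi>_def)
      finally show ?thesis using d[of s] by linarith
    qed
    then have "expectation (\<lambda>\<omega>. (\<Sum>s\<in>slab n i t. \<psi> s (Z s \<omega>))\<^sup>2) \<le> (real (card (slab n i t)))\<^sup>2 * d"
      using ipsi2 by (intro second_moment_sum_le(2)) auto
    then show ?thesis using w B by (simp add: v power_mult_distrib mult.commute)
  next
    assume v: "v = 4 * (c\<^sub>0 + 1) * (2 / (1 - exp (- (c\<^sub>1 / real CARD('N))))) ^ CARD('N) / real w"
    have "v * (2 * B * real w)\<^sup>2 = real w * (4 * (2 * B)\<^sup>2 * (c\<^sub>0 + 1)) * (2 / (1 - exp (- (c\<^sub>1 / real CARD('N))))) ^ CARD('N)"
      using w(2) unfolding v by (simp only: power2_eq_square) simp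
    then show ?thesis
      using slab_second_moment_le[OF psi bd _ mpsi, of n i t] B w(1) by simp
  qed
  have imp: "(\<delta> / 2) * real (card (lattice_box n)) \<le> \<bar>\<Sum>s\<in>lattice_box n. \<psi> s (Z s \<omega>)\<bar>"
    if "\<forall>s\<in>lattice_box n. norm (Z s \<omega>) < B" "\<delta> * real (card (lattice_box n)) \<le> \<bar>(\<Sum>s\<in>lattice_box n. Z s \<omega>) \<bullet> u\<bar>" for \<omega>
  proof -
    have "(\<Sum>s\<in>lattice_box n. Z s \<omega>) \<bullet> u = (\<Sum>s\<in>lattice_box n. \<psi> s (Z s \<omega>)) + (\<Sum>s\<in>lattice_box n. \<mu> s)"
      using that(1) by (simp add: inner_sum_left \<psi>_def \<phi>_def sum.distrib[symmetric])
    moreover have "\<bar>\<Sum>s\<in>lattice_box n. \<mu> s\<bar> \<le> (\<Sum>s\<in>lattice_box n. \<delta> / 2)"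
      using shift by (intro order_trans[OF sum_abs sum_mono])
    ultimately show ?thesis using that(2) by (simp add: algebra_simps)
  qed
  have "\<P>(\<omega> in M. (\<forall>s\<in>lattice_box n. norm (Z s \<omega>) < B) \<and>
      \<delta> * real (card (lattice_box n)) \<le> \<bar>(\<Sum>s\<in>lattice_box n. Z s \<omega>) \<bullet> u\<bar>) \<le>
    prob {\<omega>\<in>space M. (\<delta> / 2) * real (card (lattice_box n)) \<le> \<bar>\<Sum>s\<in>lattice_box n. \<psi> s (Z s \<omega>)\<bar>}"
    using imp by (intro finite_measure_mono) auto
  also have "\<dots> \<le> 6 * exp (- l * (\<delta> / 2) * real (n $ i) / (2 * B) + 9 * l\<^sup>2 * v * (real Q * (real K)\<^sup>2) * real (n $ i))"
    using B by (intro slab_tail[OF psi bd _ mpsi w var Q K l]) auto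
  finally show ?thesis by (simp add: mult_ac)
qed

text \<open>A longest side is at least the geometric mean of all sides. In dimension at least 2 the
  slab orthogonal to it contains some complete other side, which the shape condition makes at least
  C' times the longest one.\<close>

lemma admissible_sizeE:
  fixes n :: "nat ^ 'N::finite"
  assumes adm: "admissible_size C' n" and C': "C' > 0"
  obtains i w where "\<And>t. card (slab n i t) = w" "w > 0" "n $ i \<le> card (lattice_box n)"
    "real (card (lattice_box n)) powr (1 / real CARD('N)) \<le> real (n $ i)"
    "CARD('N) \<ge> 2 \<Longrightarrow> C' * real (n $ i) \<le> real w"
proof -
  let ?L = "card (lattice_box n)" and ?Max = "Max (range (($) n))" and ?Min = "Min (range (($) n))"
  have L2: "?L \<ge> 2" using adm by (simp add: admissible_size_def)
  have pos: "n $ j > 0" for j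
  proof (rule ccontr)
    assume "\<not> n $ j > 0"
    then have "?L = 0" unfolding card_lattice_box by (intro prod_zero) auto
    then show False using L2 by simp
  qed
  have "?Max \<in> range (($) n)" by (intro Max_in) auto
  then obtain i where i: "n $ i = ?Max" by (metis rangeE)
  have le: "n $ j \<le> n $ i" for j unfolding i by (intro Max_ge) auto
  define w where "w = card (slab n i 0)"
  have w: "card (slab n i t) = w" for t by (simp add: w_def card_slab)
  have w0: "w > 0" unfolding w_def card_slab using pos by (intro prod_pos) auto
  have Lw: "?L = n $ i * w" using card_lattice_box_slab[of n i] w by simp
  have "?L \<le> n $ i ^ CARD('N)"
    unfolding card_lattice_box using le prod_mono[of UNIV "($) n" "\<lambda>_. n $ i"] by simp
  then have "real ?L \<le> real (n $ i) ^ CARD('N)" by (metis of_nat_le_iff of_nat_power)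
  then have "real ?L powr (1 / real CARD('N)) \<le> (real (n $ i) ^ CARD('N)) powr (1 / real CARD('N))"
    by (intro powr_mono2) auto
  also have "\<dots> = real (n $ i)"
    using pos[of i] by (simp add: powr_realpow[symmetric] powr_powr)
  finally have root: "real ?L powr (1 / real CARD('N)) \<le> real (n $ i)" .
  have "C' * real (n $ i) \<le> real w" if "CARD('N) \<ge> 2"
  proof -
    have "UNIV \<noteq> {i}"
    proof
      assume "UNIV = {i}"
      then have "CARD('N) = card {i}" by simp
      then show False using that by simp
    qed
    then obtain j where j: "j \<noteq> i" by blast
    have "n $ j dvd w" unfolding w_def card_slab by (rule dvd_prodI) (use j in auto)
    then have "n $ j \<le> w" using w0 by (rule dvd_imp_le)
    moreover have "?Min \<le> n $ j" by (intro Min_le) auto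
    moreover have "C' * real (n $ i) \<le> real ?Min" using adm by (simp add: admissible_size_def i)
    ultimately show ?thesis by linarith
  qed
  with that[OF w w0 _ root] Lw w0 show ?thesis by simp
qed

lemma mixing_hilbert_field_mixing_field:
  assumes "mixing_hilbert_field c\<^sub>0 c\<^sub>1 d\<^sub>0 d\<^sub>1 \<kappa>\<^sub>0 \<kappa>\<^sub>1 \<gamma> M e Z" "c\<^sub>0 > 0" "c\<^sub>1 > 0"
  shows "mixing_field M Z c\<^sub>0 c\<^sub>1"
  using assms by (simp add: mixing_hilbert_field_def mixing_field_def mixing_field_axioms_def)

text \<open>Half of \<epsilon> is allotted to the remainder of the basis expansion and half to the
  first \<open>m\<close> coordinates in Euclidean norm, hence the budget \<epsilon>^2/4 for squared
  levels. Truncation is charged once for all coordinates, by a union bound over the sites.\<close>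

lemma mean_exceedance_le:
  fixes Z :: "int ^ 'N::finite \<Rightarrow> 'a \<Rightarrow> 'h::{real_inner, banach, second_countable_topology}"
  assumes mhf: "mixing_hilbert_field c\<^sub>0 c\<^sub>1 d\<^sub>0 d\<^sub>1 \<kappa>\<^sub>0 \<kappa>\<^sub>1 \<gamma> M e Z"
    and pos: "d\<^sub>0 > 0" "d\<^sub>1 > 0" "\<epsilon> > 0" and L: "card (lattice_box n) > 0"
    and m: "m \<ge> 1" and B: "B > 0"
    and \<delta>: "\<And>j. \<delta> j \<ge> 0" "(\<Sum>j=1..m. (\<delta> j)\<^sup>2) \<le> \<epsilon>\<^sup>2 / 4"
  shows "mean_exceedance M Z n \<epsilon> \<le> 4 * d\<^sub>0 * exp (- d\<^sub>1 * real m) / ((1 - exp (- d\<^sub>1)) * \<epsilon>\<^sup>2)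
    + real (card (lattice_box n)) * (\<kappa>\<^sub>0 * exp (- \<kappa>\<^sub>1 * B powr \<gamma>))
    + (\<Sum>j=1..m. \<P>(\<omega> in M. (\<forall>s\<in>lattice_box n. norm (Z s \<omega>) < B) \<and>
        \<delta> j * real (card (lattice_box n)) \<le> \<bar>(\<Sum>s\<in>lattice_box n. Z s \<omega>) \<bullet> e j\<bar>))"
proof -
  have e: "orthonormal_basis e" and Z[measurable]: "\<And>s. Z s \<in> borel_measurable M"
    and i2: "\<And>s j. j \<ge> 1 \<Longrightarrow> integrable M (\<lambda>\<omega>. (Z s \<omega> \<bullet> e j)\<^sup>2)"
    and v: "\<And>s j. j \<ge> 1 \<Longrightarrow> (\<integral>\<omega>. (Z s \<omega> \<bullet> e j)\<^sup>2 \<partial>M) \<le> d\<^sub>0 * exp (- d\<^sub>1 * real j)"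
    and tail: "\<And>s z. z \<ge> 0 \<Longrightarrow> \<P>(\<omega> in M. z \<le> norm (Z s \<omega>)) \<le> \<kappa>\<^sub>0 * exp (- \<kappa>\<^sub>1 * z powr \<gamma>)"
    and "prob_space M"
    using mhf by (auto simp: mixing_hilbert_field_def)
  interpret prob_space M by fact
  let ?I = "lattice_box n" and ?L = "real (card (lattice_box n))"
  let ?S = "\<lambda>\<omega>. \<Sum>s\<in>?I. Z s \<omega>"
  have L0: "?L > 0" using L by simp
  define E1 where "E1 = {\<omega>\<in>space M. ?L * \<epsilon> / 2 \<le> norm (?S \<omega> - basis_proj e m (?S \<omega>))}"
  define E2 where "E2 = (\<Union>s\<in>?I. {\<omega>\<in>space M. B \<le> norm (Z s \<omega>)})"
  define F where "F j = {\<omega>\<in>space M. (\<forall>s\<in>?I. norm (Z s \<omega>) < B) \<and> \<delta> j * ?L \<le> \<bar>?S \<omega> \<bullet> e j\<bar>}" for j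
  have [measurable]: "(\<lambda>\<omega>. basis_proj e m (?S \<omega>)) \<in> borel_measurable M"
    unfolding basis_proj_def by measurable
  have [measurable]: "E1 \<in> sets M" unfolding E1_def by measurable
  have [measurable]: "E2 \<in> sets M" unfolding E2_def using finite_lattice_box by (intro sets.finite_UN) auto
  have [measurable]: "F j \<in> sets M" for j unfolding F_def using finite_lattice_box[of n] by measurable
  have sub: "{\<omega>\<in>space M. \<epsilon> \<le> norm (?S \<omega>) / ?L} \<subseteq> E1 \<union> E2 \<union> (\<Union>j\<in>{1..m}. F j)"
  proof
    fix \<omega> assume "\<omega> \<in> {\<omega>\<in>space M. \<epsilon> \<le> norm (?S \<omega>) / ?L}"
    then have w: "\<omega> \<in> space M" and big: "?L * \<epsilon> \<le> norm (?S \<omega>)" using L0 by (auto simp: field_simps)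
    show "\<omega> \<in> E1 \<union> E2 \<union> (\<Union>j\<in>{1..m}. F j)"
    proof (rule ccontr)
      assume no: "\<omega> \<notin> E1 \<union> E2 \<union> (\<Union>j\<in>{1..m}. F j)"
      have good: "\<forall>s\<in>?I. norm (Z s \<omega>) < B" using no w by (auto simp: E2_def not_le)
      have small: "\<bar>?S \<omega> \<bullet> e j\<bar> < \<delta> j * ?L" if "j \<in> {1..m}" for j
        using no w good that by (auto simp: F_def not_le)
      have "norm (?S \<omega>) \<le> norm (?S \<omega> - basis_proj e m (?S \<omega>)) + norm (basis_proj e m (?S \<omega>))"
        using norm_triangle_ineq[of "?S \<omega> - basis_proj e m (?S \<omega>)" "basis_proj e m (?S \<omega>)"] by simp
      moreover have "norm (?S \<omega> - basis_proj e m (?S \<omega>)) < ?L * \<epsilon> / 2" using no w by (simp add: E1_def not_le)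
      ultimately have "?L * \<epsilon> / 2 < norm (basis_proj e m (?S \<omega>))" using big by linarith
      then have "(?L * \<epsilon> / 2)\<^sup>2 < (norm (basis_proj e m (?S \<omega>)))\<^sup>2"
        using L0 pos by (intro power_strict_mono) auto
      also have "\<dots> = (\<Sum>j=1..m. (?S \<omega> \<bullet> e j)\<^sup>2)" by (rule norm_basis_proj[OF e])
      also have "\<dots> \<le> (\<Sum>j=1..m. (\<delta> j * ?L)\<^sup>2)"
        using small by (intro sum_mono) (metis abs_ge_zero less_imp_le power2_abs power_mono)
      also have "\<dots> = (\<Sum>j=1..m. (\<delta> j)\<^sup>2) * ?L\<^sup>2" by (simp add: power_mult_distrib sum_distrib_right)
      also have "\<dots> \<le> (\<epsilon>\<^sup>2 / 4) * ?L\<^sup>2" using \<delta>(2) by (intro mult_right_mono) auto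
      finally show False by (simp add: power_mult_distrib power_divide)
    qed
  qed
  have "mean_exceedance M Z n \<epsilon> = prob {\<omega>\<in>space M. \<epsilon> \<le> norm (?S \<omega>) / ?L}"
    by (simp add: mean_exceedance_def)
  also have "\<dots> \<le> prob (E1 \<union> E2 \<union> (\<Union>j\<in>{1..m}. F j))"
    by (rule finite_measure_mono[OF sub]) measurable
  also have "\<dots> \<le> prob (E1 \<union> E2) + prob (\<Union>j\<in>{1..m}. F j)"
    by (rule measure_Un_le) measurable
  also have "\<dots> \<le> (prob E1 + prob E2) + (\<Sum>j=1..m. prob (F j))"
    by (intro add_mono measure_Un_le measure_UNION_le) auto
  finally have le: "mean_exceedance M Z n \<epsilon> \<le> prob E1 + prob E2 + (\<Sum>j=1..m. prob (F j))" .
  have S2: "integrable M (\<lambda>\<omega>. (?S \<omega> \<bullet> e j)\<^sup>2)"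
    "expectation (\<lambda>\<omega>. (?S \<omega> \<bullet> e j)\<^sup>2) \<le> ?L\<^sup>2 * d\<^sub>0 * exp (- d\<^sub>1 * real j)" if "j \<ge> 1" for j
    unfolding inner_sum_left
    using second_moment_sum_le[of ?I "\<lambda>s \<omega>. Z s \<omega> \<bullet> e j" "d\<^sub>0 * exp (- d\<^sub>1 * real j)"] i2[OF that] v[OF that]
    by (auto simp: mult.assoc)
  have "prob E1 \<le> ?L\<^sup>2 * d\<^sub>0 * exp (- d\<^sub>1 * real m) / ((1 - exp (- d\<^sub>1)) * (?L * \<epsilon> / 2)\<^sup>2)"
    unfolding E1_def using S2 pos L0 by (intro basis_remainder_tail[OF e]) auto
  also have "\<dots> = 4 * d\<^sub>0 * exp (- d\<^sub>1 * real m) / ((1 - exp (- d\<^sub>1)) * \<epsilon>\<^sup>2)"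
    using L0 pos by (simp add: power_mult_distrib power_divide field_simps)
  finally have 1: "prob E1 \<le> 4 * d\<^sub>0 * exp (- d\<^sub>1 * real m) / ((1 - exp (- d\<^sub>1)) * \<epsilon>\<^sup>2)" .
  have "prob E2 \<le> (\<Sum>s\<in>?I. prob {\<omega>\<in>space M. B \<le> norm (Z s \<omega>)})"
    unfolding E2_def using finite_lattice_box by (intro measure_UNION_le) auto
  also have "\<dots> \<le> (\<Sum>s\<in>?I. \<kappa>\<^sub>0 * exp (- \<kappa>\<^sub>1 * B powr \<gamma>))"
    using B by (intro sum_mono tail) auto
  finally have 2: "prob E2 \<le> ?L * (\<kappa>\<^sub>0 * exp (- \<kappa>\<^sub>1 * B powr \<gamma>))" by simp
  show ?thesis using le 1 2 unfolding F_def by linarith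
qed

text \<open>Of the two terms in the level given to coordinate \<open>j\<close>, the constant one determines the final
  exponent. The other one keeps the level above the decaying variance of the coordinate; this is
  needed only for \<open>N = 1\<close>, where slabs are single points and averaging does not reduce the variance.\<close>

lemma sum_coordinate_level_le:
  fixes d \<epsilon> :: real
  assumes d: "d > 0" and m: "m \<ge> 1"
  shows "(\<Sum>j=1..m. (\<epsilon> / 4 * (1 / sqrt (real m) + sqrt (1 - exp (- d)) * exp (- d * real j)))\<^sup>2) \<le> \<epsilon>\<^sup>2 / 4"
proof -
  define r where "r = exp (- d)"
  have r: "0 < r" "r < 1" using d by (auto simp: r_def)
  have two: "(a + b)\<^sup>2 \<le> 2 * (a\<^sup>2 + b\<^sup>2)" for a b :: real
    using zero_le_power2[of "a - b"] by (simp add: power2_sum power2_diff)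
  have summand: "(\<epsilon> / 4 * (1 / sqrt (real m) + sqrt (1 - exp (- d)) * exp (- d * real j)))\<^sup>2
      \<le> \<epsilon>\<^sup>2 / 8 * (1 / real m + (1 - r) * r ^ j)" for j
  proof -
    have "exp (- d * real j) = r ^ j" by (simp add: r_def exp_of_nat_mult[symmetric] mult.commute)
    moreover have "(r ^ j)\<^sup>2 \<le> r ^ j"
      using r by (simp add: power2_eq_square mult_left_le power_le_one)
    ultimately have "(sqrt (1 - exp (- d)) * exp (- d * real j))\<^sup>2 \<le> (1 - r) * r ^ j"
      using r by (simp add: power_mult_distrib r_def[symmetric])
    then have "(1 / sqrt (real m) + sqrt (1 - exp (- d)) * exp (- d * real j))\<^sup>2 \<le> 2 * (1 / real m + (1 - r) * r ^ j)"
      using two[of "1 / sqrt (real m)" "sqrt (1 - exp (- d)) * exp (- d * real j)"] by (simp add: power_divide)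
    then have "(\<epsilon> / 4)\<^sup>2 * (1 / sqrt (real m) + sqrt (1 - exp (- d)) * exp (- d * real j))\<^sup>2
        \<le> (\<epsilon> / 4)\<^sup>2 * (2 * (1 / real m + (1 - r) * r ^ j))" by (rule mult_left_mono) simp
    then show ?thesis unfolding power_mult_distrib[symmetric] by (simp add: power_divide algebra_simps)
  qed
  have geo: "(\<Sum>j=1..m. (1 - r) * r ^ j) \<le> 1"
  proof -
    have "(\<Sum>j=1..m. r ^ j) \<le> (\<Sum>j. r ^ j)" using r by (intro sum_le_suminf summable_geometric) auto
    also have "\<dots> = 1 / (1 - r)" using r by (intro suminf_geometric) auto
    finally have "(1 - r) * (\<Sum>j=1..m. r ^ j) \<le> (1 - r) * (1 / (1 - r))" using r by (intro mult_left_mono) auto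
    then show ?thesis using r by (simp add: sum_distrib_left)
  qed
  have "(\<Sum>j=1..m. (\<epsilon> / 4 * (1 / sqrt (real m) + sqrt (1 - exp (- d)) * exp (- d * real j)))\<^sup>2)
      \<le> (\<Sum>j=1..m. \<epsilon>\<^sup>2 / 8 * (1 / real m + (1 - r) * r ^ j))" by (intro sum_mono summand)
  also have "\<dots> = \<epsilon>\<^sup>2 / 8 * ((\<Sum>j=1..m. 1 / real m) + (\<Sum>j=1..m. (1 - r) * r ^ j))"
    by (simp only: sum_distrib_left[symmetric] sum.distrib)
  also have "\<dots> \<le> \<epsilon>\<^sup>2 / 8 * (1 + 1)" using m geo by (intro mult_left_mono add_mono) auto
  finally show ?thesis by simp
qed

section \<open>Choice of truncation level, projection dimension and tilt\<close>

lemma ln_bounds_ge2: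
  fixes L :: nat
  assumes "L \<ge> 2"
  shows "2 / 3 \<le> ln (real L)"
    and "real (nat \<lceil>2 * ln (real L)\<rceil>) \<le> 4 * ln (real L)"
    and "nat \<lceil>2 * ln (real L)\<rceil> \<ge> 1"
    and "L \<le> 2 ^ nat \<lceil>2 * ln (real L)\<rceil>"
proof -
  let ?K = "nat \<lceil>2 * ln (real L)\<rceil>"
  have "ln 2 \<le> ln (real L)" using assms by simp
  then show l: "2 / 3 \<le> ln (real L)" using ln2_ge_two_thirds by linarith
  have "real ?K \<le> 2 * ln (real L) + 1" using l by linarith
  then show "real ?K \<le> 4 * ln (real L)" using l by linarith
  have K: "2 * ln (real L) \<le> real ?K" by linarith
  then show "?K \<ge> 1" using l by linarith
  have "ln (real L) \<le> 2 * ln (real L) * (2 / 3)" using l by simp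
  also have "\<dots> \<le> real ?K * ln 2"
    using K l ln2_ge_two_thirds by (intro mult_mono) auto
  also have "\<dots> = ln (2 ^ ?K)" by (simp add: ln_realpow)
  finally have "real L \<le> 2 ^ ?K" using assms by (subst (asm) ln_le_cancel_iff) auto
  then show "L \<le> 2 ^ ?K" by (metis of_nat_le_iff of_nat_numeral of_nat_power)
qed

lemma rate_bounds:
  fixes n :: "nat ^ 'N::finite"
  assumes L: "card (lattice_box n) \<ge> 2"
  shows "0 < rate n" and "rate n \<le> 3 * real (card (lattice_box n))"
proof -
  let ?L = "real (card (lattice_box n))"
  have l: "2 / 3 \<le> ln ?L" by (rule ln_bounds_ge2[OF L])
  show "0 < rate n" unfolding rate_def using l L by (intro divide_pos_pos) auto
  have "?L powr (1 / real CARD('N)) \<le> ?L powr 1" using L by (intro powr_mono) auto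
  then have 1: "?L powr (1 / real CARD('N)) \<le> ?L" using L by simp
  have "(2 / 3)\<^sup>2 \<le> (ln ?L)\<^sup>2" using l by (intro power_mono) auto
  then have "1 / 3 \<le> (ln ?L)\<^sup>2" by (simp add: power2_eq_square)
  then have "?L * 1 \<le> ?L * (3 * (ln ?L)\<^sup>2)" by (intro mult_left_mono) auto
  moreover have "(ln ?L)\<^sup>2 > 0" using l by simp
  ultimately show "rate n \<le> 3 * ?L" unfolding rate_def using 1 by (simp add: divide_le_eq)
qed

lemma power_scale_bounds:
  fixes x \<beta> :: real
  assumes x: "x \<ge> 1" and \<beta>: "0 < \<beta>" "\<beta> \<le> 1"
  shows "nat \<lceil>x powr \<beta>\<rceil> \<ge> 1" and "x powr \<beta> \<le> real (nat \<lceil>x powr \<beta>\<rceil>)"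
    and "real (nat \<lceil>x powr \<beta>\<rceil>) \<le> 2 * x" and "sqrt (real (nat \<lceil>x powr \<beta>\<rceil>)) \<le> 2 * x powr (\<beta> / 2)"
proof -
  let ?m = "nat \<lceil>x powr \<beta>\<rceil>"
  have y1: "1 \<le> x powr \<beta>" using x \<beta> by (simp add: ge_one_powr_ge_zero)
  have yx: "x powr \<beta> \<le> x" using x powr_mono[OF \<beta>(2) x] by simp
  show "?m \<ge> 1" using y1 by linarith
  show "x powr \<beta> \<le> real ?m" by linarith
  have m: "real ?m \<le> 2 * x powr \<beta>" using y1 by linarith
  then show "real ?m \<le> 2 * x" using yx by linarith
  have "sqrt (real ?m) \<le> sqrt (4 * x powr \<beta>)" using m y1 by simp
  also have "\<dots> = 2 * x powr (\<beta> / 2)"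
    using x by (simp add: real_sqrt_mult powr_half_sqrt[symmetric] powr_powr)
  finally show "sqrt (real ?m) \<le> 2 * x powr (\<beta> / 2)" .
qed

text \<open>\<open>shift\<close> keeps the bias caused by truncation below the level of the
  coordinate. \<open>dim\<close> is the smallness of the tilt that replaces the variance gain in
  dimension one. The exponential of the constant in the exponent is what the quadratic term leaves
  behind when N \<ge> 2.\<close>

lemma coordinate_exceedance_le:
  fixes Z :: "int ^ 'N::finite \<Rightarrow> 'a \<Rightarrow> 'h::{real_inner, banach, second_countable_topology}"
  assumes mhf: "mixing_hilbert_field c\<^sub>0 c\<^sub>1 d\<^sub>0 d\<^sub>1 \<kappa>\<^sub>0 \<kappa>\<^sub>1 \<gamma> M e Z"
    and pos: "c\<^sub>0 > 0" "c\<^sub>1 > 0" "d\<^sub>0 > 0" "d\<^sub>1 > 0" "\<kappa>\<^sub>0 > 0" "\<kappa>\<^sub>1 > 0" "\<gamma> > 0" "C' > 0"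
    and adm: "admissible_size C' n" and \<epsilon>: "\<epsilon> > 0"
    and x_def: "x = \<epsilon> * rate n" and x1: "x \<ge> 1"
    and \<beta>_def: "\<beta> = 2 * \<gamma> / (2 + 3 * \<gamma>)" and m_def: "m = nat \<lceil>x powr \<beta>\<rceil>" and B_def: "B = x powr (\<beta> / \<gamma>)"
    and j: "j \<ge> 1"
    and \<delta>_def: "\<delta> = \<epsilon> / 4 * (1 / sqrt (real m) + sqrt (1 - exp (- d\<^sub>1)) * exp (- d\<^sub>1 * real j))"
    and Q: "1 + \<bar>ln c\<^sub>0\<bar> \<le> c\<^sub>1 * real Q"
    and \<tau>: "\<tau> > 0" "3 * real Q * \<tau> \<le> 1" "6 * \<tau> \<le> c\<^sub>1"
    and dim: "CARD('N) \<ge> 2 \<or> 72 * real Q * d\<^sub>0 * \<tau> \<le> \<epsilon> * sqrt (1 - exp (- d\<^sub>1))"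
    and shift: "(d\<^sub>0 + \<kappa>\<^sub>0) * exp (- \<kappa>\<^sub>1 / 2 * x powr \<beta>) \<le> \<epsilon> / (4 * sqrt (real m))"
  shows "\<P>(\<omega> in M. (\<forall>s\<in>lattice_box n. norm (Z s \<omega>) < B) \<and>
        \<delta> * real (card (lattice_box n)) \<le> \<bar>(\<Sum>s\<in>lattice_box n. Z s \<omega>) \<bullet> e j\<bar>)
    \<le> 6 * exp (2 * c\<^sub>1 * (c\<^sub>0 + 1) * (2 / (1 - exp (- (c\<^sub>1 / real CARD('N))))) ^ CARD('N) / C' - \<tau> / 1024 * x powr \<beta>)"
proof -
  let ?L = "card (lattice_box n)"
  define G where "G = (2 / (1 - exp (- (c\<^sub>1 / real CARD('N))))) ^ CARD('N)"
  have L2: "?L \<ge> 2" using adm by (simp add: admissible_size_def)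
  obtain i w where w: "\<And>t. card (slab n i t) = w" "w > 0" and nL: "n $ i \<le> ?L"
    and root: "real ?L powr (1 / real CARD('N)) \<le> real (n $ i)"
    and wn: "CARD('N) \<ge> 2 \<Longrightarrow> C' * real (n $ i) \<le> real w"
    using admissible_sizeE[OF adm pos(8)] by blast
  define K where "K = nat \<lceil>2 * ln (real ?L)\<rceil>"
  note lnL = ln_bounds_ge2[OF L2, folded K_def]
  have G0: "G > 0" using pos by (simp add: G_def)
  have K1: "K \<ge> 1" and K1r: "1 \<le> (real K)\<^sup>2" using lnL by auto
  have nK: "n $ i \<le> 2 ^ K" using nL lnL by linarith
  have \<beta>01: "0 < \<beta>" "\<beta> \<le> 1" using pos by (auto simp: \<beta>_def divide_le_eq)
  note mb = power_scale_bounds[OF x1 \<beta>01, folded m_def]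
  have sm: "sqrt (real m) > 0" using mb by simp
  have B1: "B \<ge> 1" unfolding B_def using x1 \<beta>01 pos by (intro ge_one_powr_ge_zero) auto
  have Bg: "B powr \<gamma> = x powr \<beta>" unfolding B_def using pos by (simp add: powr_powr)
  have r0: "0 < 1 - exp (- d\<^sub>1)" using pos by simp
  have \<delta>1: "\<epsilon> / (4 * sqrt (real m)) \<le> \<delta>"
    using \<epsilon> r0 by (simp add: \<delta>_def distrib_left)
  have \<delta>2: "\<epsilon> / 4 * sqrt (1 - exp (- d\<^sub>1)) * exp (- d\<^sub>1 * real j) \<le> \<delta>"
    using \<epsilon> r0 sm by (simp add: \<delta>_def distrib_left)
  have \<delta>0: "\<delta> > 0" using \<delta>1 \<epsilon> sm by (smt (verit) divide_pos_pos mult_pos_pos)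
  \<comment> \<open>The balancing weight: since B^\<gamma> = x^\<beta>, dividing the tail exp
    (-\<kappa>1 x^\<beta>) by this square root of it returns the same square root.\<close>
  define a where "a = exp (- \<kappa>\<^sub>1 / 2 * x powr \<beta>)"
  define d where "d = d\<^sub>0 * exp (- d\<^sub>1 * real j)"
  have d_le: "d \<le> d\<^sub>0" using pos by (simp add: d_def mult_le_cancel_left1)
  have ashift: "a * d + \<kappa>\<^sub>0 * exp (- \<kappa>\<^sub>1 * B powr \<gamma>) / a \<le> \<delta>"
  proof -
    have "\<kappa>\<^sub>0 * exp (- \<kappa>\<^sub>1 * B powr \<gamma>) / a = \<kappa>\<^sub>0 * a"
      by (simp add: a_def Bg exp_diff[symmetric] times_divide_eq_right[symmetric] del: times_divide_eq_right)
    moreover have "a * d \<le> d\<^sub>0 * a" using d_le by (simp add: a_def mult.commute)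
    moreover have "d\<^sub>0 * a + \<kappa>\<^sub>0 * a \<le> \<epsilon> / (4 * sqrt (real m))" using shift by (simp add: a_def algebra_simps)
    ultimately show ?thesis using \<delta>1 by linarith
  qed
  \<comment> \<open>With this scaling the two conditions on the tilt become conditions on
    \<open>\<tau>\<close> that do not involve the size of the box.\<close>
  define l where "l = \<tau> / (real K)\<^sup>2"
  have lK: "l * (real K)\<^sup>2 = \<tau>" using K1 by (simp add: l_def)
  have l0: "l > 0" using \<tau> K1 by (simp add: l_def)
  have l_le: "l \<le> \<tau>" using mult_left_mono[OF K1r, of l] l0 lK by simp
  define v where "v = (if CARD('N) \<ge> 2 then 4 * (c\<^sub>0 + 1) * G / real w else d / (4 * B\<^sup>2))"
  \<comment> \<open>Half of the linear term of the exponent. The other half is reserved for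
    absorbing the quadratic term in dimension one.\<close>
  define F where "F = l * real (n $ i) * \<delta> / (8 * B)"
  have F0: "F \<ge> 0" using l0 \<delta>0 B1 by (simp add: F_def)
  have "\<P>(\<omega> in M. (\<forall>s\<in>lattice_box n. norm (Z s \<omega>) < B) \<and>
        \<delta> * real (card (lattice_box n)) \<le> \<bar>(\<Sum>s\<in>lattice_box n. Z s \<omega>) \<bullet> e j\<bar>)
     \<le> 6 * exp (- l * \<delta> * real (n $ i) / (4 * B) + 9 * l\<^sup>2 * v * (real Q * (real K)\<^sup>2) * real (n $ i))"
  proof (rule coordinate_tail[where w=w and a=a and d=d])
    show "mixing_field M Z c\<^sub>0 c\<^sub>1" using mhf pos by (intro mixing_hilbert_field_mixing_field)
    show "norm (e j) = 1" using mhf j by (intro norm_orthonormal_basis) (auto simp: mixing_hilbert_field_def)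
    show "a * d + \<kappa>\<^sub>0 * exp (- \<kappa>\<^sub>1 * B powr \<gamma>) / a \<le> \<delta>" by (rule ashift)
    show "v = d / (4 * B\<^sup>2) \<or> v = 4 * (c\<^sub>0 + 1) * (2 / (1 - exp (- (c\<^sub>1 / real CARD('N))))) ^ CARD('N) / real w"
      by (simp add: v_def G_def)
    show "3 * real Q * l * (real K)\<^sup>2 \<le> 1" "6 * l * (real K)\<^sup>2 \<le> c\<^sub>1"
      using \<tau> lK by (simp_all add: mult.assoc)
  qed (use mhf j B1 w Q K1 nK l0 in \<open>auto simp: mixing_hilbert_field_def d_def a_def\<close>)
  also have "- l * \<delta> * real (n $ i) / (4 * B) = - 2 * F" using B1 by (simp add: F_def field_simps)
  also have "9 * l\<^sup>2 * v * (real Q * (real K)\<^sup>2) * real (n $ i) \<le> 2 * c\<^sub>1 * (c\<^sub>0 + 1) * G / C' + F"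
  proof -
    have eq: "9 * l\<^sup>2 * v * (real Q * (real K)\<^sup>2) * real (n $ i) = l * real (n $ i) * (9 * real Q * \<tau> * v)"
      by (simp add: lK[symmetric] power2_eq_square)
    show ?thesis
    proof (cases "CARD('N) \<ge> 2")
      case True
      \<comment> \<open>The normalised variance carries a factor 1/w, which cancels the side length:
        the quadratic term is bounded by a constant independent of the box.\<close>
      have nw: "real (n $ i) / real w \<le> 1 / C'"
        using wn[OF True] pos w(2) by (simp add: field_simps)
      have "l * real (n $ i) * (9 * real Q * \<tau> * v) = 12 * l * (3 * real Q * \<tau>) * ((c\<^sub>0 + 1) * G) * (real (n $ i) / real w)"
        using True by (simp add: v_def)
      also have "\<dots> \<le> 12 * \<tau> * 1 * ((c\<^sub>0 + 1) * G) * (1 / C')"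
        using nw l_le \<tau> l0 pos G0 by (intro mult_mono mult_nonneg_nonneg) auto
      also have "\<dots> = 12 * \<tau> * ((c\<^sub>0 + 1) * G / C')" by simp
      also have "\<dots> \<le> 2 * c\<^sub>1 * ((c\<^sub>0 + 1) * G / C')" using \<tau> pos G0 by (intro mult_right_mono) auto
      finally show ?thesis unfolding eq using F0 by (simp add: mult.assoc)
    next
      case False
      \<comment> \<open>The variance of the coordinate and the second part of its level decay at the
        same rate in j, so the single condition \<open>dim\<close> on \<open>\<tau>\<close> works
        for all coordinates.\<close>
      have "9 * real Q * \<tau> * v \<le> \<delta> / (8 * B)"
      proof -
        have "72 * real Q * d\<^sub>0 * \<tau> * exp (- d\<^sub>1 * real j) \<le> \<epsilon> * sqrt (1 - exp (- d\<^sub>1)) * exp (- d\<^sub>1 * real j)"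
          using dim False by (intro mult_right_mono) auto
        moreover have "18 * real Q * \<tau> * d = 72 * real Q * d\<^sub>0 * \<tau> * exp (- d\<^sub>1 * real j) / 4" by (simp add: d_def)
        moreover have "\<epsilon> / 4 * sqrt (1 - exp (- d\<^sub>1)) * exp (- d\<^sub>1 * real j) = \<epsilon> * sqrt (1 - exp (- d\<^sub>1)) * exp (- d\<^sub>1 * real j) / 4" by simp
        ultimately have "18 * real Q * \<tau> * d \<le> \<delta>" using \<delta>2 by linarith
        also have "\<delta> * 1 \<le> \<delta> * B" using B1 \<delta>0 by (intro mult_left_mono) auto
        finally have "18 * real Q * \<tau> * d \<le> \<delta> * B" by simp
        then show ?thesis using False B1 by (simp add: v_def field_simps power2_eq_square)
      qed
      then have "l * real (n $ i) * (9 * real Q * \<tau> * v) \<le> l * real (n $ i) * (\<delta> / (8 * B))"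
        using l0 by (intro mult_left_mono) auto
      moreover have "0 \<le> 2 * c\<^sub>1 * (c\<^sub>0 + 1) * G / C'" using pos G0 by simp
      ultimately show ?thesis unfolding eq by (simp add: F_def)
    qed
  qed
  then have "- 2 * F + 9 * l\<^sup>2 * v * (real Q * (real K)\<^sup>2) * real (n $ i) \<le> 2 * c\<^sub>1 * (c\<^sub>0 + 1) * G / C' - F" by linarith
  \<comment> \<open>1024 = 8 * 16 * 8: the first 8 is in the definition of \<open>F\<close>, 16
    comes from K \<le> 4 ln |I_n|, and the last 8 from the level \<epsilon>/(4 sqrt m) with sqrt m
    at most 2 x^(\<beta>/2).\<close>
  also have "\<tau> / 1024 * x powr \<beta> \<le> F"
  proof -
    have K4: "(real K)\<^sup>2 \<le> 16 * (ln (real ?L))\<^sup>2"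
      using power_mono[OF lnL(2), of 2] by (simp add: power_mult_distrib)
    have lL: "(ln (real ?L))\<^sup>2 > 0" using lnL(1) by simp
    have "\<epsilon> / (4 * (2 * x powr (\<beta> / 2))) \<le> \<epsilon> / (4 * sqrt (real m))"
      using \<epsilon> sm mb(4) by (intro frac_le) auto
    then have \<delta>3: "\<epsilon> / (8 * x powr (\<beta> / 2)) \<le> \<delta>" using \<delta>1 by simp
    have "rate n / 16 \<le> real (n $ i) / (real K)\<^sup>2"
    proof -
      have "rate n / 16 = real ?L powr (1 / real CARD('N)) / (16 * (ln (real ?L))\<^sup>2)" by (simp add: rate_def)
      also have "\<dots> \<le> real (n $ i) / (real K)\<^sup>2" using root K4 K1 by (intro frac_le) auto
      finally show ?thesis .
    qed
    then have "rate n / 16 * (\<epsilon> / (8 * x powr (\<beta> / 2))) \<le> real (n $ i) / (real K)\<^sup>2 * \<delta>"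
      using \<delta>3 \<epsilon> rate_bounds(1)[OF L2] by (intro mult_mono) auto
    then have "\<tau> / (8 * B) * (rate n / 16 * (\<epsilon> / (8 * x powr (\<beta> / 2)))) \<le> \<tau> / (8 * B) * (real (n $ i) / (real K)\<^sup>2 * \<delta>)"
      using \<tau> B1 by (intro mult_left_mono) auto
    also have "\<dots> = F" by (simp add: F_def l_def mult_ac)
    also have "\<tau> / (8 * B) * (rate n / 16 * (\<epsilon> / (8 * x powr (\<beta> / 2)))) = \<tau> / 1024 * (x / (x powr (\<beta> / 2) * x powr (\<beta> / \<gamma>)))"
      by (simp add: x_def[symmetric] B_def mult.commute[of \<epsilon>]) (simp add: x_def mult_ac)
    also have "x / (x powr (\<beta> / 2) * x powr (\<beta> / \<gamma>)) = x powr (1 - (\<beta> / 2 + \<beta> / \<gamma>))"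
      using x1 by (simp add: powr_diff powr_add)
    \<comment> \<open>The balance equation that determines \<open>\<beta>\<close>.\<close>
    also have "1 - (\<beta> / 2 + \<beta> / \<gamma>) = \<beta>"
    proof -
      define D where "D = 2 + 3 * \<gamma>"
      have D: "\<beta> = 2 * \<gamma> / D" "D > 0" using pos by (simp_all add: \<beta>_def D_def)
      have "1 - (\<beta> / 2 + \<beta> / \<gamma>) = 1 - (\<gamma> / D + 2 / D)" using pos by (simp add: D(1))
      also have "\<dots> = (D - \<gamma> - 2) / D" using D(2) by (simp add: field_simps)
      also have "\<dots> = \<beta>" by (simp add: D(1)) (simp add: D_def)
      finally show ?thesis .
    qed
    finally show ?thesis .
  qed
  then have "2 * c\<^sub>1 * (c\<^sub>0 + 1) * G / C' - F \<le> 2 * c\<^sub>1 * (c\<^sub>0 + 1) * G / C' - \<tau> / 1024 * x powr \<beta>" by linarith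
  finally show ?thesis by (simp add: G_def)
qed

text \<open>In the polynomial factor, |I_n|^2 stems from 1/\<epsilon>^2 in the projection remainder
  (x \<ge> 1 forces 1/\<epsilon> \<le> 3 |I_n|), |I_n| from the union over sites, and \<epsilon>
  |I_n| from the number of coordinates. Where the estimates do not apply, the claimed bound is at
  least 1.\<close>

lemma exceedance_le:
  fixes Z :: "int ^ 'N::finite \<Rightarrow> 'a \<Rightarrow> 'h::{real_inner, banach, second_countable_topology}"
  assumes mhf: "mixing_hilbert_field c\<^sub>0 c\<^sub>1 d\<^sub>0 d\<^sub>1 \<kappa>\<^sub>0 \<kappa>\<^sub>1 \<gamma> M e Z"
    and pos: "c\<^sub>0 > 0" "c\<^sub>1 > 0" "d\<^sub>0 > 0" "d\<^sub>1 > 0" "\<kappa>\<^sub>0 > 0" "\<kappa>\<^sub>1 > 0" "\<gamma> > 0" "C' > 0"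
    and adm: "admissible_size C' n" and \<epsilon>: "\<epsilon> > 0"
    and Q: "1 + \<bar>ln c\<^sub>0\<bar> \<le> c\<^sub>1 * real Q"
    and \<tau>: "\<tau> > 0" "3 * real Q * \<tau> \<le> 1" "6 * \<tau> \<le> c\<^sub>1"
    and dim: "CARD('N) \<ge> 2 \<or> 72 * real Q * d\<^sub>0 * \<tau> \<le> \<epsilon> * sqrt (1 - exp (- d\<^sub>1))"
    and A: "A > 0" "A \<le> \<tau> / 1024" "A \<le> \<kappa>\<^sub>1 / 2" "A \<le> d\<^sub>1"
    and E_def: "E = 2 * c\<^sub>1 * (c\<^sub>0 + 1) * (2 / (1 - exp (- (c\<^sub>1 / real CARD('N))))) ^ CARD('N) / C'"
    and C_def: "C = 36 * d\<^sub>0 / (1 - exp (- d\<^sub>1)) + \<kappa>\<^sub>0 + 36 * exp E + 24 * (d\<^sub>0 + \<kappa>\<^sub>0) + exp d\<^sub>1"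
  shows "mean_exceedance M Z n \<epsilon> \<le>
    C * (1 + \<epsilon>) * real (card (lattice_box n)) ^ 2 * exp (- A * (\<epsilon> * rate n) powr (2 * \<gamma> / (2 + 3 * \<gamma>)))"
proof -
  let ?L = "real (card (lattice_box n))"
  define \<beta> where "\<beta> = 2 * \<gamma> / (2 + 3 * \<gamma>)"
  define x where "x = \<epsilon> * rate n"
  define y where "y = x powr \<beta>"
  define W where "W = (1 + \<epsilon>) * ?L ^ 2 * exp (- A * y)"
  interpret prob_space M using mhf by (simp add: mixing_hilbert_field_def)
  have L2: "card (lattice_box n) \<ge> 2" using adm by (simp add: admissible_size_def)
  then have L2r: "?L \<ge> 2" by simp
  have r: "0 < rate n" "rate n \<le> 3 * ?L" by (rule rate_bounds[OF L2])+
  have \<beta>01: "0 < \<beta>" "\<beta> \<le> 1" using pos by (auto simp: \<beta>_def divide_le_eq)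
  have r0: "0 < 1 - exp (- d\<^sub>1)" using pos by simp
  have y0: "y \<ge> 0" by (simp add: y_def)
  have LL: "?L \<le> ?L ^ 2" "1 \<le> ?L ^ 2" using L2r by (auto simp: power2_eq_square intro: order_trans[of 1 2] mult_ge1_I)
  have Wge: "?L ^ 2 * exp (- A * y) \<le> W" "\<epsilon> * ?L ^ 2 * exp (- A * y) \<le> W" "?L * exp (- A * y) \<le> W"
    "\<epsilon> * ?L * exp (- A * y) \<le> W" "exp (- A * y) \<le> W"
  proof -
    have "c * exp (- A * y) \<le> W" if "c \<le> (1 + \<epsilon>) * ?L ^ 2" for c
      unfolding W_def using that by (rule mult_right_mono) simp
    note * = this
    have le: "?L ^ 2 \<le> (1 + \<epsilon>) * ?L ^ 2" "\<epsilon> * ?L ^ 2 \<le> (1 + \<epsilon>) * ?L ^ 2" "\<epsilon> * ?L \<le> \<epsilon> * ?L ^ 2"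
      using \<epsilon> LL by (auto simp: distrib_right)
    show "?L ^ 2 * exp (- A * y) \<le> W" "\<epsilon> * ?L ^ 2 * exp (- A * y) \<le> W" "?L * exp (- A * y) \<le> W"
      "\<epsilon> * ?L * exp (- A * y) \<le> W" by (rule *; use le LL in linarith)+
    show "exp (- A * y) \<le> W" using *[of 1] le LL by simp
  qed
  have W0: "W > 0" using \<epsilon> L2r by (simp add: W_def)
  have ex: "exp (- c * y) \<le> exp (- A * y)" if "A \<le> c" for c
    using mult_right_mono[OF that y0] by simp
  have P1: "mean_exceedance M Z n \<epsilon> \<le> 1" by (simp add: mean_exceedance_def)
  have Cge: "K * W \<le> C * W" if "K \<le> C" for K using that W0 by simp
  have Cparts: "0 < 36 * d\<^sub>0 / (1 - exp (- d\<^sub>1))" "0 < exp E" "0 < exp d\<^sub>1" using pos r0 by auto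
  have "mean_exceedance M Z n \<epsilon> \<le> C * W"
  proof (cases "x \<ge> 1")
    case False
    \<comment> \<open>For x < 1 the summand \<open>exp d\<^sub>1\<close> of \<open>C\<close>
      outweighs exp (-A y), because A \<le> d1 and y \<le> 1.\<close>
    have "y \<le> 1" unfolding y_def using False \<epsilon> r \<beta>01 by (intro powr_le1) (auto simp: x_def)
    then have "A * y \<le> d\<^sub>1" using A y0 mult_mono[of A d\<^sub>1 y 1] by simp
    then have "1 \<le> exp d\<^sub>1 * exp (- A * y)" by (simp add: exp_add[symmetric])
    also have "\<dots> \<le> exp d\<^sub>1 * W" using Wge by (intro mult_left_mono) auto
    also have "\<dots> \<le> C * W" by (rule Cge) (use Cparts pos in \<open>simp add: C_def\<close>)
    finally show ?thesis using P1 by linarith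
  next
    case True
    define m where "m = nat \<lceil>x powr \<beta>\<rceil>"
    define B where "B = x powr (\<beta> / \<gamma>)"
    note mb = power_scale_bounds[OF True \<beta>01, folded m_def, folded y_def]
    have sm: "sqrt (real m) > 0" using mb by simp
    have inv: "1 / \<epsilon> \<le> 3 * ?L" "x \<le> 3 * \<epsilon> * ?L"
    proof -
      have "1 / \<epsilon> \<le> rate n" using True \<epsilon> by (simp add: x_def field_simps)
      then show "1 / \<epsilon> \<le> 3 * ?L" using r by linarith
      show "x \<le> 3 * \<epsilon> * ?L" using r \<epsilon> by (simp add: x_def)
    qed
    show ?thesis
    proof (cases "(d\<^sub>0 + \<kappa>\<^sub>0) * exp (- \<kappa>\<^sub>1 / 2 * y) \<le> \<epsilon> / (4 * sqrt (real m))")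
      case False
      \<comment> \<open>If the truncation bias is too large, \<epsilon> lies below a multiple of
        sqrt m times the decaying exponential. As sqrt m is at most 6 \<epsilon> |I_n|, cancelling
        \<epsilon> shows that the claimed bound exceeds 1.\<close>
      have "sqrt (real m) \<le> 2 * x"
      proof -
        have "sqrt (real m) * 1 \<le> sqrt (real m) * sqrt (real m)" using mb(1) by (intro mult_left_mono) auto
        also have "\<dots> = real m" by simp
        finally show ?thesis using mb(3) by linarith
      qed
      have "\<epsilon> < (d\<^sub>0 + \<kappa>\<^sub>0) * exp (- \<kappa>\<^sub>1 / 2 * y) * (4 * sqrt (real m))"
        using False sm by (simp add: not_le divide_less_eq)
      also have "\<dots> \<le> (d\<^sub>0 + \<kappa>\<^sub>0) * exp (- A * y) * (4 * (2 * (3 * \<epsilon> * ?L)))"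
      proof (intro mult_mono)
        show "exp (- \<kappa>\<^sub>1 / 2 * y) \<le> exp (- A * y)" using ex[of "\<kappa>\<^sub>1 / 2"] A by simp
        show "sqrt (real m) \<le> 2 * (3 * \<epsilon> * ?L)" using \<open>sqrt (real m) \<le> 2 * x\<close> inv by linarith
      qed (use pos in auto)
      finally have "\<epsilon> * 1 < \<epsilon> * (24 * (d\<^sub>0 + \<kappa>\<^sub>0) * (?L * exp (- A * y)))" by (simp add: algebra_simps)
      then have "1 < 24 * (d\<^sub>0 + \<kappa>\<^sub>0) * (?L * exp (- A * y))" using \<epsilon> by (simp only: mult_less_cancel_left_pos)
      also have "\<dots> \<le> 24 * (d\<^sub>0 + \<kappa>\<^sub>0) * W" using Wge pos by (intro mult_left_mono) auto
      also have "\<dots> \<le> C * W" by (rule Cge) (use Cparts pos in \<open>simp add: C_def\<close>)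
      finally show ?thesis using P1 by linarith
    next
      case shift: True
      define \<delta> where "\<delta> j = \<epsilon> / 4 * (1 / sqrt (real m) + sqrt (1 - exp (- d\<^sub>1)) * exp (- d\<^sub>1 * real j))" for j
      have \<delta>0: "\<delta> j \<ge> 0" for j using \<epsilon> r0 by (simp add: \<delta>_def)
      have \<delta>s: "(\<Sum>j=1..m. (\<delta> j)\<^sup>2) \<le> \<epsilon>\<^sup>2 / 4"
        unfolding \<delta>_def by (rule sum_coordinate_level_le[OF pos(4) mb(1)])
      have B0: "B > 0" using True by (simp add: B_def)
      have Bg: "B powr \<gamma> = y" unfolding B_def y_def using pos by (simp add: powr_powr)
      define F where "F j = \<P>(\<omega> in M. (\<forall>s\<in>lattice_box n. norm (Z s \<omega>) < B) \<and>
        \<delta> j * ?L \<le> \<bar>(\<Sum>s\<in>lattice_box n. Z s \<omega>) \<bullet> e j\<bar>)" for j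
      have F: "F j \<le> 6 * exp E * exp (- A * y)" if "j \<ge> 1" for j
      proof -
        have "F j \<le> 6 * exp (E - \<tau> / 1024 * x powr \<beta>)"
          unfolding F_def E_def
          by (rule coordinate_exceedance_le[OF mhf pos adm \<epsilon> x_def True \<beta>_def m_def B_def that \<delta>_def Q \<tau> dim shift[unfolded y_def]])
        also have "\<dots> = 6 * exp E * exp (- (\<tau> / 1024) * y)" by (simp add: y_def exp_add[symmetric])
        also have "\<dots> \<le> 6 * exp E * exp (- A * y)" using ex[OF A(2)] by (intro mult_left_mono) auto
        finally show ?thesis .
      qed
      have T1: "4 * d\<^sub>0 * exp (- d\<^sub>1 * real m) / ((1 - exp (- d\<^sub>1)) * \<epsilon>\<^sup>2) \<le> 36 * d\<^sub>0 / (1 - exp (- d\<^sub>1)) * W"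
      proof -
        have "exp (- d\<^sub>1 * real m) \<le> exp (- d\<^sub>1 * y)" using mb(2) pos by simp
        also have "\<dots> \<le> exp (- A * y)" using ex A by blast
        finally have e1: "exp (- d\<^sub>1 * real m) \<le> exp (- A * y)" .
        have "(1 / \<epsilon>)\<^sup>2 \<le> (3 * ?L)\<^sup>2" using inv \<epsilon> by (intro power_mono) auto
        then have e2: "1 / \<epsilon>\<^sup>2 \<le> 9 * ?L ^ 2" by (simp add: power_divide power_mult_distrib)
        have "4 * d\<^sub>0 * exp (- d\<^sub>1 * real m) / ((1 - exp (- d\<^sub>1)) * \<epsilon>\<^sup>2) =
            4 * d\<^sub>0 / (1 - exp (- d\<^sub>1)) * (1 / \<epsilon>\<^sup>2 * exp (- d\<^sub>1 * real m))" by simp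
        also have "\<dots> \<le> 4 * d\<^sub>0 / (1 - exp (- d\<^sub>1)) * (9 * ?L ^ 2 * exp (- A * y))"
          using e1 e2 pos r0 by (intro mult_left_mono mult_mono) auto
        also have "\<dots> = 36 * d\<^sub>0 / (1 - exp (- d\<^sub>1)) * (?L ^ 2 * exp (- A * y))" by simp
        also have "\<dots> \<le> 36 * d\<^sub>0 / (1 - exp (- d\<^sub>1)) * W" using Wge(1) pos r0 by (intro mult_left_mono) auto
        finally show ?thesis .
      qed
      have T2: "?L * (\<kappa>\<^sub>0 * exp (- \<kappa>\<^sub>1 * B powr \<gamma>)) \<le> \<kappa>\<^sub>0 * W"
      proof -
        have "exp (- \<kappa>\<^sub>1 * B powr \<gamma>) \<le> exp (- A * y)" unfolding Bg using ex[of \<kappa>\<^sub>1] A pos by simp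
        then have "?L * (\<kappa>\<^sub>0 * exp (- \<kappa>\<^sub>1 * B powr \<gamma>)) \<le> ?L * (\<kappa>\<^sub>0 * exp (- A * y))"
          using pos by (intro mult_left_mono) auto
        also have "\<dots> = \<kappa>\<^sub>0 * (?L * exp (- A * y))" by simp
        also have "\<dots> \<le> \<kappa>\<^sub>0 * W" using Wge(3) pos by (intro mult_left_mono) auto
        finally show ?thesis .
      qed
      have T3: "(\<Sum>j=1..m. F j) \<le> 36 * exp E * W"
      proof -
        have "(\<Sum>j=1..m. F j) \<le> (\<Sum>j=1..m. 6 * exp E * exp (- A * y))" by (intro sum_mono F) auto
        also have "\<dots> = real m * (6 * exp E * exp (- A * y))" by simp
        also have "\<dots> \<le> (6 * \<epsilon> * ?L) * (6 * exp E * exp (- A * y))"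
          using mb(3) inv(2) by (intro mult_right_mono) auto
        also have "\<dots> = 36 * exp E * (\<epsilon> * ?L * exp (- A * y))" by simp
        also have "\<dots> \<le> 36 * exp E * W" using Wge(4) by (intro mult_left_mono) auto
        finally show ?thesis .
      qed
      have "mean_exceedance M Z n \<epsilon> \<le> 4 * d\<^sub>0 * exp (- d\<^sub>1 * real m) / ((1 - exp (- d\<^sub>1)) * \<epsilon>\<^sup>2)
        + ?L * (\<kappa>\<^sub>0 * exp (- \<kappa>\<^sub>1 * B powr \<gamma>)) + (\<Sum>j=1..m. F j)"
        unfolding F_def by (rule mean_exceedance_le[OF mhf pos(3,4) \<epsilon> _ mb(1) B0 \<delta>0 \<delta>s]) (use L2 in simp)
      also have "\<dots> \<le> 36 * d\<^sub>0 / (1 - exp (- d\<^sub>1)) * W + \<kappa>\<^sub>0 * W + 36 * exp E * W"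
        using T1 T2 T3 by linarith
      also have "\<dots> = (36 * d\<^sub>0 / (1 - exp (- d\<^sub>1)) + \<kappa>\<^sub>0 + 36 * exp E) * W" by (simp only: distrib_right)
      also have "\<dots> \<le> C * W" by (rule Cge) (use Cparts pos in \<open>simp add: C_def\<close>)
      finally show ?thesis .
    qed
  qed
  then show ?thesis by (simp add: W_def y_def x_def \<beta>_def mult.assoc)
qed

text \<open>All constants are fixed before the probability space, the field and the box. The rate
  \<open>A\<close> is a function of \<epsilon> only to accommodate dimension one.\<close>

lemma exceedance_exponential:
  fixes c\<^sub>0 c\<^sub>1 d\<^sub>0 d\<^sub>1 \<kappa>\<^sub>0 \<kappa>\<^sub>1 \<gamma> C' :: real
  assumes pos: "c\<^sub>0 > 0" "c\<^sub>1 > 0" "d\<^sub>0 > 0" "d\<^sub>1 > 0" "\<kappa>\<^sub>0 > 0" "\<kappa>\<^sub>1 > 0" "\<gamma> > 0" "C' > 0"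
  obtains C :: real and A :: "real \<Rightarrow> real" where "C > 0" "\<And>\<epsilon>. \<epsilon> > 0 \<Longrightarrow> A \<epsilon> > 0"
    "\<And>\<epsilon>. CARD('N::finite) \<ge> 2 \<Longrightarrow> A \<epsilon> = A 1"
    "\<And>(M :: 'a measure) (e :: nat \<Rightarrow> 'h::{real_inner, banach, second_countable_topology})
        (Z :: int ^ 'N \<Rightarrow> 'a \<Rightarrow> 'h) n \<epsilon>.
      mixing_hilbert_field c\<^sub>0 c\<^sub>1 d\<^sub>0 d\<^sub>1 \<kappa>\<^sub>0 \<kappa>\<^sub>1 \<gamma> M e Z \<Longrightarrow> admissible_size C' n \<Longrightarrow> \<epsilon> > 0 \<Longrightarrow>
      mean_exceedance M Z n \<epsilon> \<le>
        C * (1 + \<epsilon>) * real (card (lattice_box n)) ^ 2 * exp (- A \<epsilon> * (\<epsilon> * rate n) powr (2 * \<gamma> / (2 + 3 * \<gamma>)))"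
proof -
  define Q where "Q = nat \<lceil>(1 + \<bar>ln c\<^sub>0\<bar>) / c\<^sub>1\<rceil>"
  have "(1 + \<bar>ln c\<^sub>0\<bar>) / c\<^sub>1 \<le> real Q" unfolding Q_def by linarith
  then have Q: "1 + \<bar>ln c\<^sub>0\<bar> \<le> c\<^sub>1 * real Q" using pos by (simp add: divide_le_eq mult.commute)
  then have Q0: "real Q > 0" using pos by (cases Q) auto
  \<comment> \<open>\<open>\<theta>\<close> is the largest tilt scale meeting both dimension-free
    constraints; \<open>s\<close> turns the additional constraint in dimension one into
    \<open>\<tau> \<epsilon> \<le> \<epsilon> * s\<close>.\<close>
  define \<theta> where "\<theta> = min (1 / (3 * real Q)) (c\<^sub>1 / 6)"
  define s where "s = sqrt (1 - exp (- d\<^sub>1)) / (72 * real Q * d\<^sub>0)"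
  have s0: "s > 0" using pos Q0 by (simp add: s_def)
  define \<tau> where "\<tau> \<epsilon> = (if CARD('N) \<ge> 2 then \<theta> else min \<theta> (\<epsilon> * s))" for \<epsilon> :: real
  define A where "A \<epsilon> = min (\<tau> \<epsilon> / 1024) (min (\<kappa>\<^sub>1 / 2) d\<^sub>1)" for \<epsilon>
  define E where "E = 2 * c\<^sub>1 * (c\<^sub>0 + 1) * (2 / (1 - exp (- (c\<^sub>1 / real CARD('N))))) ^ CARD('N) / C'"
  define C where "C = 36 * d\<^sub>0 / (1 - exp (- d\<^sub>1)) + \<kappa>\<^sub>0 + 36 * exp E + 24 * (d\<^sub>0 + \<kappa>\<^sub>0) + exp d\<^sub>1"
  have \<theta>: "\<theta> > 0" "3 * real Q * \<theta> \<le> 1" "6 * \<theta> \<le> c\<^sub>1"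
  proof -
    show "\<theta> > 0" using Q0 pos by (simp add: \<theta>_def)
    have "3 * real Q * \<theta> \<le> 3 * real Q * (1 / (3 * real Q))" by (intro mult_left_mono) (auto simp: \<theta>_def)
    then show "3 * real Q * \<theta> \<le> 1" using Q0 by simp
    show "6 * \<theta> \<le> c\<^sub>1" by (simp add: \<theta>_def)
  qed
  have \<tau>: "\<tau> \<epsilon> > 0" "3 * real Q * \<tau> \<epsilon> \<le> 1" "6 * \<tau> \<epsilon> \<le> c\<^sub>1" if "\<epsilon> > 0" for \<epsilon>
  proof -
    show "\<tau> \<epsilon> > 0" using \<theta> s0 that by (simp add: \<tau>_def)
    have le: "\<tau> \<epsilon> \<le> \<theta>" by (simp add: \<tau>_def)
    then show "6 * \<tau> \<epsilon> \<le> c\<^sub>1" using \<theta> by linarith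
    have "3 * real Q * \<tau> \<epsilon> \<le> 3 * real Q * \<theta>" using le by (intro mult_left_mono) auto
    then show "3 * real Q * \<tau> \<epsilon> \<le> 1" using \<theta> by linarith
  qed
  have dim: "CARD('N) \<ge> 2 \<or> 72 * real Q * d\<^sub>0 * \<tau> \<epsilon> \<le> \<epsilon> * sqrt (1 - exp (- d\<^sub>1))" for \<epsilon>
  proof (cases "CARD('N) \<ge> 2")
    case False
    then have "72 * real Q * d\<^sub>0 * \<tau> \<epsilon> \<le> 72 * real Q * d\<^sub>0 * (\<epsilon> * s)"
      using pos by (intro mult_left_mono) (auto simp: \<tau>_def)
    also have "\<dots> = \<epsilon> * sqrt (1 - exp (- d\<^sub>1))" using Q0 pos by (simp add: s_def)
    finally show ?thesis ..
  qed simp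
  show ?thesis
  proof (rule that[of C A])
    show "C > 0" unfolding C_def using pos by (intro add_pos_pos) auto
    show "A \<epsilon> > 0" if "\<epsilon> > 0" for \<epsilon> using \<tau>[OF that] pos by (simp add: A_def)
    show "A \<epsilon> = A 1" if "CARD('N) \<ge> 2" for \<epsilon> using that by (simp add: A_def \<tau>_def)
    fix M :: "'a measure" and e :: "nat \<Rightarrow> 'h" and Z :: "int ^ 'N \<Rightarrow> 'a \<Rightarrow> 'h" and n :: "nat ^ 'N" and \<epsilon> :: real
    assume "mixing_hilbert_field c\<^sub>0 c\<^sub>1 d\<^sub>0 d\<^sub>1 \<kappa>\<^sub>0 \<kappa>\<^sub>1 \<gamma> M e Z" "admissible_size C' n" and \<epsilon>: "\<epsilon> > 0"
    then show "mean_exceedance M Z n \<epsilon> \<le>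
        C * (1 + \<epsilon>) * real (card (lattice_box n)) ^ 2 * exp (- A \<epsilon> * (\<epsilon> * rate n) powr (2 * \<gamma> / (2 + 3 * \<gamma>)))"
      using \<tau>[OF \<epsilon>] pos
      by (intro exceedance_le[OF _ pos _ _ Q _ _ _ dim _ _ _ _ E_def C_def]) (auto simp: A_def)
  qed
qed

section \<open>Absorbing the polynomial factor\<close>

definition refined_factor :: "nat ^ 'N::finite \<Rightarrow> real \<Rightarrow> real" where
  "refined_factor n \<epsilon> = \<epsilon> powr (-2) + (\<epsilon> * rate n) powr (2 / 5) + (rate n) powr (1 / 5) * \<epsilon> powr (-4 / 5)"

text \<open>From ln L \<le> L^s / s with s = 1/(k N), chosen so that the k-th power produces exactly
  L^(1/N).\<close>

lemma ln_power_le_root: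
  assumes "L \<ge> 1" "k \<ge> 1" "N > 0"
  shows "(ln L) ^ k \<le> (real k * N) ^ k * L powr (1 / N)"
proof -
  have "ln L \<le> L powr (1 / (real k * N)) / (1 / (real k * N))"
    using assms by (intro ln_powr_bound) auto
  then have "(ln L) ^ k \<le> (real k * N * L powr (1 / (real k * N))) ^ k"
    using assms by (intro power_mono) (auto simp: mult.commute)
  also have "\<dots> = (real k * N) ^ k * L powr (1 / N)"
    using assms by (simp add: power_mult_distrib powr_realpow[symmetric] powr_powr)
  finally show ?thesis .
qed

lemma rate_lower:
  fixes n :: "nat ^ 'N::finite"
  assumes "card (lattice_box n) \<ge> 2"
  shows "1 / (4 * (real CARD('N))\<^sup>2) \<le> rate n"
proof -
  let ?L = "real (card (lattice_box n))" and ?N = "real CARD('N)"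
  have "(ln ?L)\<^sup>2 \<le> (2 * ?N)\<^sup>2 * ?L powr (1 / ?N)" using ln_power_le_root[of ?L 2 ?N] assms by simp
  moreover have "(ln ?L)\<^sup>2 > 0" using ln_bounds_ge2(1)[OF assms] by simp
  ultimately show ?thesis by (simp add: rate_def field_simps power2_eq_square)
qed

text \<open>The last bound is uniform: if x \<ge> 1 the second summand is at least 1; otherwise
  \<epsilon> \<le> 1/\<open>rate n\<close> \<le> 4 N^2, so the first summand is bounded
  below.\<close>

lemma refined_factor_lower:
  fixes n :: "nat ^ 'N::finite"
  assumes L: "card (lattice_box n) \<ge> 2" and \<epsilon>: "\<epsilon> > 0"
  shows "\<epsilon> powr (-2) \<le> refined_factor n \<epsilon>" "\<epsilon> * rate n \<ge> 1 \<Longrightarrow> 1 \<le> refined_factor n \<epsilon>"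
    "1 / (16 * (real CARD('N)) ^ 4) \<le> refined_factor n \<epsilon>"
proof -
  let ?N = "real CARD('N)"
  show *: "\<epsilon> powr (-2) \<le> refined_factor n \<epsilon>" by (simp add: refined_factor_def)
  show 1: "1 \<le> refined_factor n \<epsilon>" if "\<epsilon> * rate n \<ge> 1"
  proof -
    have "1 \<le> (\<epsilon> * rate n) powr (2 / 5)" using that by (intro ge_one_powr_ge_zero) auto
    then show ?thesis unfolding refined_factor_def by (smt (verit) powr_ge_zero mult_nonneg_nonneg)
  qed
  have N1: "?N \<ge> 1" by (simp add: Suc_le_eq)
  then have N4: "1 \<le> 16 * ?N ^ 4" using one_le_power[OF N1, of 4] by linarith
  show "1 / (16 * ?N ^ 4) \<le> refined_factor n \<epsilon>"
  proof (cases "\<epsilon> * rate n \<ge> 1")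
    case True
    have "1 / (16 * ?N ^ 4) \<le> 1" using N4 by simp
    then show ?thesis using 1[OF True] by linarith
  next
    case False
    have "rate n \<le> 1 / \<epsilon>" using False \<epsilon> by (simp add: field_simps)
    with rate_lower[OF L] have "1 / (4 * ?N\<^sup>2) \<le> 1 / \<epsilon>" by linarith
    then have "(1 / (4 * ?N\<^sup>2))\<^sup>2 \<le> (1 / \<epsilon>)\<^sup>2" by (intro power_mono) auto
    also have "(1 / \<epsilon>)\<^sup>2 = \<epsilon> powr (-2)"
      using \<epsilon> by (simp add: powr_minus powr_numeral power_divide inverse_eq_divide)
    finally have "1 / (16 * ?N ^ 4) \<le> \<epsilon> powr (-2)" by (simp add: power_divide power_mult_distrib power_mult[symmetric])
    then show ?thesis using * by linarith
  qed
qed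

text \<open>Each summand of the constant handles one regime: x < 1, y large against ln |I_n|, and y
  small against it. The divisor 8 N of the rate is dictated by the last regime, where exp (-A y)
  must stay above |I_n|^(-1/N).\<close>

lemma absorb_polynomial_factor:
  fixes n :: "nat ^ 'N::finite" and a C P \<beta> \<epsilon> :: real
  defines "N \<equiv> real CARD('N)"
  assumes L: "card (lattice_box n) \<ge> 2" and \<epsilon>: "\<epsilon> > 0" and C: "C > 0" and a: "a > 0" and \<beta>: "\<beta> \<ge> 2 / 5"
    and P1: "P \<le> 1"
    and P: "P \<le> C * (1 + \<epsilon>) * real (card (lattice_box n)) ^ 2 * exp (- a * (\<epsilon> * rate n) powr \<beta>)"
  shows "P \<le> (16 * N ^ 4 * exp (a / (8 * N)) + 27 * C * (1 + 4 * N\<^sup>2) * (4 / a) ^ 3 + (8 / a) ^ 6 * (10 * N) ^ 10)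
    * exp (- (a / (8 * N)) * (\<epsilon> * rate n) powr (2 / 5)) * refined_factor n \<epsilon>"
proof -
  let ?L = "real (card (lattice_box n))" and ?F = "refined_factor n \<epsilon>"
  define x where "x = \<epsilon> * rate n"
  define y where "y = x powr (2 / 5)"
  define A where "A = a / (8 * N)"
  define K1 where "K1 = 16 * N ^ 4 * exp A"
  define K2 where "K2 = 27 * C * (1 + 4 * N\<^sup>2) * (4 / a) ^ 3"
  define K3 where "K3 = (8 / a) ^ 6 * (10 * N) ^ 10"
  have N1: "N \<ge> 1" by (simp add: N_def Suc_le_eq)
  have L2: "?L \<ge> 2" using L by simp
  have lnL: "ln ?L > 0" using L2 by simp
  have r: "rate n > 0" "1 / (4 * N\<^sup>2) \<le> rate n"
    using rate_bounds(1)[OF L] rate_lower[OF L] by (simp_all add: N_def)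
  have x0: "x > 0" using \<epsilon> r by (simp add: x_def)
  have K: "K1 > 0" "K2 > 0" "K3 > 0" using N1 C a by (simp_all add: K1_def K2_def K3_def add_pos_nonneg)
  have A: "0 < A" "A \<le> a / 2" using a N1 by (simp_all add: A_def field_simps)
  note F = refined_factor_lower[OF L \<epsilon>]
  have F0: "?F > 0" using less_le_trans[OF _ F(1)] \<epsilon> by simp
  have "1 \<le> K1 * exp (- A * y) * ?F \<or> P \<le> K2 * exp (- A * y) * ?F \<or> 1 \<le> K3 * exp (- A * y) * ?F"
  proof (cases "x \<ge> 1")
    case False
    have "y \<le> 1" unfolding y_def using False x0 by (intro powr_le1) auto
    then have "1 \<le> exp A * exp (- A * y)" using A by (simp add: exp_add[symmetric])
    moreover have "1 \<le> 16 * N ^ 4 * ?F" using F(3) N1 by (simp add: N_def[symmetric] field_simps)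
    ultimately have "1 * 1 \<le> (exp A * exp (- A * y)) * (16 * N ^ 4 * ?F)" by (intro mult_mono) auto
    then show ?thesis by (simp add: K1_def mult_ac)
  next
    case True
    have F1: "1 \<le> ?F" using F(2) True by (simp add: x_def)
    have y1: "y \<ge> 1" unfolding y_def using True by (intro ge_one_powr_ge_zero) auto
    have xy: "x \<le> y ^ 3"
    proof -
      have "y ^ 3 = x powr (6 / 5)" using x0 by (simp add: y_def powr_realpow[symmetric] powr_powr)
      moreover have "x powr 1 \<le> x powr (6 / 5)" using True by (intro powr_mono) auto
      ultimately show ?thesis using x0 by simp
    qed
    show ?thesis
    \<comment> \<open>With this threshold |I_n|^2 consumes a quarter of the exponent a y. The factor
      1 + \<epsilon>, at most a multiple of y^3, consumes another quarter, and half is left.\<close>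
    proof (cases "8 / a * ln ?L \<le> y")
      case True
      have "?L ^ 2 = exp (2 * ln ?L)" using L2 by (simp add: exp_double)
      also have "\<dots> \<le> exp (a / 4 * y)" using True a by (simp add: field_simps)
      finally have e1: "?L ^ 2 \<le> exp (a / 4 * y)" .
      have "\<epsilon> \<le> 4 * N\<^sup>2 * x"
      proof -
        have "\<epsilon> * 1 \<le> \<epsilon> * (4 * N\<^sup>2 * rate n)" using r N1 \<epsilon> by (intro mult_left_mono) (auto simp: field_simps)
        then show ?thesis by (simp add: x_def mult_ac)
      qed
      then have "1 + \<epsilon> \<le> (1 + 4 * N\<^sup>2) * x" using \<open>x \<ge> 1\<close> by (simp add: distrib_right)
      also have "\<dots> \<le> (1 + 4 * N\<^sup>2) * y ^ 3" using xy by (intro mult_left_mono) auto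
      also have "\<dots> \<le> (1 + 4 * N\<^sup>2) * (27 * (4 / a) ^ 3 * exp (a / 4 * y))"
      proof (rule mult_left_mono)
        have "a / 12 * y \<le> exp (a / 12 * y)" using exp_ge_add_one_self[of "a / 12 * y"] by linarith
        then have "(a / 12 * y) ^ 3 \<le> exp (a / 12 * y) ^ 3" using a y1 by (intro power_mono) auto
        also have "\<dots> = exp (a / 4 * y)" by (simp add: exp_of_nat_mult[symmetric])
        finally have "(12 / a) ^ 3 * (a / 12 * y) ^ 3 \<le> (12 / a) ^ 3 * exp (a / 4 * y)"
          using a by (intro mult_left_mono) auto
        then show "y ^ 3 \<le> 27 * (4 / a) ^ 3 * exp (a / 4 * y)"
          using a by (simp add: power_mult_distrib[symmetric]) (simp add: power_divide)
      qed simp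
      finally have e2: "1 + \<epsilon> \<le> (1 + 4 * N\<^sup>2) * (27 * (4 / a) ^ 3 * exp (a / 4 * y))" .
      have "y \<le> x powr \<beta>" unfolding y_def using \<open>x \<ge> 1\<close> \<beta> by (intro powr_mono) auto
      then have e3: "exp (- a * x powr \<beta>) \<le> exp (- a * y)" using a by simp
      have "P \<le> C * (1 + \<epsilon>) * ?L ^ 2 * exp (- a * x powr \<beta>)" using P by (simp add: x_def)
      also have "\<dots> \<le> C * ((1 + 4 * N\<^sup>2) * (27 * (4 / a) ^ 3 * exp (a / 4 * y))) * exp (a / 4 * y) * exp (- a * y)"
        using e1 e2 e3 C \<epsilon> a by (intro mult_mono) auto
      also have "\<dots> = K2 * (exp (a / 4 * y) * exp (a / 4 * y) * exp (- a * y))" by (simp add: K2_def)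
      also have "exp (a / 4 * y) * exp (a / 4 * y) * exp (- a * y) = exp (- (a / 2) * y)"
        by (simp add: exp_add[symmetric])
      also have "K2 * exp (- (a / 2) * y) \<le> K2 * exp (- A * y)"
        using K mult_right_mono[OF A(2), of y] y1 by (intro mult_left_mono) auto
      also have "\<dots> \<le> K2 * exp (- A * y) * ?F" using mult_left_mono[OF F1, of "K2 * exp (- A * y)"] K by simp
      finally show ?thesis by blast
    next
      case False
      define l R where "l = ln ?L" and "R = ?L powr (1 / N)"
      have R0: "R > 0" using L2 by (simp add: R_def)
      have l0: "l > 0" using lnL by (simp add: l_def)
      have "y ^ 3 \<le> (8 / a * l) ^ 3" using False y1 by (intro power_mono) (auto simp: l_def)
      then have "x \<le> (8 / a * l) ^ 3" using xy by linarith
      moreover have "x = \<epsilon> * R / l\<^sup>2" by (simp add: x_def rate_def R_def l_def N_def)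
      \<comment> \<open>Together with the squared logarithm in \<open>rate\<close> this bounds
        \<epsilon> R by a multiple of l^5. After squaring, l^10 is again at most a multiple of R, so
        one power of R cancels and \<epsilon>^2 R stays bounded.\<close>
      ultimately have "\<epsilon> * R \<le> (8 / a * l) ^ 3 * l\<^sup>2" using l0 by (simp add: divide_le_eq)
      then have "(\<epsilon> * R)\<^sup>2 \<le> ((8 / a * l) ^ 3 * l\<^sup>2)\<^sup>2" using \<epsilon> R0 by (intro power_mono) auto
      also have "\<dots> = (8 / a) ^ 6 * l ^ 10" by (simp only: power_mult_distrib power_mult[symmetric] mult.assoc power_add[symmetric]) simp
      also have "\<dots> \<le> (8 / a) ^ 6 * ((10 * N) ^ 10 * R)"
        using ln_power_le_root[of ?L 10 N] N1 L2 by (intro mult_left_mono) (auto simp: l_def R_def)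
      finally have "R * (\<epsilon>\<^sup>2 * R) \<le> R * K3" by (simp add: K3_def power2_eq_square mult_ac)
      then have "\<epsilon>\<^sup>2 * R \<le> K3" using R0 by simp
      then have "1 \<le> K3 * (1 / R) * (1 / \<epsilon>\<^sup>2)" using R0 \<epsilon> by (simp add: field_simps)
      also have "\<dots> \<le> K3 * exp (- A * y) * ?F"
      proof (intro mult_mono)
        have "A * y \<le> A * (8 / a * l)" using False A by (intro mult_left_mono) (auto simp: l_def)
        also have "\<dots> = l / N" using a N1 by (simp add: A_def)
        finally have "exp (- (l / N)) \<le> exp (- A * y)" by simp
        moreover have "1 / R = exp (- (l / N))" using L2 by (simp add: R_def l_def powr_def exp_minus inverse_eq_divide)
        ultimately show "1 / R \<le> exp (- A * y)" by simp
        have "1 / \<epsilon>\<^sup>2 = \<epsilon> powr (-2)"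
          using \<epsilon> by (simp add: powr_minus powr_numeral inverse_eq_divide)
        then show "1 / \<epsilon>\<^sup>2 \<le> ?F" using F(1) by simp
      qed (use K R0 in auto)
      finally show ?thesis by blast
    qed
  qed
  then have "P \<le> K1 * exp (- A * y) * ?F + K2 * exp (- A * y) * ?F + K3 * exp (- A * y) * ?F"
  proof -
    have "0 \<le> K1 * exp (- A * y) * ?F" "0 \<le> K2 * exp (- A * y) * ?F" "0 \<le> K3 * exp (- A * y) * ?F"
      using K F0 by auto
    moreover assume "1 \<le> K1 * exp (- A * y) * ?F \<or> P \<le> K2 * exp (- A * y) * ?F \<or> 1 \<le> K3 * exp (- A * y) * ?F"
    ultimately show ?thesis using P1 by linarith
  qed
  then show ?thesis by (simp add: K1_def K2_def K3_def A_def y_def x_def distrib_right)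
qed

text \<open>The exponent is divided by \<open>1 + ln K\<close> in order to remove the constant \<open>K\<close>: since \<open>P \<le> 1\<close>, its
  upper bound may be raised to the power \<open>1 / (1 + ln K)\<close>. For \<open>N = 1\<close> this moves the dependence
  on \<open>\<epsilon>\<close> from \<open>A\<^sub>1\<close> to \<open>A\<^sub>2\<close>.\<close>

lemma remove_constant_factor:
  fixes P K F b k y :: real
  assumes P: "0 \<le> P" "P \<le> 1" "P \<le> K * exp (- b * y) * F" and K: "K \<ge> 1" and k: "k \<ge> 1" "1 / k \<le> F"
  shows "P \<le> exp 1 * k * exp (- (b / (1 + ln K)) * y) * F"
proof (cases "P = 0")
  case True
  then show ?thesis using k by (auto intro!: mult_nonneg_nonneg order_trans[OF _ k(2)])
next
  case False
  define t where "t = 1 / (1 + ln K)"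
  have lK: "ln K \<ge> 0" using K by simp
  have t: "0 < t" "t \<le> 1" "ln K * t \<le> 1" using lK by (simp_all add: t_def divide_le_eq)
  have F0: "F > 0" using k by (smt (verit) divide_pos_pos)
  have "P powr 1 \<le> P powr t" using P t by (intro powr_mono') auto
  then have "P \<le> P powr t" using P by simp
  also have "\<dots> \<le> (K * exp (- b * y) * F) powr t" using P t by (intro powr_mono2) auto
  also have "\<dots> = K powr t * exp (- b * y) powr t * F powr t"
    using K F0 by (simp add: powr_mult)
  also have "K powr t = exp (ln K * t)" using K by (simp add: powr_def mult.commute)
  also have "exp (- b * y) powr t = exp (- (b * t) * y)" by (simp add: powr_def mult_ac)
  also have "exp (ln K * t) * exp (- (b * t) * y) * F powr t \<le> exp 1 * exp (- (b * t) * y) * (k * F)"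
  proof (intro mult_mono)
    show "F powr t \<le> k * F"
    proof (cases "F \<ge> 1")
      case True
      have "F powr t \<le> F powr 1" using True t by (intro powr_mono) auto
      also have "\<dots> \<le> k * F" using F0 k by simp
      finally show ?thesis .
    next
      case False
      have "F powr t \<le> 1" using F0 False t by (intro powr_le1) auto
      also have "1 \<le> k * F" using k by (simp add: field_simps)
      finally show ?thesis .
    qed
  qed (use t in auto)
  finally show ?thesis by (simp add: t_def mult_ac)
qed

theorem theorem2p3:
  fixes c\<^sub>0 c\<^sub>1 d\<^sub>0 d\<^sub>1 \<kappa>\<^sub>0 \<kappa>\<^sub>1 \<gamma> C' :: real
  assumes "c\<^sub>0 > 0" "c\<^sub>1 > 0" "d\<^sub>0 > 0" "d\<^sub>1 > 0" "\<kappa>\<^sub>0 > 0" "\<kappa>\<^sub>1 > 0" "\<gamma> > 0" "C' > 0"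
  shows
    "(\<exists>(D::nat) (a :: nat \<Rightarrow> nat \<Rightarrow> real) (A\<^sub>2 :: real \<Rightarrow> real).
       (\<forall>\<epsilon>>0. A\<^sub>2 \<epsilon> > 0) \<and> (CARD('N::finite) \<ge> 2 \<longrightarrow> (\<forall>\<epsilon>>0. A\<^sub>2 \<epsilon> = A\<^sub>2 1)) \<and>
       (\<forall>(M :: 'a measure) (e :: nat \<Rightarrow> 'h::{real_inner, banach, second_countable_topology})
          (Z :: int ^ 'N \<Rightarrow> 'a \<Rightarrow> 'h) (n :: nat ^ 'N) (\<epsilon>::real).
          mixing_hilbert_field c\<^sub>0 c\<^sub>1 d\<^sub>0 d\<^sub>1 \<kappa>\<^sub>0 \<kappa>\<^sub>1 \<gamma> M e Z \<longrightarrow> admissible_size C' n \<longrightarrow> \<epsilon> > 0 \<longrightarrow>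
          mean_exceedance M Z n \<epsilon>
            \<le> (\<Sum>i\<le>D. \<Sum>j\<le>D. a i j * real (card (lattice_box n)) ^ i * \<epsilon> ^ j) *
               exp (- A\<^sub>2 \<epsilon> * (\<epsilon> * rate n) powr (2 * \<gamma> / (2 + 3 * \<gamma>)))))
     \<and>
     (\<gamma> \<ge> 1 \<longrightarrow>
     (\<exists>(A\<^sub>1 :: real) (A\<^sub>2 :: real \<Rightarrow> real).
       A\<^sub>1 > 0 \<and> (\<forall>\<epsilon>>0. A\<^sub>2 \<epsilon> > 0) \<and> (CARD('N::finite) \<ge> 2 \<longrightarrow> (\<forall>\<epsilon>>0. A\<^sub>2 \<epsilon> = A\<^sub>2 1)) \<and>
       (\<forall>(M :: 'a measure) (e :: nat \<Rightarrow> 'h::{real_inner, banach, second_countable_topology})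
          (Z :: int ^ 'N \<Rightarrow> 'a \<Rightarrow> 'h) (n :: nat ^ 'N) (\<epsilon>::real).
          mixing_hilbert_field c\<^sub>0 c\<^sub>1 d\<^sub>0 d\<^sub>1 \<kappa>\<^sub>0 \<kappa>\<^sub>1 \<gamma> M e Z \<longrightarrow> admissible_size C' n \<longrightarrow> \<epsilon> > 0 \<longrightarrow>
          mean_exceedance M Z n \<epsilon>
            \<le> A\<^sub>1 * exp (- A\<^sub>2 \<epsilon> * (\<epsilon> * rate n) powr (2 / 5)) *
               (\<epsilon> powr (-2) + (\<epsilon> * rate n) powr (2 / 5) +
                (rate n) powr (1 / 5) * \<epsilon> powr (-4 / 5)))))"
proof -
  let ?N = "real CARD('N)"
  obtain C :: real and A :: "real \<Rightarrow> real" where C: "C > 0" and A: "\<And>\<epsilon>. \<epsilon> > 0 \<Longrightarrow> A \<epsilon> > 0"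
    and Ac: "\<And>\<epsilon>. CARD('N) \<ge> 2 \<Longrightarrow> A \<epsilon> = A 1"
    and bound: "\<And>(M :: 'a measure) (e :: nat \<Rightarrow> 'h) (Z :: int ^ 'N \<Rightarrow> 'a \<Rightarrow> 'h) n \<epsilon>.
      mixing_hilbert_field c\<^sub>0 c\<^sub>1 d\<^sub>0 d\<^sub>1 \<kappa>\<^sub>0 \<kappa>\<^sub>1 \<gamma> M e Z \<Longrightarrow> admissible_size C' n \<Longrightarrow> \<epsilon> > 0 \<Longrightarrow>
      mean_exceedance M Z n \<epsilon> \<le>
        C * (1 + \<epsilon>) * real (card (lattice_box n)) ^ 2 * exp (- A \<epsilon> * (\<epsilon> * rate n) powr (2 * \<gamma> / (2 + 3 * \<gamma>)))"
    using exceedance_exponential[OF assms, where ?'N = 'N and ?'a = 'a and ?'h = 'h] by blast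
  show ?thesis
  proof (intro conjI impI)
    define a where "a i j = (if i = 2 \<and> j \<le> 1 then C else 0)" for i j :: nat
    have poly: "(\<Sum>i\<le>2. \<Sum>j\<le>2. a i j * x ^ i * \<epsilon> ^ j) = C * (1 + \<epsilon>) * x ^ 2" for x \<epsilon> :: real
      by (simp add: a_def numeral_2_eq_2 atMost_Suc algebra_simps)
    show "\<exists>(D::nat) (a :: nat \<Rightarrow> nat \<Rightarrow> real) (A\<^sub>2 :: real \<Rightarrow> real).
       (\<forall>\<epsilon>>0. A\<^sub>2 \<epsilon> > 0) \<and> (CARD('N) \<ge> 2 \<longrightarrow> (\<forall>\<epsilon>>0. A\<^sub>2 \<epsilon> = A\<^sub>2 1)) \<and>
       (\<forall>(M :: 'a measure) (e :: nat \<Rightarrow> 'h) (Z :: int ^ 'N \<Rightarrow> 'a \<Rightarrow> 'h) (n :: nat ^ 'N) (\<epsilon>::real).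
          mixing_hilbert_field c\<^sub>0 c\<^sub>1 d\<^sub>0 d\<^sub>1 \<kappa>\<^sub>0 \<kappa>\<^sub>1 \<gamma> M e Z \<longrightarrow> admissible_size C' n \<longrightarrow> \<epsilon> > 0 \<longrightarrow>
          mean_exceedance M Z n \<epsilon>
            \<le> (\<Sum>i\<le>D. \<Sum>j\<le>D. a i j * real (card (lattice_box n)) ^ i * \<epsilon> ^ j) *
               exp (- A\<^sub>2 \<epsilon> * (\<epsilon> * rate n) powr (2 * \<gamma> / (2 + 3 * \<gamma>))))"
    proof (rule exI[of _ 2], rule exI[of _ a], rule exI[of _ A], intro conjI allI impI)
      show "A \<epsilon> > 0" if "\<epsilon> > 0" for \<epsilon> using that by (rule A)
      show "A \<epsilon> = A 1" if "CARD('N) \<ge> 2" for \<epsilon> using that by (rule Ac)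
    qed (unfold poly, rule bound)
  next
    assume \<gamma>: "\<gamma> \<ge> 1"
    \<comment> \<open>The value 2/5 is the exponent at \<gamma> = 1, and the exponent increases with
      \<gamma>; this is where \<open>\<gamma> \<ge> 1\<close> enters.\<close>
    have \<beta>: "2 / 5 \<le> 2 * \<gamma> / (2 + 3 * \<gamma>)" using \<gamma> by (simp add: field_simps)
    \<comment> \<open>The leading 1 ensures K \<ge> 1. In dimension one this constant varies with
      \<epsilon> through \<open>A \<epsilon>\<close>, so it has to be moved into the rate.\<close>
    define K where "K a = 1 + (16 * ?N ^ 4 * exp (a / (8 * ?N)) + 27 * C * (1 + 4 * ?N\<^sup>2) * (4 / a) ^ 3 + (8 / a) ^ 6 * (10 * ?N) ^ 10)" for a
    define A2 where "A2 \<epsilon> = A \<epsilon> / (8 * ?N) / (1 + ln (K (A \<epsilon>)))" for \<epsilon>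
    have N1: "?N \<ge> 1" by (simp add: Suc_le_eq)
    have K1: "K a \<ge> 1" if "a > 0" for a using that C by (simp add: K_def)
    have N4: "1 \<le> 16 * ?N ^ 4" using one_le_power[OF N1, of 4] by linarith
    show "\<exists>(A\<^sub>1 :: real) (A\<^sub>2 :: real \<Rightarrow> real).
       A\<^sub>1 > 0 \<and> (\<forall>\<epsilon>>0. A\<^sub>2 \<epsilon> > 0) \<and> (CARD('N) \<ge> 2 \<longrightarrow> (\<forall>\<epsilon>>0. A\<^sub>2 \<epsilon> = A\<^sub>2 1)) \<and>
       (\<forall>(M :: 'a measure) (e :: nat \<Rightarrow> 'h) (Z :: int ^ 'N \<Rightarrow> 'a \<Rightarrow> 'h) (n :: nat ^ 'N) (\<epsilon>::real).
          mixing_hilbert_field c\<^sub>0 c\<^sub>1 d\<^sub>0 d\<^sub>1 \<kappa>\<^sub>0 \<kappa>\<^sub>1 \<gamma> M e Z \<longrightarrow> admissible_size C' n \<longrightarrow> \<epsilon> > 0 \<longrightarrow>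
          mean_exceedance M Z n \<epsilon>
            \<le> A\<^sub>1 * exp (- A\<^sub>2 \<epsilon> * (\<epsilon> * rate n) powr (2 / 5)) *
               (\<epsilon> powr (-2) + (\<epsilon> * rate n) powr (2 / 5) + (rate n) powr (1 / 5) * \<epsilon> powr (-4 / 5)))"
    proof (intro exI conjI allI impI)
      \<comment> \<open>The witness for \<open>A\<^sub>1\<close> depends on N alone: exp 1 bounds
        K^(1/(1 + ln K)), and 16 N^4 is the reciprocal of the uniform lower bound for the
        bracket.\<close>
      show "exp 1 * (16 * ?N ^ 4) > 0" by simp
      show "A2 \<epsilon> > 0" if "\<epsilon> > 0" for \<epsilon>
        using A[OF that] K1[OF A[OF that]] N1 unfolding A2_def by (intro divide_pos_pos) (auto intro: add_pos_nonneg)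
      show "A2 \<epsilon> = A2 1" if "CARD('N) \<ge> 2" for \<epsilon> unfolding A2_def Ac[OF that, of \<epsilon>] ..
      fix M :: "'a measure" and e :: "nat \<Rightarrow> 'h" and Z :: "int ^ 'N \<Rightarrow> 'a \<Rightarrow> 'h" and n :: "nat ^ 'N" and \<epsilon> :: real
      assume mhf: "mixing_hilbert_field c\<^sub>0 c\<^sub>1 d\<^sub>0 d\<^sub>1 \<kappa>\<^sub>0 \<kappa>\<^sub>1 \<gamma> M e Z" and adm: "admissible_size C' n" and \<epsilon>: "\<epsilon> > 0"
      let ?P = "mean_exceedance M Z n \<epsilon>" and ?y = "(\<epsilon> * rate n) powr (2 / 5)"
      interpret prob_space M using mhf by (simp add: mixing_hilbert_field_def)
      have P01: "0 \<le> ?P" "?P \<le> 1" by (simp_all add: mean_exceedance_def)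
      have L: "card (lattice_box n) \<ge> 2" using adm by (simp add: admissible_size_def)
      have F: "1 / (16 * ?N ^ 4) \<le> refined_factor n \<epsilon>" by (rule refined_factor_lower(3)[OF L \<epsilon>])
      have F0: "refined_factor n \<epsilon> \<ge> 0" using order_trans[OF _ F] by simp
      have "?P \<le> (K (A \<epsilon>) - 1) * exp (- (A \<epsilon> / (8 * ?N)) * ?y) * refined_factor n \<epsilon>"
        using absorb_polynomial_factor[OF L \<epsilon> C A[OF \<epsilon>] \<beta> P01(2) bound[OF mhf adm \<epsilon>]] by (simp add: K_def)
      also have "\<dots> \<le> K (A \<epsilon>) * exp (- (A \<epsilon> / (8 * ?N)) * ?y) * refined_factor n \<epsilon>"
        using F0 by (intro mult_right_mono) auto
      finally have "?P \<le> exp 1 * (16 * ?N ^ 4) * exp (- (A \<epsilon> / (8 * ?N) / (1 + ln (K (A \<epsilon>)))) * ?y) * refined_factor n \<epsilon>"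
        by (rule remove_constant_factor[OF P01 _ K1[OF A[OF \<epsilon>]] N4 F])
      then show "?P \<le> exp 1 * (16 * ?N ^ 4) * exp (- A2 \<epsilon> * ?y) *
          (\<epsilon> powr (-2) + ?y + (rate n) powr (1 / 5) * \<epsilon> powr (-4 / 5))"
        by (simp only: A2_def refined_factor_def)
    qed
  qed
qed

end
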